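(* Let $G,H\in\mathcal{A}_0$. The groups $G$ and $H$ are isomorphic if and only if the groups $\mathrm{Mult}\,G$ and $\mathrm{Mult}\,H$ are isomorphic.
   Context: All groups are additively written Abelian groups. A multiplication on a group $G$ is a homomorphism $G\otimes G\to G$; $\mathrm{Mult}\,G=\mathrm{Hom}(G\otimes G,G)$ is the additive group of all multiplications on $G$. A torsion-free group $G$ of finite rank is almost completely decomposable (ACD) if it contains a completely decomposable subgroup (a direct sum of rank-1 groups) of finite index. Its regulator $\mathrm{Reg}\,G$ is the intersection of all its completely decomposable subgroups of least index; it is a completely decomposable, fully invariant subgroup of finite index. For a type $\tau$, $\mathrm{Reg}_\tau G$ denotes the sum of the rank-1 direct summands of type $\tau$ in a given decomposition of $\mathrm{Reg}\,G$ into rank-1 summands, and $T(G)=\{\tau\mid \mathrm{Reg}_\tau G\neq0\}$ is the set of critical types. $G$ is block-rigid if the types in $T(G)$ are pairwise incomparable. $G$ is of ring type if all types in $T(G)$ are idempotent. $\mathcal{A}_0$ is the class of block-rigid ACD groups of ring type with cyclic quotient $G/\mathrm{Reg}\,G$. *)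

theory Defs
  imports
    "HOL-Algebra.Free_Abelian_Groups"
    "HOL-Algebra.Elementary_Groups"
    "HOL-Computational_Algebra.Primes"
    "HOL-Library.Extended_Nat"
begin

text \<open>
  Abelian groups are the \<^const>\<open>comm_group\<close> structures of HOL-Algebra, so they are written
  multiplicatively: \<open>x [^] n\<close> stands for the multiple \<open>n x\<close> and \<open>\<one>\<close> for the zero element.
\<close>

section \<open>The group of multiplications\<close>

definition tensor_relations ::
    "('a, 'm) monoid_scheme \<Rightarrow> ('b, 'n) monoid_scheme \<Rightarrow> ('a \<times> 'b \<Rightarrow>\<^sub>0 int) set" where
  "tensor_relations A B =
     {frag_of (x \<otimes>\<^bsub>A\<^esub> x', y) - frag_of (x, y) - frag_of (x', y) | x x' y.
        x \<in> carrier A \<and> x' \<in> carrier A \<and> y \<in> carrier B} \<union>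
     {frag_of (x, y \<otimes>\<^bsub>B\<^esub> y') - frag_of (x, y) - frag_of (x, y') | x y y'.
        x \<in> carrier A \<and> y \<in> carrier B \<and> y' \<in> carrier B}"

definition tensor_product ::
    "('a, 'm) monoid_scheme \<Rightarrow> ('b, 'n) monoid_scheme \<Rightarrow> ('a \<times> 'b \<Rightarrow>\<^sub>0 int) set monoid" where
  "tensor_product A B =
     (let F = free_Abelian_group (carrier A \<times> carrier B)
      in F Mod generate F (tensor_relations A B))"

text \<open>
  Homomorphisms are required to be extensional, since the members of \<^term>\<open>hom A B\<close> take
  arbitrary values outside \<^term>\<open>carrier A\<close>.
\<close>

definition hom_group ::
    "('a, 'm) monoid_scheme \<Rightarrow> ('b, 'n) monoid_scheme \<Rightarrow> ('a \<Rightarrow> 'b) monoid" where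
  "hom_group A B =
     \<lparr>carrier = hom A B \<inter> extensional (carrier A),
      monoid.mult = (\<lambda>f g. \<lambda>x\<in>carrier A. f x \<otimes>\<^bsub>B\<^esub> g x),
      one = (\<lambda>x\<in>carrier A. \<one>\<^bsub>B\<^esub>)\<rparr>"

definition Mult :: "('a, 'm) monoid_scheme \<Rightarrow> (('a \<times> 'a \<Rightarrow>\<^sub>0 int) set \<Rightarrow> 'a) monoid" where
  "Mult G = hom_group (tensor_product G G) G"

lemma comm_group_hom_group:
  assumes "group A" "comm_group B"
  shows "comm_group (hom_group A B)"
proof -
  interpret A: group A by fact
  interpret B: comm_group B by fact
  show ?thesis
  proof (rule comm_groupI)
    fix f g h
    assume f: "f \<in> carrier (hom_group A B)" and g: "g \<in> carrier (hom_group A B)"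
    then have F: "f \<in> hom A B" "f \<in> extensional (carrier A)"
      and G: "g \<in> hom A B" "g \<in> extensional (carrier A)" by (auto simp: hom_group_def)
    have cl: "\<And>x. x \<in> carrier A \<Longrightarrow> f x \<in> carrier B" "\<And>x. x \<in> carrier A \<Longrightarrow> g x \<in> carrier B"
      using F G by (auto simp: hom_in_carrier)
    show "f \<otimes>\<^bsub>hom_group A B\<^esub> g \<in> carrier (hom_group A B)"
      using cl by (auto simp: hom_group_def intro!: homI)
        (simp add: hom_mult[OF F(1)] hom_mult[OF G(1)] B.m_ac)
    show "f \<otimes>\<^bsub>hom_group A B\<^esub> g = g \<otimes>\<^bsub>hom_group A B\<^esub> f"
      using cl by (auto simp: hom_group_def B.m_comm intro!: restrict_ext)
    show "\<one>\<^bsub>hom_group A B\<^esub> \<otimes>\<^bsub>hom_group A B\<^esub> f = f"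
      using cl F(2) by (auto simp: hom_group_def extensional_def fun_eq_iff)
    show "f \<otimes>\<^bsub>hom_group A B\<^esub> g \<otimes>\<^bsub>hom_group A B\<^esub> h =
          f \<otimes>\<^bsub>hom_group A B\<^esub> (g \<otimes>\<^bsub>hom_group A B\<^esub> h)"
      if "h \<in> carrier (hom_group A B)"
    proof -
      have "\<And>x. x \<in> carrier A \<Longrightarrow> h x \<in> carrier B"
        using that by (auto simp: hom_group_def hom_in_carrier)
      with cl show ?thesis by (auto simp: hom_group_def B.m_assoc intro!: restrict_ext)
    qed
    show "\<exists>g\<in>carrier (hom_group A B). g \<otimes>\<^bsub>hom_group A B\<^esub> f = \<one>\<^bsub>hom_group A B\<^esub>"
    proof
      show "(\<lambda>x\<in>carrier A. inv\<^bsub>B\<^esub> f x) \<in> carrier (hom_group A B)"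
        using cl by (auto simp: hom_group_def intro!: homI)
          (simp add: hom_mult[OF F(1)] B.inv_mult)
      show "(\<lambda>x\<in>carrier A. inv\<^bsub>B\<^esub> f x) \<otimes>\<^bsub>hom_group A B\<^esub> f = \<one>\<^bsub>hom_group A B\<^esub>"
        using cl by (auto simp: hom_group_def intro!: restrict_ext)
    qed
  next
    show "\<one>\<^bsub>hom_group A B\<^esub> \<in> carrier (hom_group A B)"
      by (auto simp: hom_group_def intro!: homI)
  qed
qed

section \<open>Rank\<close>

definition torsion_free_group :: "('a, 'm) monoid_scheme \<Rightarrow> bool" where
  "torsion_free_group G \<longleftrightarrow> comm_group G \<and>
     (\<forall>x\<in>carrier G. \<forall>n::nat. n > 0 \<longrightarrow> x [^]\<^bsub>G\<^esub> n = \<one>\<^bsub>G\<^esub> \<longrightarrow> x = \<one>\<^bsub>G\<^esub>)"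

definition independent_in :: "('a, 'm) monoid_scheme \<Rightarrow> 'a set \<Rightarrow> bool" where
  "independent_in G S \<longleftrightarrow> S \<subseteq> carrier G \<and>
     (\<forall>F (c :: 'a \<Rightarrow> int). finite F \<and> F \<subseteq> S \<and> finprod G (\<lambda>x. x [^]\<^bsub>G\<^esub> c x) F = \<one>\<^bsub>G\<^esub> \<longrightarrow>
        (\<forall>x\<in>F. c x = 0))"

text \<open>The rank of a torsion-free group is the size of a maximal independent subset.\<close>

definition has_rank :: "('a, 'm) monoid_scheme \<Rightarrow> nat \<Rightarrow> bool" where
  "has_rank G n \<longleftrightarrow>
     (\<exists>S. independent_in G S \<and> (\<forall>S'. independent_in G S' \<and> S \<subseteq> S' \<longrightarrow> S' = S) \<and>
          finite S \<and> card S = n)"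

definition rank1_group :: "('a, 'm) monoid_scheme \<Rightarrow> bool" where
  "rank1_group G \<longleftrightarrow> torsion_free_group G \<and> has_rank G 1"

section \<open>Types\<close>

text \<open>
  A characteristic assigns a value in \<^typ>\<open>enat\<close> to every prime; values at non-primes are ignored
  throughout.  Two characteristics are equivalent if they differ at only finitely many primes
  and are finite wherever they differ.  Types are the equivalence classes.
\<close>

definition char_equiv :: "(nat \<Rightarrow> enat) \<Rightarrow> (nat \<Rightarrow> enat) \<Rightarrow> bool" where
  "char_equiv \<chi> \<psi> \<longleftrightarrow> finite {p. prime p \<and> \<chi> p \<noteq> \<psi> p} \<and>
     (\<forall>p. prime p \<and> \<chi> p \<noteq> \<psi> p \<longrightarrow> \<chi> p \<noteq> \<infinity> \<and> \<psi> p \<noteq> \<infinity>)"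

lemma equivp_char_equiv: "equivp char_equiv"
proof (rule equivpI)
  show "reflp char_equiv" by (simp add: reflp_def char_equiv_def)
  show "symp char_equiv" by (auto simp: symp_def char_equiv_def eq_commute)
  show "transp char_equiv"
  proof (rule transpI)
    fix f g h assume fg: "char_equiv f g" and gh: "char_equiv g h"
    have "{p. prime p \<and> f p \<noteq> h p} \<subseteq> {p. prime p \<and> f p \<noteq> g p} \<union> {p. prime p \<and> g p \<noteq> h p}"
      by force
    moreover have "finite ({p. prime p \<and> f p \<noteq> g p} \<union> {p. prime p \<and> g p \<noteq> h p})"
      using fg gh unfolding char_equiv_def by blast
    ultimately have "finite {p. prime p \<and> f p \<noteq> h p}" by (rule finite_subset)
    moreover have "f p \<noteq> \<infinity> \<and> h p \<noteq> \<infinity>" if "prime p" "f p \<noteq> h p" for p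
    proof (cases "f p = g p")
      case True
      then show ?thesis using that gh unfolding char_equiv_def by simp
    next
      case fg': False
      then have "f p \<noteq> \<infinity>" "g p \<noteq> \<infinity>" using that fg unfolding char_equiv_def by blast+
      then show ?thesis using that gh unfolding char_equiv_def by (cases "g p = h p") auto
    qed
    ultimately show "char_equiv f h" by (auto simp: char_equiv_def)
  qed
qed

quotient_type htype = "nat \<Rightarrow> enat" / char_equiv
  by (rule equivp_char_equiv)

definition type_le :: "htype \<Rightarrow> htype \<Rightarrow> bool" where
  "type_le s t \<longleftrightarrow> (\<exists>\<chi> \<psi>. s = abs_htype \<chi> \<and> t = abs_htype \<psi> \<and> (\<forall>p. prime p \<longrightarrow> \<chi> p \<le> \<psi> p))"

lift_definition type_mult :: "htype \<Rightarrow> htype \<Rightarrow> htype" is "\<lambda>\<chi> \<psi> p. \<chi> p + \<psi> p"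
proof -
  fix f f' g g' assume f: "char_equiv f f'" and g: "char_equiv g g'"
  have "finite {p. prime p \<and> f p + g p \<noteq> f' p + g' p}"
    by (rule finite_subset[of _ "{p. prime p \<and> f p \<noteq> f' p} \<union> {p. prime p \<and> g p \<noteq> g' p}"])
       (use f g in \<open>auto simp: char_equiv_def\<close>)
  moreover have "f p + g p \<noteq> \<infinity> \<and> f' p + g' p \<noteq> \<infinity>"
    if "prime p" "f p + g p \<noteq> f' p + g' p" for p
    using that f g unfolding char_equiv_def by (metis plus_eq_infty_iff_enat)
  ultimately show "char_equiv (\<lambda>p. f p + g p) (\<lambda>p. f' p + g' p)"
    by (auto simp: char_equiv_def)
qed

definition idempotent_type :: "htype \<Rightarrow> bool" where
  "idempotent_type t \<longleftrightarrow> type_mult t t = t"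

lemma idempotent_type_iff:
  "idempotent_type t \<longleftrightarrow> (\<exists>\<chi>. t = abs_htype \<chi> \<and> (\<forall>p. prime p \<longrightarrow> \<chi> p \<in> {0, \<infinity>}))"
proof
  assume t: "idempotent_type t"
  obtain \<psi> where \<psi>: "t = abs_htype \<psi>" by (metis Quotient3_abs_rep Quotient3_htype)
  have dbl: "n + n = n \<longleftrightarrow> n \<in> {0, \<infinity>}" for n :: enat
    by (cases n) (auto simp: zero_enat_def)
  have e: "char_equiv (\<lambda>p. \<psi> p + \<psi> p) \<psi>"
    using t unfolding idempotent_type_def \<psi> type_mult.abs_eq htype.abs_eq_iff .
  have "char_equiv (\<lambda>p. if \<psi> p = \<infinity> then \<infinity> else 0) \<psi>"
    using e unfolding char_equiv_def dbl
    by (auto elim!: rev_finite_subset simp: zero_enat_def)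
  then show "\<exists>\<chi>. t = abs_htype \<chi> \<and> (\<forall>p. prime p \<longrightarrow> \<chi> p \<in> {0, \<infinity>})"
    unfolding \<psi> by (intro exI[of _ "\<lambda>p. if \<psi> p = \<infinity> then \<infinity> else 0"])
      (auto simp: htype.abs_eq_iff equivp_symp[OF equivp_char_equiv])
next
  assume "\<exists>\<chi>. t = abs_htype \<chi> \<and> (\<forall>p. prime p \<longrightarrow> \<chi> p \<in> {0, \<infinity>})"
  then obtain \<chi> where t: "t = abs_htype \<chi>" and \<chi>: "\<And>p. prime p \<Longrightarrow> \<chi> p \<in> {0, \<infinity>}" by blast
  have eq: "\<chi> p + \<chi> p = \<chi> p" if "prime p" for p using \<chi>[OF that] by auto
  have none: "{p. prime p \<and> \<chi> p + \<chi> p \<noteq> \<chi> p} = {}" using eq by blast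
  have "char_equiv (\<lambda>p. \<chi> p + \<chi> p) \<chi>"
    unfolding char_equiv_def none using eq by blast
  then show "idempotent_type t"
    by (simp add: idempotent_type_def t type_mult.abs_eq htype.abs_eq_iff)
qed

definition height :: "('a, 'm) monoid_scheme \<Rightarrow> 'a \<Rightarrow> nat \<Rightarrow> enat" where
  "height A g p = (SUP k \<in> {k. \<exists>y\<in>carrier A. y [^]\<^bsub>A\<^esub> (p ^ k) = g}. enat k)"

text \<open>In a rank-1 group all nonzero elements have equivalent characteristics.\<close>

definition group_type :: "('a, 'm) monoid_scheme \<Rightarrow> htype" where
  "group_type A = abs_htype (height A (SOME g. g \<in> carrier A \<and> g \<noteq> \<one>\<^bsub>A\<^esub>))"

section \<open>Completely decomposable and almost completely decomposable groups\<close>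

definition internal_direct_sum :: "('a, 'm) monoid_scheme \<Rightarrow> 'a set set \<Rightarrow> bool" where
  "internal_direct_sum C \<D> \<longleftrightarrow> (\<forall>A\<in>\<D>. subgroup A C) \<and>
     (\<lambda>x. gfinprod C x \<D>) \<in> iso (sum_group \<D> (\<lambda>A. C\<lparr>carrier := A\<rparr>)) C"

definition rank1_decomposition :: "('a, 'm) monoid_scheme \<Rightarrow> 'a set set \<Rightarrow> bool" where
  "rank1_decomposition C \<D> \<longleftrightarrow>
     internal_direct_sum C \<D> \<and> (\<forall>A\<in>\<D>. rank1_group (C\<lparr>carrier := A\<rparr>))"

definition completely_decomposable :: "('a, 'm) monoid_scheme \<Rightarrow> bool" where
  "completely_decomposable C \<longleftrightarrow> comm_group C \<and> (\<exists>\<D>. rank1_decomposition C \<D>)"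

text \<open>
  Finiteness of the index is part of the definition, because \<^const>\<open>card\<close> is \<open>0\<close> on infinite sets.
\<close>

definition cd_finite_index_subgroups :: "('a, 'm) monoid_scheme \<Rightarrow> 'a set set" where
  "cd_finite_index_subgroups G =
     {C. subgroup C G \<and> completely_decomposable (G\<lparr>carrier := C\<rparr>) \<and> finite (rcosets\<^bsub>G\<^esub> C)}"

definition ACD_group :: "('a, 'm) monoid_scheme \<Rightarrow> bool" where
  "ACD_group G \<longleftrightarrow> torsion_free_group G \<and> (\<exists>n. has_rank G n) \<and> cd_finite_index_subgroups G \<noteq> {}"

definition regulator :: "('a, 'm) monoid_scheme \<Rightarrow> 'a set" where
  "regulator G =
     \<Inter> {C \<in> cd_finite_index_subgroups G.
          \<forall>C'\<in>cd_finite_index_subgroups G. card (rcosets\<^bsub>G\<^esub> C) \<le> card (rcosets\<^bsub>G\<^esub> C')}"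

abbreviation Reg :: "('a, 'm) monoid_scheme \<Rightarrow> ('a, 'm) monoid_scheme" where
  "Reg G \<equiv> G\<lparr>carrier := regulator G\<rparr>"

definition type_component :: "('a, 'm) monoid_scheme \<Rightarrow> 'a set set \<Rightarrow> htype \<Rightarrow> 'a set" where
  "type_component C \<D> \<tau> = generate C (\<Union> {A \<in> \<D>. group_type (C\<lparr>carrier := A\<rparr>) = \<tau>})"

text \<open>
  The components depend on the decomposition of the regulator, but whether the component of a given
  type vanishes does not.
\<close>

definition critical_types :: "('a, 'm) monoid_scheme \<Rightarrow> htype set" where
  "critical_types G =
     {\<tau>. \<exists>\<D>. rank1_decomposition (Reg G) \<D> \<and> type_component (Reg G) \<D> \<tau> \<noteq> {\<one>\<^bsub>G\<^esub>}}"

definition block_rigid :: "('a, 'm) monoid_scheme \<Rightarrow> bool" where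
  "block_rigid G \<longleftrightarrow>
     (\<forall>\<sigma>\<in>critical_types G. \<forall>\<tau>\<in>critical_types G. \<sigma> \<noteq> \<tau> \<longrightarrow> \<not> type_le \<sigma> \<tau> \<and> \<not> type_le \<tau> \<sigma>)"

definition of_ring_type :: "('a, 'm) monoid_scheme \<Rightarrow> bool" where
  "of_ring_type G \<longleftrightarrow> (\<forall>\<tau>\<in>critical_types G. idempotent_type \<tau>)"

definition class_A0 :: "('a, 'm) monoid_scheme \<Rightarrow> bool" where
  "class_A0 G \<longleftrightarrow> ACD_group G \<and> block_rigid G \<and> of_ring_type G \<and> cyclic_group (G Mod regulator G)"

end

theory Submission
  imports Defs "HOL-Library.Function_Algebras" "HOL-Algebra.Multiplicative_Group"
begin

text \<open>
  Write \<open>R\<^sub>t = \<int>[1/p : p \<in> t]\<close> for a set \<open>t\<close> of primes.  Since \<open>G\<close> has ring type and a cyclic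
  regulator quotient, it is, after a change of basis in each homogeneous component of the regulator, the
  group generated by a direct sum of copies of the rings \<open>R\<^sub>t\<close> together with one vector
  \<open>\<Sum>\<^sub>t (s\<^sub>t / m\<^sub>t) e\<^sub>t\<close>, where \<open>e\<^sub>t\<close> is one basis element of the component of type \<open>t\<close>, the integers
  \<open>m\<^sub>t\<close> and \<open>s\<^sub>t\<close> are coprime, and \<open>m\<^sub>t\<close> has no prime factor in \<open>t\<close>.  The isomorphism class of such a
  group is determined by the types \<open>t\<close>, the ranks \<open>r\<^sub>t\<close> and the denominators \<open>m\<^sub>t\<close>, together with the
  numerators \<open>s\<^sub>t\<close> for \<open>r\<^sub>t = 1\<close>, modulo \<open>m\<^sub>t\<close>, up to units of \<open>R\<^sub>t\<close> and one common factor.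

  Because the types are incomparable, a multiplication is a family of \<open>R\<^sub>t\<close>-bilinear maps on the
  homogeneous components.  Computing the divisibility conditions on their structure constants shows that
  \<open>Mult G\<close> is a group of the same form, with ranks \<open>r\<^sub>t\<^sup>3\<close>, the same denominators and numerators
  inverse to \<open>s\<^sub>t\<close> modulo \<open>m\<^sub>t\<close>.  From these data those of \<open>G\<close> can be recovered.
\<close>

section \<open>Localizations of the integers\<close>

text \<open>The numerators invert because a product meets the extra vector twice. At the basis
  element carrying s/m, write the structure constant as m^2 F. The product of the extra vector with
  itself then has coordinate (s/m)^2 m^2 F = s^2 F there, and modulo R_t this must be k s/m, with
  one integer k for all types. Hence F is k r/m modulo R_t, where r inverts s modulo m. The way back
  inverts the numerators, the common factor and the units, and the sizes are cube roots; r_t^3 = 1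
  exactly when r_t = 1.

  Numerators count only for r_t = 1: a second basis element in the block leaves room for an integral
  matrix of determinant 1 that turns s into any other numerator coprime to m.

  The denominators are governed by a purity condition: each m_t divides the least common multiple of
  the others. It comes from the minimal index of the regulator, and it ensures that an element of
  the group supported in a single block has no denominators. This makes isomorphisms and
  multiplications matrices over the rings R_t.\<close>

definition dens :: "nat set \<Rightarrow> nat set" where
  "dens P = {b. b > 0 \<and> (\<forall>p. prime p \<longrightarrow> p dvd b \<longrightarrow> p \<in> P)}"

lemma dens_1 [simp]: "Suc 0 \<in> dens P"
  by (auto simp: dens_def)

lemma dens_pos: "b \<in> dens P \<Longrightarrow> b > 0"
  by (simp add: dens_def)

lemma dens_mult: "a \<in> dens P \<Longrightarrow> b \<in> dens P \<Longrightarrow> a * b \<in> dens P"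
  by (auto simp: dens_def prime_dvd_mult_iff)

definition loc :: "nat set \<Rightarrow> rat set" where
  "loc P = {of_int a / of_nat b | a b. b \<in> dens P}"

lemma locI: "b \<in> dens P \<Longrightarrow> of_int a / of_nat b \<in> loc P"
  unfolding loc_def by blast

lemma locE:
  assumes "q \<in> loc P"
  obtains a b where "q = of_int a / of_nat b" "b \<in> dens P"
  using assms unfolding loc_def by blast

lemma loc_of_int [simp, intro]: "of_int a \<in> loc P"
  using locI[of 1 P a] by auto

lemma loc_0 [simp, intro]: "0 \<in> loc P" and loc_1 [simp, intro]: "1 \<in> loc P"
  using loc_of_int[of 0 P] loc_of_int[of 1 P] by auto

lemma loc_add [intro]:
  assumes "x \<in> loc P" "y \<in> loc P"
  shows "x + y \<in> loc P"
proof -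
  obtain a b where 1: "x = of_int a / of_nat b" "b \<in> dens P"
    using assms(1) by (rule locE)
  obtain c d where 2: "y = of_int c / of_nat d" "d \<in> dens P"
    using assms(2) by (rule locE)
  have "x + y = of_int (a * int d + c * int b) / of_nat (b * d)"
    using dens_pos[OF 1(2)] dens_pos[OF 2(2)] by (simp add: 1 2 field_simps)
  moreover have "\<dots> \<in> loc P"
    by (intro locI dens_mult 1 2)
  ultimately show ?thesis by simp
qed

lemma loc_mult [intro]:
  assumes "x \<in> loc P" "y \<in> loc P"
  shows "x * y \<in> loc P"
proof -
  obtain a b where 1: "x = of_int a / of_nat b" "b \<in> dens P"
    using assms(1) by (rule locE)
  obtain c d where 2: "y = of_int c / of_nat d" "d \<in> dens P"
    using assms(2) by (rule locE)
  have "x * y = of_int (a * c) / of_nat (b * d)"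
    by (simp add: 1 2)
  moreover have "\<dots> \<in> loc P"
    by (intro locI dens_mult 1 2)
  ultimately show ?thesis by simp
qed

lemma loc_uminus [intro]: "x \<in> loc P \<Longrightarrow> - x \<in> loc P"
  using loc_mult[OF loc_of_int[of "-1" P], of x] by simp

lemma loc_diff [intro]: "x \<in> loc P \<Longrightarrow> y \<in> loc P \<Longrightarrow> x - y \<in> loc P"
  using loc_add[of x P "- y"] loc_uminus[of y P] by simp

lemma loc_sum: "(\<And>i. i \<in> A \<Longrightarrow> f i \<in> loc P) \<Longrightarrow> sum f A \<in> loc P"
  by (induction A rule: infinite_finite_induct) auto

lemma loc_inverse_prime:
  assumes "prime p" "p \<in> P"
  shows "1 / of_nat p \<in> loc P"
  using locI[of p P 1] assms by (auto simp: dens_def prime_gt_0_nat dest: primes_dvd_imp_eq)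

lemma loc_divide_power:
  assumes "prime p" "p \<in> P" "x \<in> loc P"
  shows "x / of_nat p ^ k \<in> loc P"
proof (induction k)
  case (Suc k)
  have "x / of_nat p ^ Suc k = x / of_nat p ^ k * (1 / of_nat p)" by simp
  then show ?case using loc_mult[OF Suc loc_inverse_prime] assms by metis
qed (use assms in simp)

definition coprime_to :: "nat set \<Rightarrow> int \<Rightarrow> bool" where
  "coprime_to P m \<longleftrightarrow> m > 0 \<and> (\<forall>p\<in>P. prime p \<longrightarrow> \<not> int p dvd m)"

lemma coprime_to_coprime:
  assumes "coprime_to P m" and "b \<in> dens P"
  shows "coprime (int b) m"
proof (rule ccontr)
  assume "\<not> coprime (int b) m"
  then have "gcd (int b) m \<noteq> 1" using coprime_iff_gcd_eq_1 by blast
  then have "nat (gcd (int b) m) \<noteq> 1" by simp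
  then obtain p where p: "prime p" "p dvd nat (gcd (int b) m)"
    using prime_factor_nat by blast
  then have "int p dvd gcd (int b) m"
    by (metis gcd_ge_0_int nat_0_le of_nat_dvd_iff)
  then have "p dvd b" "int p dvd m" by auto
  with p assms show False unfolding coprime_to_def dens_def by blast
qed

text \<open>Elements of \<open>dens P\<close> are invertible modulo \<open>m\<close>, so they cannot
  cancel it. Integrality conditions on generator coordinates become integer divisibilities in this
  way.\<close>

lemma loc_frac_iff:
  assumes "coprime_to P m"
  shows "of_int a / of_int m \<in> loc P \<longleftrightarrow> m dvd a"
proof
  have m: "m > 0" using assms by (simp add: coprime_to_def)
  assume "of_int a / of_int m \<in> loc P"
  then obtain c b where 1: "of_int a / of_int m = (of_int c / of_nat b :: rat)" "b \<in> dens P"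
    by (rule locE)
  then have "of_int (a * int b) = (of_int (c * m) :: rat)"
    using m dens_pos[OF 1(2)] by (simp add: field_simps)
  then have "a * int b = c * m" by (simp only: of_int_eq_iff)
  then have "m dvd a * int b" by simp
  then show "m dvd a"
    using coprime_to_coprime[OF assms 1(2)] by (simp add: coprime_dvd_mult_left_iff coprime_commute)
next
  assume "m dvd a"
  then obtain k where "a = m * k" by blast
  moreover have "m \<noteq> 0" using assms by (simp add: coprime_to_def)
  ultimately show "of_int a / of_int m \<in> loc P" by simp
qed

text \<open>Otherwise clearing the denominator of \<open>x * of_nat N\<close> leaves a nonzero
  integer divisible by every power of \<open>p\<close>. The factor \<open>N\<close> absorbs the
  bounded denominators that elements of a model group have beyond \<open>loc P\<close>.\<close>

lemma loc_of_all_powers: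
  assumes "prime p" "N > 0" "\<And>k. x * of_nat N / of_nat p ^ k \<in> loc P" "x \<noteq> 0"
  shows "p \<in> P"
proof (rule ccontr)
  assume np: "p \<notin> P"
  obtain a b where ab: "x * of_nat N = of_int a / of_nat b" "b \<in> dens P"
    using assms(3)[of 0] unfolding power_0 div_by_1 by (rule locE)
  have a: "a \<noteq> 0" using ab assms by auto
  have "int p ^ k dvd a" for k
  proof -
    have "of_nat b * (x * of_nat N / of_nat p ^ k) \<in> loc P"
      using loc_mult[OF loc_of_int[of "int b"] assms(3)] by simp
    also have "of_nat b * (x * of_nat N / of_nat p ^ k) = of_int a / of_int (int p ^ k)"
      using ab dens_pos[OF ab(2)] by simp
    finally have *: "of_int a / of_int (int p ^ k) \<in> loc P" .
    have "coprime_to P (int p ^ k)"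
      unfolding coprime_to_def
    proof (intro conjI ballI impI notI)
      fix q assume q: "q \<in> P" "prime q" "int q dvd int p ^ k"
      then have "q dvd p ^ k" by (metis of_nat_dvd_iff of_nat_power)
      then have "q = p" using q(2) assms(1) by (metis prime_dvd_power primes_dvd_imp_eq)
      with q np show False by simp
    qed (use assms(1) in \<open>simp add: prime_gt_0_nat\<close>)
    then show ?thesis using loc_frac_iff * by blast
  qed
  moreover have "\<exists>k. \<bar>a\<bar> < int p ^ k"
  proof
    have "\<bar>a\<bar> < 2 ^ nat \<bar>a\<bar>"
      by (metis abs_ge_zero int_nat_eq less_exp of_nat_less_iff of_nat_numeral of_nat_power)
    also have "\<dots> \<le> int p ^ nat \<bar>a\<bar>"
      using prime_ge_2_nat[OF assms(1)] by (intro power_mono) auto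
    finally show "\<bar>a\<bar> < int p ^ nat \<bar>a\<bar>" .
  qed
  ultimately show False
    using a by (metis abs_of_nat dvd_imp_le_int linorder_not_less of_nat_power)
qed

section \<open>Additive groups of rational vectors\<close>

definition vec_group :: "('i \<Rightarrow> rat) set \<Rightarrow> ('i \<Rightarrow> rat) monoid" where
  "vec_group X = \<lparr>carrier = X, monoid.mult = (+), one = 0\<rparr>"

lemma vec_group_simps [simp]:
  "carrier (vec_group X) = X" "x \<otimes>\<^bsub>vec_group X\<^esub> y = x + y" "\<one>\<^bsub>vec_group X\<^esub> = 0"
  by (auto simp: vec_group_def)

lemma common_denominator:
  fixes x :: "'i \<Rightarrow> rat"
  assumes "finite I"
  shows "\<exists>K>0::nat. \<forall>i\<in>I. \<exists>z. of_nat K * x i = of_int z"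
  using assms
proof (induction I rule: finite_induct)
  case (insert i F)
  then obtain K where K: "K > 0" "\<forall>i\<in>F. \<exists>z. of_nat K * x i = of_int z" by blast
  obtain a b where ab: "x i = of_int a / of_int b" "b > 0" by (metis Rat_cases Fract_of_int_quotient)
  show ?case
  proof (intro exI[of _ "K * nat b"] conjI ballI)
    fix j assume j: "j \<in> insert i F"
    show "\<exists>z. of_nat (K * nat b) * x j = of_int z"
    proof (cases "j = i")
      case True
      then have "of_nat (K * nat b) * x j = of_int (int K * a)" using ab by simp
      then show ?thesis by blast
    next
      case False
      then obtain z where "of_nat K * x j = of_int z" using K j by blast
      then have "of_nat (K * nat b) * x j = of_int (b * z)" using ab by (simp add: mult_ac)
      then show ?thesis by blast
    qed
  qed (use K ab in simp)
qed auto

definition unit_vec :: "'i \<Rightarrow> 'i \<Rightarrow> rat" where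
  "unit_vec i = (\<lambda>j. of_bool (j = i))"

text \<open>Subgroups of full rank among the rational vectors supported on \<open>I\<close>; they
  need not be discrete. Model groups and the enlarged subgroup in the minimality argument for the
  regulator are both instances.\<close>

locale lattice_set =
  fixes I :: "'i set" and X :: "('i \<Rightarrow> rat) set"
  assumes finI: "finite I"
    and zero_in: "0 \<in> X"
    and add_in: "x \<in> X \<Longrightarrow> y \<in> X \<Longrightarrow> x + y \<in> X"
    and minus_in: "x \<in> X \<Longrightarrow> - x \<in> X"
    and supp: "x \<in> X \<Longrightarrow> i \<notin> I \<Longrightarrow> x i = 0"
    and unit_in: "i \<in> I \<Longrightarrow> unit_vec i \<in> X"
begin

lemma nmult_in: "x \<in> X \<Longrightarrow> (\<lambda>i. of_nat k * x i) \<in> X"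
proof (induction k)
  case 0
  then show ?case using zero_in by (simp add: zero_fun_def)
next
  case (Suc k)
  have "(\<lambda>i. of_nat (Suc k) * x i) = x + (\<lambda>i. of_nat k * x i)"
    by (auto simp: fun_eq_iff algebra_simps)
  then show ?case using add_in Suc by simp
qed

lemma zmult_in: "x \<in> X \<Longrightarrow> (\<lambda>i. of_int k * x i) \<in> X"
proof (cases "k \<ge> 0")
  case True
  then show "x \<in> X \<Longrightarrow> ?thesis" using nmult_in[of x "nat k"] by simp
next
  case False
  have "(\<lambda>i. of_int k * x i) = - (\<lambda>i. of_nat (nat (- k)) * x i)"
    using False by (auto simp: fun_eq_iff fun_Compl_def)
  then show "x \<in> X \<Longrightarrow> ?thesis" using nmult_in[of x "nat (- k)"] minus_in by simp
qed

lemma comm_group_vec_group: "comm_group (vec_group X)"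
proof (rule comm_groupI)
  show "\<exists>y\<in>carrier (vec_group X). y \<otimes>\<^bsub>vec_group X\<^esub> x = \<one>\<^bsub>vec_group X\<^esub>"
    if "x \<in> carrier (vec_group X)" for x
    using that minus_in by (intro bexI[of _ "- x"]) auto
qed (simp_all add: add_in zero_in add_ac)

context
  fixes g :: "('i \<Rightarrow> rat) \<Rightarrow> rat"
  assumes g_add: "\<And>x y. x \<in> X \<Longrightarrow> y \<in> X \<Longrightarrow> g (x + y) = g x + g y"
begin

lemma additive_zero: "g 0 = 0"
  using g_add[OF zero_in zero_in] by simp

lemma additive_minus: "x \<in> X \<Longrightarrow> g (- x) = - g x"
  using g_add[OF _ minus_in, of x x] additive_zero by simp

lemma additive_nmult: "x \<in> X \<Longrightarrow> g (\<lambda>i. of_nat k * x i) = of_nat k * g x"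
proof (induction k)
  case 0
  then show ?case using additive_zero by (simp add: zero_fun_def)
next
  case (Suc k)
  have eq: "(\<lambda>i. of_nat (Suc k) * x i) = x + (\<lambda>i. of_nat k * x i)"
    by (auto simp: fun_eq_iff algebra_simps)
  show ?case
    unfolding eq g_add[OF Suc.prems nmult_in[OF Suc.prems]] Suc.IH[OF Suc.prems]
    by (simp add: algebra_simps)
qed

lemma additive_zmult: "x \<in> X \<Longrightarrow> g (\<lambda>i. of_int k * x i) = of_int k * g x"
proof (cases "k \<ge> 0")
  case True
  then show "x \<in> X \<Longrightarrow> ?thesis" using additive_nmult[of x "nat k"] by simp
next
  case False
  have eq: "(\<lambda>i. of_int k * x i) = - (\<lambda>i. of_nat (nat (- k)) * x i)"
    using False by (auto simp: fun_eq_iff fun_Compl_def)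
  show "x \<in> X \<Longrightarrow> ?thesis"
    unfolding eq
    using additive_nmult[of x "nat (- k)"] additive_minus[OF nmult_in, of x "nat (- k)"] False by simp
qed

text \<open>Additive maps into the rationals are determined by unit vectors, because some nonzero multiple
  of every vector has integral coordinates.\<close>

lemma additive_eq_sum:
  assumes x: "x \<in> X"
  shows "g x = (\<Sum>i\<in>I. x i * g (unit_vec i))"
proof -
  obtain K where K0: "K > 0" "\<forall>i\<in>I. \<exists>z. of_nat K * x i = of_int z"
    using common_denominator[OF finI] by blast
  from bchoice[OF K0(2)] obtain z where z: "\<forall>i\<in>I. of_nat K * x i = of_int (z i)" ..
  have K: "K > 0" "\<And>i. i \<in> I \<Longrightarrow> of_nat K * x i = of_int (z i)" using K0(1) z by simp_all
  \<comment> \<open>Restricting \<open>x\<close> itself to \<open>F\<close> may lead out of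
    \<open>X\<close>. The induction over the support therefore runs on the integral vector K x,
    whose restrictions are integer combinations of unit vectors.\<close>
  have part: "(\<lambda>j. if j \<in> F then of_int (z j) else 0) \<in> X \<and>
      g (\<lambda>j. if j \<in> F then of_int (z j) else 0) = (\<Sum>i\<in>F. of_int (z i) * g (unit_vec i))" if "F \<subseteq> I" for F
    using finite_subset[OF that finI] that
  proof (induction F rule: finite_induct)
    case empty
    then show ?case using zero_in additive_zero by (simp add: zero_fun_def)
  next
    case (insert i F)
    have eq: "(\<lambda>j. if j \<in> insert i F then of_int (z j) else 0) =
        (\<lambda>j. of_int (z i) * unit_vec i j) + (\<lambda>j. if j \<in> F then of_int (z j) else (0::rat))"
      using insert by (auto simp: fun_eq_iff unit_vec_def)
    have "(\<lambda>j. of_int (z i) * unit_vec i j) \<in> X" using insert zmult_in unit_in by simp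
    then show ?case unfolding eq
      using insert add_in g_add additive_zmult unit_in by simp
  qed
  have eq: "(\<lambda>j. if j \<in> I then of_int (z j) else 0) = (\<lambda>i. of_nat K * x i)"
    using K supp[OF x] by (auto simp: fun_eq_iff)
  have "of_nat K * g x = (\<Sum>i\<in>I. of_int (z i) * g (unit_vec i))"
    using part[of I] additive_nmult[OF x, of K] unfolding eq by simp
  also have "\<dots> = (\<Sum>i\<in>I. of_nat K * (x i * g (unit_vec i)))"
    by (rule sum.cong) (auto simp flip: K(2) simp: mult_ac)
  also have "\<dots> = of_nat K * (\<Sum>i\<in>I. x i * g (unit_vec i))"
    by (simp add: sum_distrib_left)
  finally show ?thesis using K(1) by simp
qed

end

end

section \<open>Cyclic extensions of completely decomposable groups\<close>

text \<open>Throughout, \<open>m dvd 1 - k * l\<close> expresses that \<open>k\<close> and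
  \<open>l\<close> are inverse to each other modulo \<open>m\<close>.\<close>

lemma coprime_if_dvd_one_diff:
  fixes k l m :: int
  assumes "m dvd 1 - k * l"
  shows "coprime k m"
proof (rule coprimeI)
  fix c assume c: "c dvd k" "c dvd m"
  then have "c dvd (1 - k * l) + k * l" using assms by (intro dvd_add dvd_mult2) (auto intro: dvd_trans)
  then show "is_unit c" by simp
qed

lemma coprime_inverse_int:
  fixes k m :: int
  assumes "coprime k m"
  obtains l where "m dvd 1 - k * l"
proof -
  obtain u v where "u * k + v * m = 1" using bezout_int[of k m] assms by auto
  then have "1 - k * u = m * v" by (simp add: algebra_simps)
  then show ?thesis using that by (metis dvd_triv_left)
qed

text \<open>The subgroup generated by \<open>loc_vecs I P\<close> and the vector \<open>b\<close>,
  cut off outside \<open>I\<close>; \<open>k\<close> counts the copies of \<open>b\<close>.\<close>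

definition ext_set :: "'i set \<Rightarrow> ('i \<Rightarrow> nat set) \<Rightarrow> ('i \<Rightarrow> rat) \<Rightarrow> ('i \<Rightarrow> rat) set" where
  "ext_set I P b = {f. (\<forall>i. i \<notin> I \<longrightarrow> f i = 0) \<and> (\<exists>k::int. \<forall>i\<in>I. f i - of_int k * b i \<in> loc (P i))}"

definition loc_vecs :: "'i set \<Rightarrow> ('i \<Rightarrow> nat set) \<Rightarrow> ('i \<Rightarrow> rat) set" where
  "loc_vecs I P = {f. (\<forall>i. i \<notin> I \<longrightarrow> f i = 0) \<and> (\<forall>i\<in>I. f i \<in> loc (P i))}"

lemma loc_vecs_subset_ext_set: "loc_vecs I P \<subseteq> ext_set I P b"
  unfolding loc_vecs_def ext_set_def by (auto intro!: exI[of _ 0])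

lemma ext_set_0: "ext_set I P (\<lambda>_. 0) = loc_vecs I P"
  unfolding loc_vecs_def ext_set_def by auto

lemma lattice_set_ext_set:
  assumes "finite I"
  shows "lattice_set I (ext_set I P b)"
proof
  fix x y assume x: "x \<in> ext_set I P b" and y: "y \<in> ext_set I P b"
  obtain k where k: "\<And>i. i \<in> I \<Longrightarrow> x i - of_int k * b i \<in> loc (P i)"
    using x by (auto simp: ext_set_def)
  obtain l where l: "\<And>i. i \<in> I \<Longrightarrow> y i - of_int l * b i \<in> loc (P i)"
    using y by (auto simp: ext_set_def)
  have "(x + y) i - of_int (k + l) * b i \<in> loc (P i)" if "i \<in> I" for i
    using loc_add[OF k[OF that] l[OF that]] by (simp add: algebra_simps)
  then show "x + y \<in> ext_set I P b"
    using x y unfolding ext_set_def by (auto intro!: exI[of _ "k + l"])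
next
  fix x assume x: "x \<in> ext_set I P b"
  obtain k where k: "\<And>i. i \<in> I \<Longrightarrow> x i - of_int k * b i \<in> loc (P i)"
    using x by (auto simp: ext_set_def)
  have "(- x) i - of_int (- k) * b i \<in> loc (P i)" if "i \<in> I" for i
    using loc_uminus[OF k[OF that]] by (simp add: algebra_simps fun_Compl_def)
  then show "- x \<in> ext_set I P b"
    using x unfolding ext_set_def by (auto simp: fun_Compl_def intro!: exI[of _ "- k"])
next
  show "0 \<in> ext_set I P b"
    using loc_vecs_subset_ext_set[of I P b] by (auto simp: loc_vecs_def)
  show "unit_vec i \<in> ext_set I P b" if "i \<in> I" for i
    using loc_vecs_subset_ext_set[of I P b] that by (auto simp: loc_vecs_def unit_vec_def)
qed (use assms in \<open>auto simp: ext_set_def\<close>)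

text \<open>\<open>B\<close> holds one index per block, the one that carries the extra vector.
  \<open>base_pure\<close> says that each denominator divides the least common multiple of the
  others; with a single block it forces the denominator to be 1. \<open>m\<close> and
  \<open>s\<close> are functions of the type, so that data over different index sets can be
  compared.\<close>

locale acd_data =
  fixes I :: "'i set" and P :: "'i \<Rightarrow> nat set" and B :: "'i set" and m s :: "nat set \<Rightarrow> int"
  assumes finite_index: "finite I"
    and primes: "i \<in> I \<Longrightarrow> p \<in> P i \<Longrightarrow> prime p"
    and antichain: "i \<in> I \<Longrightarrow> j \<in> I \<Longrightarrow> P i \<subseteq> P j \<Longrightarrow> P i = P j"
    and base_subset: "B \<subseteq> I"
    and base_inj: "inj_on P B"
    and base_surj: "i \<in> I \<Longrightarrow> \<exists>j\<in>B. P j = P i"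
    and den_coprime: "i \<in> I \<Longrightarrow> coprime_to (P i) (m (P i))"
    and num_coprime: "i \<in> I \<Longrightarrow> coprime (s (P i)) (m (P i))"
    and base_pure: "i \<in> B \<Longrightarrow> (\<And>j. j \<in> B \<Longrightarrow> j \<noteq> i \<Longrightarrow> m (P j) dvd k) \<Longrightarrow> m (P i) dvd k"
begin

definition gen :: "'i \<Rightarrow> rat" where
  "gen i = (if i \<in> B then of_int (s (P i)) / of_int (m (P i)) else 0)"

definition X :: "('i \<Rightarrow> rat) set" where
  "X = ext_set I P gen"

sublocale lattice_set I X
  unfolding X_def by (rule lattice_set_ext_set[OF finite_index])

lemma den_pos: "i \<in> I \<Longrightarrow> m (P i) > 0"
  using den_coprime unfolding coprime_to_def by blast

lemma loc_vecs_subset: "loc_vecs I P \<subseteq> X"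
  unfolding X_def by (rule loc_vecs_subset_ext_set)

lemma X_obtain:
  assumes "x \<in> X"
  obtains k where "\<And>i. i \<in> I \<Longrightarrow> x i - of_int k * gen i \<in> loc (P i)"
  using assms unfolding X_def ext_set_def by blast

lemma XI:
  assumes "\<And>i. i \<notin> I \<Longrightarrow> x i = 0" "\<And>i. i \<in> I \<Longrightarrow> x i - of_int k * gen i \<in> loc (P i)"
  shows "x \<in> X"
  using assms unfolding X_def ext_set_def by blast

lemma gen_in: "gen \<in> X"
  using base_subset by (intro XI[of _ 1]) (auto simp: gen_def)

lemma base_unique: "i \<in> B \<Longrightarrow> j \<in> B \<Longrightarrow> P i = P j \<Longrightarrow> i = j"
  using base_inj by (auto dest: inj_onD)

lemma mult_gen_loc_iff:
  assumes "i \<in> B"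
  shows "of_int k * gen i \<in> loc (P i) \<longleftrightarrow> m (P i) dvd k"
proof -
  have i: "i \<in> I" using assms base_subset by blast
  have "of_int k * gen i = of_int (k * s (P i)) / of_int (m (P i))"
    using assms by (simp add: gen_def)
  then have "of_int k * gen i \<in> loc (P i) \<longleftrightarrow> m (P i) dvd k * s (P i)"
    using loc_frac_iff[OF den_coprime[OF i]] by metis
  then show ?thesis
    using num_coprime[OF i] by (simp add: coprime_dvd_mult_left_iff coprime_commute)
qed

lemma den_mult_gen: "i \<in> I \<Longrightarrow> of_int (m (P i)) * gen i \<in> loc Q"
  using den_pos by (auto simp: gen_def)

text \<open>If \<open>x\<close> is local up to \<open>k\<close> copies of \<open>gen\<close>, the
  blocks where \<open>x\<close> vanishes force their denominators to divide \<open>k\<close>. By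
  \<open>base_pure\<close> the remaining denominator divides \<open>k\<close> as well, so the copies
  of \<open>gen\<close> are local themselves.\<close>

lemma block_pure:
  assumes x: "x \<in> X" and t: "\<And>i. i \<in> I \<Longrightarrow> x i \<noteq> 0 \<Longrightarrow> P i = t"
  shows "x \<in> loc_vecs I P"
proof (cases "\<exists>i\<in>I. x i \<noteq> 0")
  case True
  then obtain b where b: "b \<in> B" "P b = t" using t base_surj by metis
  obtain k where k: "\<And>i. i \<in> I \<Longrightarrow> x i - of_int k * gen i \<in> loc (P i)"
    using X_obtain[OF x] by blast
  have dvd: "m (P j) dvd k" if "j \<in> B" "j \<noteq> b" for j
  proof -
    have "j \<in> I" using that base_subset by blast
    moreover have "x j = 0" using t[of j] base_unique[OF that(1) b(1)] b(2) that \<open>j \<in> I\<close> by auto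
    ultimately have "- (of_int k * gen j) \<in> loc (P j)" using k[of j] by simp
    then have "of_int k * gen j \<in> loc (P j)" using loc_uminus by fastforce
    then show ?thesis using mult_gen_loc_iff that by blast
  qed
  then have "m (P b) dvd k" using base_pure[OF b(1)] by blast
  with dvd have dvd': "m (P j) dvd k" if "j \<in> B" for j using that by (cases "j = b") auto
  have "of_int k * gen i \<in> loc (P i)" if "i \<in> I" for i
    using dvd'[of i] mult_gen_loc_iff by (cases "i \<in> B") (auto simp: gen_def)
  then have "x i \<in> loc (P i)" if "i \<in> I" for i
    using loc_add[OF k[OF that]] that by fastforce
  then show ?thesis using supp[OF x] by (auto simp: loc_vecs_def)
next
  case False
  then show ?thesis using supp[OF x] by (auto simp: loc_vecs_def)
qed

lemma block_divisible:
  assumes x: "x \<in> loc_vecs I P" and t: "\<And>i. i \<in> I \<Longrightarrow> x i \<noteq> 0 \<Longrightarrow> P i = t"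
    and p: "p \<in> t" "prime p"
  shows "\<exists>y\<in>X. x = (\<lambda>i. of_nat (p ^ k) * y i)"
proof
  have "(\<lambda>i. x i / of_nat p ^ k) \<in> loc_vecs I P"
    unfolding loc_vecs_def
  proof (intro CollectI conjI allI impI ballI)
    fix i assume i: "i \<in> I"
    show "x i / of_nat p ^ k \<in> loc (P i)"
    proof (cases "x i = 0")
      case False
      then show ?thesis
        using loc_divide_power[OF p(2), of "P i" "x i" k] t[OF i] p x i by (auto simp: loc_vecs_def)
    qed simp
  qed (use x in \<open>auto simp: loc_vecs_def\<close>)
  then show "(\<lambda>i. x i / of_nat p ^ k) \<in> X" using loc_vecs_subset by blast
  show "x = (\<lambda>i. of_nat (p ^ k) * (x i / of_nat p ^ k))"
    using prime_gt_0_nat[OF p(2)] by (auto simp: fun_eq_iff)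
qed

text \<open>Together with \<open>block_divisible\<close> this recovers types from the abstract
  group. Multiplying by \<open>m (P i)\<close> removes the contribution of \<open>gen\<close>, after
  which coordinate \<open>i\<close> stays in \<open>loc (P i)\<close> under division by all powers
  of \<open>p\<close>.\<close>

lemma divisible_imp_mem:
  assumes x: "\<And>k. \<exists>y\<in>X. x = (\<lambda>i. of_nat (p ^ k) * y i)" and p: "prime p" and i: "i \<in> I" "x i \<noteq> 0"
  shows "p \<in> P i"
proof (rule loc_of_all_powers)
  fix k
  obtain y where y: "y \<in> X" "x = (\<lambda>i. of_nat (p ^ k) * y i)" using x by blast
  obtain l where l: "y i - of_int l * gen i \<in> loc (P i)"
    using X_obtain[OF y(1)] i by blast
  have "of_int (m (P i)) * (y i - of_int l * gen i) + of_int l * (of_int (m (P i)) * gen i) \<in> loc (P i)"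
    by (intro loc_add loc_mult loc_of_int l den_mult_gen i)
  then have "of_int (m (P i)) * y i \<in> loc (P i)" by (simp add: algebra_simps)
  moreover have "x i * of_nat (nat (m (P i))) / of_nat p ^ k = of_int (m (P i)) * y i"
    using prime_gt_0_nat[OF p] den_pos[OF i(1)] by (simp add: y(2))
  ultimately show "x i * of_nat (nat (m (P i))) / of_nat p ^ k \<in> loc (P i)" by simp
qed (use p i den_pos[OF i(1)] in auto)

end

section \<open>Invariants of the model groups under isomorphism\<close>

definition unit_multiple :: "nat set \<Rightarrow> rat \<Rightarrow> rat \<Rightarrow> bool" where
  "unit_multiple t a b \<longleftrightarrow> (\<exists>u\<in>loc t. u \<noteq> 0 \<and> 1 / u \<in> loc t \<and> u * a - b \<in> loc t)"

text \<open>Invariants of the group \<open>X\<close>: the blocks and their sizes, the denominators, and the numerators,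
  the latter up to a common factor \<open>k\<close> invertible modulo all denominators and, in blocks of size 1,
  up to units.\<close>

definition equivalent_data ::
    "'i set \<Rightarrow> ('i \<Rightarrow> nat set) \<Rightarrow> (nat set \<Rightarrow> int) \<Rightarrow> (nat set \<Rightarrow> int) \<Rightarrow>
     'j set \<Rightarrow> ('j \<Rightarrow> nat set) \<Rightarrow> (nat set \<Rightarrow> int) \<Rightarrow> (nat set \<Rightarrow> int) \<Rightarrow> bool" where
  "equivalent_data I P m s I' P' m' s' \<longleftrightarrow>
     P ` I = P' ` I' \<and>
     (\<forall>t\<in>P ` I. card {i\<in>I. P i = t} = card {i\<in>I'. P' i = t} \<and> m t = m' t) \<and>
     (\<exists>k l. \<forall>t\<in>P ` I. m t dvd 1 - k * l \<and>
       (card {i\<in>I. P i = t} = 1 \<longrightarrow>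
         unit_multiple t (of_int (s t) / of_int (m t)) (of_int k * (of_int (s' t) / of_int (m t)))))"

text \<open>The inverse is carried along to keep the situation symmetric: through
  \<open>flipped\<close> every statement also holds in the other direction.\<close>

locale acd_iso = A: acd_data I P B m s + A': acd_data I' P' B' m' s'
  for I :: "'i set" and P B m s and I' :: "'j set" and P' B' m' s' +
  fixes \<phi> :: "('i \<Rightarrow> rat) \<Rightarrow> 'j \<Rightarrow> rat" and \<psi> :: "('j \<Rightarrow> rat) \<Rightarrow> 'i \<Rightarrow> rat"
  assumes \<phi>_in: "x \<in> A.X \<Longrightarrow> \<phi> x \<in> A'.X" and \<psi>_in: "y \<in> A'.X \<Longrightarrow> \<psi> y \<in> A.X"
    and \<phi>_add: "x \<in> A.X \<Longrightarrow> x' \<in> A.X \<Longrightarrow> \<phi> (x + x') = \<phi> x + \<phi> x'"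
    and \<psi>_add: "y \<in> A'.X \<Longrightarrow> y' \<in> A'.X \<Longrightarrow> \<psi> (y + y') = \<psi> y + \<psi> y'"
    and \<psi>_\<phi>: "x \<in> A.X \<Longrightarrow> \<psi> (\<phi> x) = x" and \<phi>_\<psi>: "y \<in> A'.X \<Longrightarrow> \<phi> (\<psi> y) = y"
begin

lemma flipped: "acd_iso I' P' B' m' s' I P B m s \<psi> \<phi>"
  by unfold_locales (use \<phi>_in \<psi>_in \<phi>_add \<psi>_add \<psi>_\<phi> \<phi>_\<psi> in auto)

lemma \<phi>_sum: "x \<in> A.X \<Longrightarrow> \<phi> x j = (\<Sum>i\<in>I. x i * \<phi> (unit_vec i) j)"
  using A.additive_eq_sum[of "\<lambda>x. \<phi> x j"] \<phi>_add by simp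

lemma \<phi>_nmult: "x \<in> A.X \<Longrightarrow> \<phi> (\<lambda>i. of_nat k * x i) = (\<lambda>j. of_nat k * \<phi> x j)"
  using A.additive_nmult[of "\<lambda>x. \<phi> x _" x k] \<phi>_add by auto

text \<open>Additive maps preserve divisibility, and \<open>unit_vec i\<close> is divisible by all
  powers of the primes in \<open>P i\<close>; \<open>divisible_imp_mem\<close> reads this off
  coordinate \<open>j\<close> of the image.\<close>

lemma unit_block_subset:
  assumes i: "i \<in> I" and j: "j \<in> I'" "\<phi> (unit_vec i) j \<noteq> 0"
  shows "P i \<subseteq> P' j"
proof
  fix p assume p: "p \<in> P i"
  have e: "unit_vec i \<in> loc_vecs I P" using i by (auto simp: loc_vecs_def unit_vec_def)
  show "p \<in> P' j"
  proof (rule A'.divisible_imp_mem)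
    fix k
    obtain y where y: "y \<in> A.X" "unit_vec i = (\<lambda>i. of_nat (p ^ k) * y i)"
      using A.block_divisible[OF e, of "P i" p k] p A.primes[OF i p] by (auto simp: unit_vec_def split: if_splits)
    show "\<exists>z\<in>A'.X. \<phi> (unit_vec i) = (\<lambda>i. of_nat (p ^ k) * z i)"
      using \<phi>_nmult[OF y(1), of "p ^ k"] \<phi>_in[OF y(1)] y(2) by metis
  qed (use A.primes[OF i p] j in auto)
qed

lemma unit_nonzero:
  assumes i: "i \<in> I"
  obtains j where "j \<in> I'" "\<phi> (unit_vec i) j \<noteq> 0"
proof (rule ccontr)
  assume "\<not> thesis"
  then have z: "\<phi> (unit_vec i) = 0"
    using that A'.supp[OF \<phi>_in[OF A.unit_in[OF i]]] by (auto simp: fun_eq_iff)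
  have "\<psi> 0 = 0"
    using \<psi>_add[OF A'.zero_in A'.zero_in] by simp
  then have "unit_vec i = 0" using \<psi>_\<phi>[OF A.unit_in[OF i]] z by simp
  then have "unit_vec i i = 0" by simp
  then show False by (simp add: unit_vec_def)
qed

lemma block_subset: "i \<in> I \<Longrightarrow> \<exists>j\<in>I'. P i \<subseteq> P' j"
  using unit_block_subset unit_nonzero by metis

text \<open>The inclusions for the isomorphism and for its inverse form a chain from
  \<open>P i\<close> to some \<open>P i2\<close>, which the antichain condition collapses.\<close>

lemma block_eq: 
  assumes i: "i \<in> I"
  shows "\<exists>j\<in>I'. P i = P' j"
proof -
  obtain j where j: "j \<in> I'" "P i \<subseteq> P' j" using block_subset i by blast
  obtain i2 where i2: "i2 \<in> I" "P' j \<subseteq> P i2" using acd_iso.block_subset[OF flipped j(1)] by blast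
  then have "P i = P i2" using A.antichain[OF i i2(1)] j by auto
  then show ?thesis using j i2 by auto
qed

text \<open>Thus the matrix of \<open>\<phi>\<close> is block diagonal, with one block per
  type.\<close>

lemma unit_block:
  assumes i: "i \<in> I" and j: "j \<in> I'" "\<phi> (unit_vec i) j \<noteq> 0"
  shows "P' j = P i"
  using unit_block_subset[OF assms] block_eq[OF i] A'.antichain[OF _ j(1)] by metis

text \<open>The image of a unit vector lives in a single block, where \<open>block_pure\<close>
  excludes denominators.\<close>

lemma unit_loc:
  assumes i: "i \<in> I" and j: "j \<in> I'"
  shows "\<phi> (unit_vec i) j \<in> loc (P' j)"
  using A'.block_pure[OF \<phi>_in[OF A.unit_in[OF i]], of "P i"] unit_block[OF i] j
  by (auto simp: loc_vecs_def)

lemma \<phi>_loc_vecs: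
  assumes x: "x \<in> loc_vecs I P" and j: "j \<in> I'"
  shows "\<phi> x j \<in> loc (P' j)"
proof -
  have "x i * \<phi> (unit_vec i) j \<in> loc (P' j)" if i: "i \<in> I" for i
  proof (cases "\<phi> (unit_vec i) j = 0")
    case False
    have "x i \<in> loc (P' j)" using unit_block[OF i j False] x i by (auto simp: loc_vecs_def)
    then show ?thesis using unit_loc[OF i j] by auto
  qed simp
  then show ?thesis using \<phi>_sum x A.loc_vecs_subset loc_sum by (metis (no_types, lifting) subset_iff)
qed

lemma \<psi>_\<phi>_unit:
  assumes i: "i \<in> I"
  shows "(\<Sum>j\<in>{j\<in>I'. P' j = P i}. \<phi> (unit_vec i) j * \<psi> (unit_vec j) i) = 1"
proof -
  have "(\<Sum>j\<in>I'. \<phi> (unit_vec i) j * \<psi> (unit_vec j) i) = \<psi> (\<phi> (unit_vec i)) i"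
    using acd_iso.\<phi>_sum[OF flipped \<phi>_in[OF A.unit_in[OF i]], of i] by simp
  also have "\<dots> = 1" using \<psi>_\<phi>[OF A.unit_in[OF i]] by (simp add: unit_vec_def)
  also have "(\<Sum>j\<in>I'. \<phi> (unit_vec i) j * \<psi> (unit_vec j) i)
      = (\<Sum>j\<in>{j\<in>I'. P' j = P i}. \<phi> (unit_vec i) j * \<psi> (unit_vec j) i)"
    using unit_block[OF i] A'.finite_index by (intro sum.mono_neutral_right) auto
  finally show ?thesis .
qed

text \<open>Both sizes are the trace of the product of the two coordinate matrices.\<close>

lemma card_block:
  "card {i\<in>I. P i = t} = card {j\<in>I'. P' j = t}"
proof -
  have 1: "of_nat (card {i\<in>I. P i = t}) =
      (\<Sum>i\<in>{i\<in>I. P i = t}. \<Sum>j\<in>{j\<in>I'. P' j = t}. \<phi> (unit_vec i) j * \<psi> (unit_vec j) i)"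
    using \<psi>_\<phi>_unit by (subst sum.cong[OF refl, where h = "\<lambda>_. 1"]) auto
  have "of_nat (card {j\<in>I'. P' j = t}) =
      (\<Sum>j\<in>{j\<in>I'. P' j = t}. \<Sum>i\<in>{i\<in>I. P i = t}. \<psi> (unit_vec j) i * \<phi> (unit_vec i) j)"
    using acd_iso.\<psi>_\<phi>_unit[OF flipped] by (subst sum.cong[OF refl, where h = "\<lambda>_. 1"]) auto
  also have "\<dots> = of_nat (card {i\<in>I. P i = t})"
    unfolding 1 by (subst sum.swap) (simp add: mult.commute)
  finally show ?thesis by simp
qed

text \<open>By block diagonality only coordinates of \<open>gen\<close> in the block of
  \<open>j\<close> contribute, and \<open>b\<close> is the only one there that can be
  nonzero.\<close>

lemma \<phi>_gen_base:
  assumes b: "b \<in> B" and j: "j \<in> I'" "P' j = P b"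
  shows "\<phi> A.gen j = A.gen b * \<phi> (unit_vec b) j"
proof -
  have "\<phi> A.gen j = (\<Sum>i\<in>I. A.gen i * \<phi> (unit_vec i) j)"
    by (rule \<phi>_sum[OF A.gen_in])
  also have "\<dots> = (\<Sum>i\<in>{b}. A.gen i * \<phi> (unit_vec i) j)"
  proof (rule sum.mono_neutral_right[OF A.finite_index])
    show "\<forall>i\<in>I - {b}. A.gen i * \<phi> (unit_vec i) j = 0"
    proof
      fix i assume i: "i \<in> I - {b}"
      show "A.gen i * \<phi> (unit_vec i) j = 0"
        using unit_block[of i j] A.base_unique[OF _ b, of i] i j by (auto simp: A.gen_def)
    qed
  qed (use A.base_subset b in auto)
  finally show ?thesis by simp
qed

text \<open>Modulo local vectors, \<open>\<phi>\<close> sends one extra vector to \<open>k\<close>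
  copies of the other, and \<open>\<psi>\<close> returns it with factor \<open>l\<close>. The round
  trip is the identity, so \<open>1 - k * l\<close> makes the coordinate s/m local.\<close>

lemma factor_inverse:
  assumes k: "\<And>j. j \<in> I' \<Longrightarrow> \<phi> A.gen j - of_int k * A'.gen j \<in> loc (P' j)"
    and l: "\<And>i. i \<in> I \<Longrightarrow> \<psi> A'.gen i - of_int l * A.gen i \<in> loc (P i)"
    and i: "i \<in> I"
  shows "m (P i) dvd 1 - k * l"
proof -
  define \<alpha> where "\<alpha> = \<phi> A.gen - (\<lambda>j. of_int k * A'.gen j)"
  have \<alpha>: "\<alpha> \<in> loc_vecs I' P'"
    using k A'.supp[OF \<phi>_in[OF A.gen_in]] A'.supp[OF A'.gen_in] by (auto simp: loc_vecs_def \<alpha>_def)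
  then have \<alpha>X: "\<alpha> \<in> A'.X" using A'.loc_vecs_subset by blast
  have eq: "A.gen i = \<psi> \<alpha> i + of_int k * \<psi> A'.gen i" for i
  proof -
    have "A.gen = \<psi> (\<alpha> + (\<lambda>j. of_int k * A'.gen j))"
      using \<psi>_\<phi>[OF A.gen_in] by (simp add: \<alpha>_def)
    also have "\<dots> = \<psi> \<alpha> + \<psi> (\<lambda>j. of_int k * A'.gen j)"
      by (rule \<psi>_add[OF \<alpha>X A'.zmult_in[OF A'.gen_in]])
    finally have "A.gen i = \<psi> \<alpha> i + \<psi> (\<lambda>j. of_int k * A'.gen j) i" by (metis plus_fun_apply)
    also have "\<psi> (\<lambda>j. of_int k * A'.gen j) i = of_int k * \<psi> A'.gen i"
      using A'.additive_zmult[of "\<lambda>y. \<psi> y i", OF _ A'.gen_in] \<psi>_add by simp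
    finally show ?thesis .
  qed
  obtain b where b: "b \<in> B" "P b = P i" using A.base_surj[OF i] by blast
  then have bI: "b \<in> I" using A.base_subset by blast
  have "\<psi> \<alpha> b + of_int k * (\<psi> A'.gen b - of_int l * A.gen b) \<in> loc (P b)"
    by (intro loc_add loc_mult loc_of_int l[OF bI] acd_iso.\<phi>_loc_vecs[OF flipped \<alpha> bI])
  then have "of_int (1 - k * l) * A.gen b \<in> loc (P b)"
    using eq[of b] by (simp add: algebra_simps)
  then show ?thesis using A.mult_gen_loc_iff[OF b(1)] b(2) by metis
qed

lemma obtain_factor: "\<exists>k. \<forall>j\<in>I'. \<phi> A.gen j - of_int k * A'.gen j \<in> loc (P' j)"
  using A'.X_obtain[OF \<phi>_in[OF A.gen_in]] by metis

text \<open>\<open>m (P i)\<close> makes the coordinate of the first extra vector local and hence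
  also \<open>k\<close> times that of the second. As \<open>k\<close> is invertible modulo
  \<open>m' (P i)\<close>, it can be cancelled.\<close>

lemma den_dvd:
  assumes i: "i \<in> I"
  shows "m' (P i) dvd m (P i)"
proof -
  obtain k where k: "\<And>j. j \<in> I' \<Longrightarrow> \<phi> A.gen j - of_int k * A'.gen j \<in> loc (P' j)"
    using obtain_factor by blast
  obtain l where l: "\<And>i. i \<in> I \<Longrightarrow> \<psi> A'.gen i - of_int l * A.gen i \<in> loc (P i)"
    using acd_iso.obtain_factor[OF flipped] by blast
  obtain b where b: "b \<in> B" "P b = P i" using A.base_surj[OF i] by blast
  obtain j where j: "j \<in> I'" "P i = P' j" using block_eq[OF i] by blast
  obtain b' where b': "b' \<in> B'" "P' b' = P i" using A'.base_surj[OF j(1)] j by metis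
  have bI: "b \<in> I" "b' \<in> I'" using b b' A.base_subset A'.base_subset by auto
  have "of_int (m (P i)) * A.gen b * \<phi> (unit_vec b) b' -
      of_int (m (P i)) * (\<phi> A.gen b' - of_int k * A'.gen b') \<in> loc (P' b')"
    by (intro loc_diff loc_mult[OF loc_of_int] loc_mult[OF _ unit_loc[OF bI]] k bI
        A.den_mult_gen[OF bI(1), unfolded b(2)])
  moreover have "\<phi> A.gen b' = A.gen b * \<phi> (unit_vec b) b'"
    using \<phi>_gen_base[OF b(1) bI(2)] b b' by simp
  ultimately have "of_int (m (P i) * k) * A'.gen b' \<in> loc (P' b')"
    by (simp add: algebra_simps)
  then have "m' (P i) dvd m (P i) * k"
    using A'.mult_gen_loc_iff[OF b'(1)] b'(2) by metis
  moreover have "m' (P i) dvd 1 - k * l"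
    using acd_iso.factor_inverse[OF flipped l k j(1)] j(2) by (simp add: mult.commute)
  then have "coprime k (m' (P i))"
    by (rule coprime_if_dvd_one_diff)
  ultimately show ?thesis by (simp add: coprime_dvd_mult_left_iff coprime_commute)
qed

lemma equivalent: "equivalent_data I P m s I' P' m' s'"
  unfolding equivalent_data_def
proof (intro conjI)
  show img: "P ` I = P' ` I'" using block_eq acd_iso.block_eq[OF flipped] by (fastforce simp: image_iff)
  have mm: "m (P i) = m' (P i)" if i: "i \<in> I" for i
  proof -
    obtain j where j: "j \<in> I'" "P i = P' j" using block_eq[OF i] by blast
    have "m (P i) dvd m' (P i)" using acd_iso.den_dvd[OF flipped j(1)] j(2) by simp
    then show ?thesis
      using den_dvd[OF i] A.den_pos[OF i] A'.den_pos[OF j(1)] j(2) zdvd_antisym_nonneg by force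
  qed
  then show "\<forall>t\<in>P ` I. card {i \<in> I. P i = t} = card {i \<in> I'. P' i = t} \<and> m t = m' t"
    using card_block by auto
  obtain k where k: "\<And>j. j \<in> I' \<Longrightarrow> \<phi> A.gen j - of_int k * A'.gen j \<in> loc (P' j)"
    using obtain_factor by blast
  obtain l where l: "\<And>i. i \<in> I \<Longrightarrow> \<psi> A'.gen i - of_int l * A.gen i \<in> loc (P i)"
    using acd_iso.obtain_factor[OF flipped] by blast
  have unit: "unit_multiple t (of_int (s t) / of_int (m t)) (of_int k * (of_int (s' t) / of_int (m t)))"
    if t: "t \<in> P ` I" and one: "card {i \<in> I. P i = t} = 1" for t
  proof -
    obtain i where i: "i \<in> I" "P i = t" using t by blast
    obtain b where b: "b \<in> B" "P b = t" using A.base_surj[OF i(1)] i(2) by blast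
    obtain j where j: "j \<in> I'" "t = P' j" using block_eq[OF i(1)] i(2) by blast
    obtain b' where b': "b' \<in> B'" "P' b' = t" using A'.base_surj[OF j(1)] j by metis
    have bI: "b \<in> I" "b' \<in> I'" using b b' A.base_subset A'.base_subset by auto
    obtain x where "{j \<in> I'. P' j = t} = {x}"
      using one card_block[of t] by (auto simp: card_1_singleton_iff)
    moreover have "b' \<in> {j \<in> I'. P' j = t}" using bI b' by blast
    ultimately have blk': "{j \<in> I'. P' j = t} = {b'}" by (metis singletonD)
    \<comment> \<open>In a block with one index the matrices of \<open>\<phi>\<close> and
      \<open>\<psi>\<close> are numbers. They are local and inverse to each other, so
      \<open>u\<close> is a unit.\<close>
    define u where "u = \<phi> (unit_vec b) b'"
    define v where "v = \<psi> (unit_vec b') b"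
    have uv: "u * v = 1"
      using \<psi>_\<phi>_unit[OF bI(1)] b(2) blk' by (simp add: u_def v_def)
    have "u \<in> loc t" using unit_loc[OF bI] b'(2) by (simp add: u_def)
    moreover have "v \<in> loc t" using acd_iso.unit_loc[OF flipped bI(2,1)] b(2) by (simp add: v_def)
    moreover have u0: "u \<noteq> 0" using uv by auto
    moreover have "1 / u = v" using uv u0 by (simp add: field_simps)
    moreover have "u * (of_int (s t) / of_int (m t)) - of_int k * (of_int (s' t) / of_int (m t)) \<in> loc t"
      using k[OF bI(2)] \<phi>_gen_base[OF b(1) bI(2)] b b' mm[OF bI(1)]
      by (simp add: A.gen_def A'.gen_def u_def mult.commute)
    ultimately show ?thesis unfolding unit_multiple_def by blast
  qed
  show "\<exists>k l. \<forall>t\<in>P ` I. m t dvd 1 - k * l \<and>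
       (card {i\<in>I. P i = t} = 1 \<longrightarrow>
         unit_multiple t (of_int (s t) / of_int (m t)) (of_int k * (of_int (s' t) / of_int (m t))))"
    using factor_inverse[OF k l] unit by blast
qed

end

section \<open>Isomorphisms constructed from equivalent data\<close>

lemma vec_group_isoI:
  assumes "\<And>x. x \<in> X \<Longrightarrow> \<phi> x \<in> Y" "\<And>y. y \<in> Y \<Longrightarrow> \<psi> y \<in> X"
    and "\<And>x y. x \<in> X \<Longrightarrow> y \<in> X \<Longrightarrow> \<phi> (x + y) = \<phi> x + \<phi> y"
    and "\<And>x. x \<in> X \<Longrightarrow> \<psi> (\<phi> x) = x" "\<And>y. y \<in> Y \<Longrightarrow> \<phi> (\<psi> y) = y"
  shows "\<phi> \<in> iso (vec_group X) (vec_group Y)"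
proof (rule isoI)
  show "\<phi> \<in> hom (vec_group X) (vec_group Y)"
    by (rule homI) (use assms in auto)
  show "bij_betw \<phi> (carrier (vec_group X)) (carrier (vec_group Y))"
    using assms by (auto intro!: bij_betwI[where g = \<psi>])
qed

lemma ext_set_reindex:
  assumes \<sigma>: "bij_betw \<sigma> I J" and P: "\<And>i. i \<in> I \<Longrightarrow> P' (\<sigma> i) = P i"
    and g: "\<And>i. i \<in> I \<Longrightarrow> g' (\<sigma> i) = g i"
  defines "\<phi> \<equiv> (\<lambda>f j. if j \<in> J then f (inv_into I \<sigma> j) else 0)"
  shows "\<phi> \<in> iso (vec_group (ext_set I P g)) (vec_group (ext_set J P' g'))"
    and "\<phi> ` loc_vecs I P = loc_vecs J P'"
proof -
  define \<psi> :: "('b \<Rightarrow> rat) \<Rightarrow> 'a \<Rightarrow> rat" where "\<psi> = (\<lambda>h i. if i \<in> I then h (\<sigma> i) else 0)"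
  have inv: "inv_into I \<sigma> (\<sigma> i) = i" "\<sigma> i \<in> J" if "i \<in> I" for i
    using \<sigma> that by (auto simp: bij_betw_def)
  have inv': "\<sigma> (inv_into I \<sigma> j) = j" "inv_into I \<sigma> j \<in> I" if "j \<in> J" for j
    using \<sigma> that by (auto simp: bij_betw_def f_inv_into_f inv_into_into)
  have \<phi>: "\<phi> x \<in> ext_set J P' a'"
    if x: "x \<in> ext_set I P a" and a: "\<And>i. i \<in> I \<Longrightarrow> a' (\<sigma> i) = a i" for x a a'
  proof -
    obtain k where k: "\<And>i. i \<in> I \<Longrightarrow> x i - of_int k * a i \<in> loc (P i)"
      using x by (auto simp: ext_set_def)
    have "\<phi> x j - of_int k * a' j \<in> loc (P' j)" if j: "j \<in> J" for j
      using k[OF inv'(2)[OF j]] P[OF inv'(2)[OF j]] a[OF inv'(2)[OF j]] inv'[OF j] j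
      by (simp add: \<phi>_def)
    then show ?thesis by (auto simp: ext_set_def \<phi>_def)
  qed
  have \<psi>: "\<psi> y \<in> ext_set I P a"
    if y: "y \<in> ext_set J P' a'" and a: "\<And>i. i \<in> I \<Longrightarrow> a' (\<sigma> i) = a i" for y a a'
  proof -
    obtain k where k: "\<And>j. j \<in> J \<Longrightarrow> y j - of_int k * a' j \<in> loc (P' j)"
      using y by (auto simp: ext_set_def)
    have "\<psi> y i - of_int k * a i \<in> loc (P i)" if i: "i \<in> I" for i
      using k[OF inv(2)[OF i]] P[OF i] a[OF i] i by (simp add: \<psi>_def)
    then show ?thesis by (auto simp: ext_set_def \<psi>_def)
  qed
  have \<psi>\<phi>: "\<psi> (\<phi> x) = x" if "x \<in> ext_set I P a" for x a
    using that inv by (auto simp: \<psi>_def \<phi>_def ext_set_def fun_eq_iff)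
  have \<phi>\<psi>: "\<phi> (\<psi> y) = y" if "y \<in> ext_set J P' a" for y a
    using that inv' by (auto simp: \<psi>_def \<phi>_def ext_set_def fun_eq_iff)
  show "\<phi> \<in> iso (vec_group (ext_set I P g)) (vec_group (ext_set J P' g'))"
    by (rule vec_group_isoI[where \<psi> = \<psi>])
       (use \<phi>[of _ g g'] \<psi>[of _ g' g] g \<psi>\<phi> \<phi>\<psi> in \<open>auto simp: \<phi>_def fun_eq_iff\<close>)
  show "\<phi> ` loc_vecs I P = loc_vecs J P'"
  proof (intro equalityI subsetI)
    show "y \<in> loc_vecs J P'" if "y \<in> \<phi> ` loc_vecs I P" for y
      using that \<phi>[of _ "\<lambda>_. 0" "\<lambda>_. 0"] unfolding ext_set_0 by auto
    show "y \<in> \<phi> ` loc_vecs I P" if "y \<in> loc_vecs J P'" for y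
      using that \<psi>[of y "\<lambda>_. 0" "\<lambda>_. 0"] \<phi>\<psi>[of y "\<lambda>_. 0"] unfolding ext_set_0
      by (auto intro!: image_eqI[of _ _ "\<psi> y"])
  qed
qed

text \<open>The map mixes coordinate \<open>i\<close> only with coordinate \<open>\<pi> i\<close>.
  On a pair it is the 2 by 2 matrix with diagonal entries from \<open>a\<close> and the others from
  \<open>c\<close>; at a fixed point it is a scalar. The primed coefficients form the inverse
  matrix. The generator goes to \<open>k\<close> copies of the new one, and \<open>l\<close> undoes
  this factor.\<close>

lemma ext_set_twist:
  fixes a c a' c' :: "'i \<Rightarrow> rat"
  assumes fin: "finite I" and \<pi>: "\<And>i. i \<in> I \<Longrightarrow> \<pi> i \<in> I \<and> P (\<pi> i) = P i \<and> \<pi> (\<pi> i) = i"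
    and loc: "\<And>i. i \<in> I \<Longrightarrow> a i \<in> loc (P i) \<and> c i \<in> loc (P i) \<and> a' i \<in> loc (P i) \<and> c' i \<in> loc (P i)"
    and inv: "\<And>i. i \<in> I \<Longrightarrow> a' i * a i + c' i * c (\<pi> i) = 1 \<and> a' i * c i + c' i * a (\<pi> i) = 0"
    and inv': "\<And>i. i \<in> I \<Longrightarrow> a i * a' i + c i * c' (\<pi> i) = 1 \<and> a i * c' i + c i * a' (\<pi> i) = 0"
    and k: "\<And>i. i \<in> I \<Longrightarrow> a i * g i + c i * g (\<pi> i) - of_int k * g' i \<in> loc (P i)"
    and l: "\<And>i. i \<in> I \<Longrightarrow> of_int (1 - k * l) * g' i \<in> loc (P i)"
  shows "vec_group (ext_set I P g) \<cong> vec_group (ext_set I P g')"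
proof -
  define L where "L = (\<lambda>a c f i. if i \<in> I then a i * f i + c i * f (\<pi> i) else (0::rat))"
  have L_in: "L a c x \<in> ext_set I P g'"
    if x: "x \<in> ext_set I P g" and loc: "\<And>i. i \<in> I \<Longrightarrow> a i \<in> loc (P i) \<and> c i \<in> loc (P i)"
      and k: "\<And>i. i \<in> I \<Longrightarrow> a i * g i + c i * g (\<pi> i) - of_int k * g' i \<in> loc (P i)"
    for a c g g' x k
  proof -
    obtain n where n: "\<And>i. i \<in> I \<Longrightarrow> x i - of_int n * g i \<in> loc (P i)"
      using x by (auto simp: ext_set_def)
    have "L a c x i - of_int (n * k) * g' i \<in> loc (P i)" if i: "i \<in> I" for i
    proof -
      have "a i * (x i - of_int n * g i) + c i * (x (\<pi> i) - of_int n * g (\<pi> i)) +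
          of_int n * (a i * g i + c i * g (\<pi> i) - of_int k * g' i) \<in> loc (P i)"
        using n[OF i] n[of "\<pi> i"] \<pi>[OF i] loc[OF i] k[OF i] by (intro loc_add loc_mult loc_of_int) auto
      then show ?thesis using i by (simp add: L_def algebra_simps)
    qed
    then show ?thesis
      unfolding ext_set_def by (intro CollectI conjI exI[of _ "n * k"]) (auto simp: L_def)
  qed
  \<comment> \<open>Write A for the matrix. With the local vectors h = A g - k g' and r = (1 - k l)
    g' one has g' = r + l (A g - h), and the inverse matrix turns this into the claim.\<close>
  have l': "a' i * g' i + c' i * g' (\<pi> i) - of_int l * g i \<in> loc (P i)" if i: "i \<in> I" for i
  proof -
    define h where "h = (\<lambda>i. a i * g i + c i * g (\<pi> i) - of_int k * g' i)"
    have \<pi>i: "\<pi> i \<in> I" "P (\<pi> i) = P i" "\<pi> (\<pi> i) = i" using \<pi>[OF i] by auto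
    have h: "h i \<in> loc (P i)" "h (\<pi> i) \<in> loc (P i)"
      using k[OF i] k[OF \<pi>i(1)] unfolding h_def \<pi>i by blast+
    define r where "r = (\<lambda>i. of_int (1 - k * l) * g' i)"
    have r: "r i \<in> loc (P i)" "r (\<pi> i) \<in> loc (P i)"
      using l[OF i] l[OF \<pi>i(1)] unfolding r_def \<pi>i by blast+
    have "a' i * r i + c' i * r (\<pi> i) - of_int l * (a' i * h i + c' i * h (\<pi> i)) \<in> loc (P i)"
      using loc[OF i] h r by (intro loc_add loc_diff loc_mult loc_of_int) auto
    also have "a' i * r i + c' i * r (\<pi> i) - of_int l * (a' i * h i + c' i * h (\<pi> i)) =
      a' i * g' i + c' i * g' (\<pi> i) - of_int l * ((a' i * a i + c' i * c (\<pi> i)) * g i +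
        (a' i * c i + c' i * a (\<pi> i)) * g (\<pi> i))"
      unfolding h_def r_def \<pi>i by (simp add: algebra_simps)
    finally show ?thesis using inv[OF i] by simp
  qed
  have comp: "L a' c' (L a c x) = x"
    if x: "x \<in> ext_set I P g"
      and inv: "\<And>i. i \<in> I \<Longrightarrow> a' i * a i + c' i * c (\<pi> i) = 1 \<and> a' i * c i + c' i * a (\<pi> i) = 0"
    for a' c' a c x g
  proof
    fix i
    show "L a' c' (L a c x) i = x i"
    proof (cases "i \<in> I")
      case True
      have "L a' c' (L a c x) i = (a' i * a i + c' i * c (\<pi> i)) * x i + (a' i * c i + c' i * a (\<pi> i)) * x (\<pi> i)"
        using True \<pi>[OF True] by (simp add: L_def algebra_simps)
      then show ?thesis using inv[OF True] by simp
    qed (use x in \<open>auto simp: L_def ext_set_def\<close>)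
  qed
  have "L a c \<in> iso (vec_group (ext_set I P g)) (vec_group (ext_set I P g'))"
  proof (rule vec_group_isoI)
    show "L a c x \<in> ext_set I P g'" if "x \<in> ext_set I P g" for x
      by (rule L_in[OF that _ k]) (use loc in auto)
    show "L a' c' x \<in> ext_set I P g" if "x \<in> ext_set I P g'" for x
      by (rule L_in[OF that _ l']) (use loc in auto)
    show "L a' c' (L a c x) = x" if "x \<in> ext_set I P g" for x
      by (rule comp[OF that]) (use inv in auto)
    show "L a c (L a' c' x) = x" if "x \<in> ext_set I P g'" for x
      by (rule comp[OF that]) (use inv' in auto)
  qed (auto simp: L_def fun_eq_iff algebra_simps)
  then show ?thesis by (rule is_isoI)
qed

context acd_data
begin

lemma base_image: "P ` B = P ` I"
proof
  show "P ` B \<subseteq> P ` I" by (rule image_mono[OF base_subset])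
  show "P ` I \<subseteq> P ` B"
  proof
    fix t assume "t \<in> P ` I"
    then obtain i where "i \<in> I" "t = P i" by blast
    then show "t \<in> P ` B" using base_surj by (metis imageI)
  qed
qed

text \<open>The conditions of \<open>ext_set_twist\<close> at one index, except the one on
  \<open>l\<close>, for the new generator with numerators \<open>s'\<close>. Stated pointwise, they
  allow the coefficients to be chosen block by block.\<close>

definition twist_ok where
  "twist_ok k s' i \<pi> a c a' c' \<longleftrightarrow> \<pi> i \<in> I \<and> P (\<pi> i) = P i \<and> \<pi> (\<pi> i) = i \<and>
     a i \<in> loc (P i) \<and> c i \<in> loc (P i) \<and> a' i \<in> loc (P i) \<and> c' i \<in> loc (P i) \<and>
     a' i * a i + c' i * c (\<pi> i) = 1 \<and> a' i * c i + c' i * a (\<pi> i) = 0 \<and>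
     a i * a' i + c i * c' (\<pi> i) = 1 \<and> a i * c' i + c i * a' (\<pi> i) = 0 \<and>
     a i * gen i + c i * gen (\<pi> i) -
       of_int k * (if i \<in> B then of_int (s' (P i)) / of_int (m (P i)) else 0) \<in> loc (P i)"

text \<open>A block of size 1 admits only the scaling by a unit that \<open>unit\<close> provides.
  In a larger block a second index \<open>d\<close>, where the generator vanishes, makes a suitable
  matrix of determinant 1 available.\<close>

lemma twist_block:
  assumes b: "b \<in> B" and k: "m (P b) dvd 1 - k * l" and s': "coprime (s' (P b)) (m (P b))"
    and unit: "card {i\<in>I. P i = P b} = 1 \<Longrightarrow> unit_multiple (P b) (of_int (s (P b)) / of_int (m (P b))) (of_int k * (of_int (s' (P b)) / of_int (m (P b))))"
  shows "\<exists>\<pi> a c a' c'. \<forall>i\<in>{i\<in>I. P i = P b}. twist_ok k s' i \<pi> a c a' c'"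
proof -
  have bI: "b \<in> I" using b base_subset by blast
  have uniq: "i = b" if "i \<in> B" "P i = P b" for i using base_unique that b by blast
  show ?thesis
  proof (cases "card {i\<in>I. P i = P b} = 1")
    case True
    then obtain x where "{i\<in>I. P i = P b} = {x}" by (auto simp: card_1_singleton_iff)
    then have blk: "{i\<in>I. P i = P b} = {b}" using bI by auto
    obtain u where "u \<in> loc (P b)" "u \<noteq> 0" "1 / u \<in> loc (P b)"
      "u * (of_int (s (P b)) / of_int (m (P b))) - of_int k * (of_int (s' (P b)) / of_int (m (P b))) \<in> loc (P b)"
      using unit[OF True] unfolding unit_multiple_def by blast
    then show ?thesis unfolding blk twist_ok_def
      using b bI by (intro exI[of _ id] exI[of _ "\<lambda>_. u"] exI[of _ "\<lambda>_. 1 / u"] exI[of _ "\<lambda>_. 0"]) (auto simp: gen_def)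
  next
    case False
    have "{i\<in>I. P i = P b} \<noteq> {b}" using False by auto
    then obtain d where d: "d \<in> I" "P d = P b" "d \<noteq> b" using bI by auto
    have dB: "d \<notin> B" using d uniq by blast
    let ?m = "m (P b)"
    have m: "?m > 0" using den_pos[OF bI] .
    obtain q where q: "?m dvd 1 - s (P b) * q"
      using num_coprime[OF bI] coprime_inverse_int by blast
    have "coprime k ?m" using k by (rule coprime_if_dvd_one_diff)
    moreover have "coprime q ?m"
      using q coprime_if_dvd_one_diff[of ?m q "s (P b)"] by (simp add: mult.commute)
    ultimately have cop: "coprime (k * s' (P b) * q) ?m" using s' by simp
    \<comment> \<open>As \<open>q\<close> inverts \<open>s\<close> modulo the denominator,
      multiplication by \<open>u\<close> turns the numerator \<open>s\<close> into
      \<open>k * s'\<close> modulo it.\<close>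
    define u where "u = k * s' (P b) * q"
    obtain x y where xy: "u * x + ?m * y = 1"
      using cop bezout_int[of u ?m] unfolding u_def by (auto simp: mult.commute)
    have us: "?m dvd u * s (P b) - k * s' (P b)"
    proof -
      have "?m dvd - ((1 - s (P b) * q) * (k * s' (P b)))"
        using q by simp
      then show ?thesis by (simp add: u_def algebra_simps)
    qed
    have ug: "of_int u * (of_int (s (P b)) / of_int ?m) - of_int k * (of_int (s' (P b)) / of_int ?m) \<in> loc (P b)"
    proof -
      have "of_int (u * s (P b) - k * s' (P b)) / of_int ?m \<in> loc (P b)"
        using us loc_frac_iff[OF den_coprime[OF bI]] by blast
      then show ?thesis by (simp add: diff_divide_distrib)
    qed
    define \<pi> where "\<pi> = id(b := d, d := b)"
    \<comment> \<open>On the coordinates \<open>b\<close>, \<open>d\<close> the matrix has rows (u,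
      -y) and (m, x), with determinant u x + m y = 1. Only its first column meets the generator; the
      entry m yields the integer m (s/m) at \<open>d\<close>.\<close>
    define a where "a = (\<lambda>_. 1::rat)(b := of_int u, d := of_int x)"
    define c where "c = (\<lambda>_. 0::rat)(b := of_int (- y), d := of_int ?m)"
    define a' where "a' = (\<lambda>_. 1::rat)(b := of_int x, d := of_int u)"
    define c' where "c' = (\<lambda>_. 0::rat)(b := of_int y, d := of_int (- ?m))"
    have xy': "of_int u * of_int x + of_int ?m * of_int y = (1::rat)"
      using xy by (metis of_int_1 of_int_add of_int_mult)
    have "twist_ok k s' i \<pi> a c a' c'" if i: "i \<in> I" "P i = P b" for i
    proof -
      consider "i = b" | "i = d" | "i \<noteq> b" "i \<noteq> d" by blast
      then show ?thesis
      proof cases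
        case 1
        then show ?thesis
          using d ug b dB bI xy' loc_of_int[of "- y"]
          by (auto simp: twist_ok_def \<pi>_def a_def c_def a'_def c'_def gen_def algebra_simps)
      next
        case 2
        then show ?thesis
          using d b dB bI xy' m loc_of_int[of "- ?m"]
          by (auto simp: twist_ok_def \<pi>_def a_def c_def a'_def c'_def gen_def algebra_simps)
      next
        case 3
        then have "i \<notin> B" using uniq i by blast
        then show ?thesis
          using 3 i by (auto simp: twist_ok_def \<pi>_def a_def c_def a'_def c'_def gen_def)
      qed
    qed
    then show ?thesis by blast
  qed
qed

end

text \<open>Blocks are matched by size. Sending the chosen index of a block to the chosen index of
  its partner lets the bijection carry one generator to the other.\<close>

lemma bij_betw_blocks:
  assumes fin: "finite I" "finite I'" and img: "P ` I = P' ` I'"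
    and card: "\<And>t. t \<in> P ` I \<Longrightarrow> card {i\<in>I. P i = t} = card {i\<in>I'. P' i = t}"
    and B: "B \<subseteq> I" "inj_on P B" "P ` B = P ` I" and B': "B' \<subseteq> I'" "inj_on P' B'" "P' ` B' = P' ` I'"
  shows "\<exists>\<sigma>. bij_betw \<sigma> I I' \<and> (\<forall>i\<in>I. P' (\<sigma> i) = P i \<and> (\<sigma> i \<in> B' \<longleftrightarrow> i \<in> B))"
proof -
  have "\<exists>h. bij_betw h {i\<in>I. P i = t} {i\<in>I'. P' i = t} \<and>
      (\<forall>i\<in>I. P i = t \<longrightarrow> h i \<in> B' \<longleftrightarrow> i \<in> B)" if t: "t \<in> P ` I" for t
  proof -
    obtain b where b: "b \<in> B" "P b = t" using t B by (metis imageE)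
    obtain b' where b': "b' \<in> B'" "P' b' = t" using t img B' by (metis imageE)
    let ?K = "{i\<in>I. P i = t}" and ?K' = "{i\<in>I'. P' i = t}"
    have K: "b \<in> ?K" "b' \<in> ?K'" using b b' B B' by auto
    have "card (?K - {b}) = card (?K' - {b'})"
      using card[OF t] K fin by (simp add: card_Diff_singleton)
    then obtain h where h: "bij_betw h (?K - {b}) (?K' - {b'})"
      using fin finite_same_card_bij[of "?K - {b}" "?K' - {b'}"] by auto
    define h' where "h' = h(b := b')"
    have "bij_betw h' (?K - {b}) (?K' - {b'})"
      using h by (rule bij_betw_cong[THEN iffD1, rotated]) (auto simp: h'_def)
    then have "bij_betw h' (insert b (?K - {b})) (insert b' (?K' - {b'}))"
      using notIn_Un_bij_betw3[of b "?K - {b}" h' "?K' - {b'}"] by (simp add: h'_def)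
    then have bij: "bij_betw h' ?K ?K'" using K by (simp add: insert_absorb)
    have "h' i \<in> B' \<longleftrightarrow> i \<in> B" if i: "i \<in> I" "P i = t" for i
    proof (cases "i = b")
      case False
      then have "h' i \<in> ?K' - {b'}" using i h bij_betwE[OF h] by (auto simp: h'_def)
      then have "h' i \<notin> B'" using B'(2) b' by (auto dest: inj_onD)
      moreover have "i \<notin> B" using B(2) b i False by (auto dest: inj_onD)
      ultimately show ?thesis by simp
    qed (use b b' in \<open>auto simp: h'_def\<close>)
    with bij show ?thesis by blast
  qed
  then have "\<forall>t\<in>P ` I. \<exists>h. bij_betw h {i\<in>I. P i = t} {i\<in>I'. P' i = t} \<and>
      (\<forall>i\<in>I. P i = t \<longrightarrow> h i \<in> B' \<longleftrightarrow> i \<in> B)" by blast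
  from bchoice[OF this] obtain h where h0: "\<forall>t\<in>P ` I. bij_betw (h t) {i\<in>I. P i = t} {i\<in>I'. P' i = t} \<and>
      (\<forall>i\<in>I. P i = t \<longrightarrow> h t i \<in> B' \<longleftrightarrow> i \<in> B)" ..
  have h: "bij_betw (h t) {i\<in>I. P i = t} {i\<in>I'. P' i = t}"
    "\<And>i. i \<in> I \<Longrightarrow> P i = t \<Longrightarrow> h t i \<in> B' \<longleftrightarrow> i \<in> B" if "t \<in> P ` I" for t
    using h0 that by blast+
  define \<sigma> where "\<sigma> = (\<lambda>i. h (P i) i)"
  have \<sigma>: "\<sigma> i \<in> I'" "P' (\<sigma> i) = P i" if "i \<in> I" for i
    using h(1)[of "P i"] that by (auto simp: \<sigma>_def dest!: bij_betwE)
  have "bij_betw \<sigma> I I'"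
  proof (rule bij_betw_imageI)
    show "inj_on \<sigma> I"
    proof (rule inj_onI)
      fix i j assume ij: "i \<in> I" "j \<in> I" "\<sigma> i = \<sigma> j"
      then have "P i = P j" using \<sigma>(2) by metis
      then show "i = j" using ij h(1)[of "P i"] by (auto simp: \<sigma>_def bij_betw_def dest: inj_onD)
    qed
    show "\<sigma> ` I = I'"
    proof (intro equalityI subsetI)
      fix j assume j: "j \<in> I'"
      then have t: "P' j \<in> P ` I" using img by blast
      then have "j \<in> h (P' j) ` {i\<in>I. P i = P' j}" using h(1)[OF t] j by (auto simp: bij_betw_def)
      then obtain i where "i \<in> I" "P i = P' j" "j = h (P' j) i" by blast
      then show "j \<in> \<sigma> ` I" by (auto simp: \<sigma>_def intro!: image_eqI[of _ _ i])
    qed (use \<sigma> in auto)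
  qed
  moreover have "\<sigma> i \<in> B' \<longleftrightarrow> i \<in> B" if "i \<in> I" for i using h(2) that by (simp add: \<sigma>_def)
  ultimately show ?thesis using \<sigma>(2) by blast
qed

text \<open>Two moves: twist the numerators \<open>s\<close> into \<open>s'\<close> on the same
  index set, then rename the indices. \<open>g\<close> is the generator between the two
  moves.\<close>

lemma equivalent_data_imp_iso:
  assumes "acd_data I P B m s" and "acd_data I' P' B' m' s'"
    and eq: "equivalent_data I P m s I' P' m' s'"
  shows "vec_group (acd_data.X I P B m s) \<cong> vec_group (acd_data.X I' P' B' m' s')"
proof -
  interpret A: acd_data I P B m s by fact
  interpret A': acd_data I' P' B' m' s' by fact
  note eq' = eq[unfolded equivalent_data_def]
  note img = eq'[THEN conjunct1]
  note cm = eq'[THEN conjunct2, THEN conjunct1, THEN bspec]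
  have card: "card {i\<in>I. P i = t} = card {i\<in>I'. P' i = t}" and mm: "m t = m' t" if "t \<in> P ` I" for t
    by (rule cm[THEN conjunct1, OF that], rule cm[THEN conjunct2, OF that])
  obtain k l where kl0: "\<forall>t\<in>P ` I. m t dvd 1 - k * l \<and> (card {i\<in>I. P i = t} = 1 \<longrightarrow>
         unit_multiple t (of_int (s t) / of_int (m t)) (of_int k * (of_int (s' t) / of_int (m t))))"
    using eq'[THEN conjunct2, THEN conjunct2] by (elim exE)
  have kl: "\<And>t. t \<in> P ` I \<Longrightarrow> m t dvd 1 - k * l"
    and unit: "\<And>t. t \<in> P ` I \<Longrightarrow> card {i\<in>I. P i = t} = 1 \<Longrightarrow>
         unit_multiple t (of_int (s t) / of_int (m t)) (of_int k * (of_int (s' t) / of_int (m t)))"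
    by (rule kl0[THEN bspec, THEN conjunct1], assumption)
      (rule kl0[THEN bspec, THEN conjunct2, THEN mp])
  define g where "g = (\<lambda>i. if i \<in> B then of_int (s' (P i)) / of_int (m (P i)) else (0::rat))"
  have s': "coprime (s' t) (m t)" if t: "t \<in> P ` I" for t
  proof -
    obtain j where "j \<in> I'" "t = P' j" using t img by blast
    then show ?thesis using A'.num_coprime mm[OF t] by metis
  qed
  have "\<forall>t\<in>P ` I. \<exists>\<pi> a c a' c'. \<forall>i\<in>{i\<in>I. P i = t}. A.twist_ok k s' i \<pi> a c a' c'"
  proof
    fix t assume t: "t \<in> P ` I"
    obtain b where b: "b \<in> B" "t = P b" using t A.base_surj by force
    show "\<exists>\<pi> a c a' c'. \<forall>i\<in>{i\<in>I. P i = t}. A.twist_ok k s' i \<pi> a c a' c'"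
      unfolding b(2)
      by (rule A.twist_block[where l = l, OF b(1)])
         (rule kl[OF t, unfolded b(2)] s'[OF t, unfolded b(2)] unit[OF t, unfolded b(2)], assumption?)+
  qed
  then obtain \<pi> a c a' c' where
    tw: "\<forall>t\<in>P ` I. \<forall>i\<in>{i\<in>I. P i = t}. A.twist_ok k s' i (\<pi> t) (a t) (c t) (a' t) (c' t)"
    by (simp only: bchoice_iff) (elim exE, rule that)
  \<comment> \<open>The coefficients chosen for each type are merged into functions of the index
    alone.\<close>
  obtain \<pi>0 a0 c0 a0' c0' where
    eqs: "\<pi>0 = (\<lambda>i. \<pi> (P i) i)" "a0 = (\<lambda>i. a (P i) i)" "c0 = (\<lambda>i. c (P i) i)"
      "a0' = (\<lambda>i. a' (P i) i)" "c0' = (\<lambda>i. c' (P i) i)" by blast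
  have tw0: "A.twist_ok k s' i \<pi>0 a0 c0 a0' c0'" if i: "i \<in> I" for i
    unfolding eqs
    using tw i unfolding A.twist_ok_def by auto
  have twisted: "vec_group A.X \<cong> vec_group (ext_set I P g)"
    unfolding A.X_def
  proof (rule ext_set_twist[where \<pi> = \<pi>0 and a = a0 and c = c0 and a' = a0' and c' = c0'])
    show "of_int (1 - k * l) * g i \<in> loc (P i)" if i: "i \<in> I" for i
    proof -
      obtain q where "1 - k * l = m (P i) * q" using kl[of "P i"] i by (meson dvdE imageI)
      then have "of_int (1 - k * l) * g i = (if i \<in> B then of_int (q * s' (P i)) else 0)"
        using A.den_pos[OF i] by (simp add: g_def)
      then show ?thesis by (simp only:) (auto split: if_splits)
    qed
  qed (use A.finite_index tw0 in \<open>simp_all add: A.twist_ok_def g_def\<close>)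
  obtain \<sigma> where \<sigma>: "bij_betw \<sigma> I I'" "\<And>i. i \<in> I \<Longrightarrow> P' (\<sigma> i) = P i"
    "\<And>i. i \<in> I \<Longrightarrow> \<sigma> i \<in> B' \<longleftrightarrow> i \<in> B"
    using bij_betw_blocks[OF A.finite_index A'.finite_index img card A.base_subset A.base_inj A.base_image
        A'.base_subset A'.base_inj A'.base_image] by blast
  have gg: "A'.gen (\<sigma> i) = g i" if i: "i \<in> I" for i
    using \<sigma>(2,3)[OF i] mm[of "P i"] i by (simp add: A'.gen_def g_def)
  have "vec_group (ext_set I P g) \<cong> vec_group A'.X"
    unfolding A'.X_def
    by (rule is_isoI, rule ext_set_reindex(1)[OF \<sigma>(1), where P = P and P' = P' and g = g and g' = A'.gen])
       (use \<sigma>(2) gg in simp_all)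
  then show ?thesis by (rule iso_trans[OF twisted])
qed

section \<open>Multiplications as biadditive maps\<close>

definition bilinear_maps :: "('a, 'm) monoid_scheme \<Rightarrow> ('a \<times> 'a \<Rightarrow> 'a) set" where
  "bilinear_maps G = {\<beta> \<in> extensional (carrier G \<times> carrier G).
     (\<forall>x\<in>carrier G. \<forall>y\<in>carrier G. \<beta> (x, y) \<in> carrier G) \<and>
     (\<forall>x\<in>carrier G. \<forall>x'\<in>carrier G. \<forall>y\<in>carrier G. \<beta> (x \<otimes>\<^bsub>G\<^esub> x', y) = \<beta> (x, y) \<otimes>\<^bsub>G\<^esub> \<beta> (x', y)) \<and>
     (\<forall>x\<in>carrier G. \<forall>y\<in>carrier G. \<forall>y'\<in>carrier G. \<beta> (x, y \<otimes>\<^bsub>G\<^esub> y') = \<beta> (x, y) \<otimes>\<^bsub>G\<^esub> \<beta> (x, y'))}"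

definition bilinear_group :: "('a, 'm) monoid_scheme \<Rightarrow> ('a \<times> 'a \<Rightarrow> 'a) monoid" where
  "bilinear_group G = \<lparr>carrier = bilinear_maps G,
     monoid.mult = (\<lambda>\<beta> \<gamma>. \<lambda>p\<in>carrier G \<times> carrier G. \<beta> p \<otimes>\<^bsub>G\<^esub> \<gamma> p),
     one = (\<lambda>p\<in>carrier G \<times> carrier G. \<one>\<^bsub>G\<^esub>)\<rparr>"

lemma bilinear_mapsD:
  assumes "\<beta> \<in> bilinear_maps G"
  shows "\<beta> \<in> extensional (carrier G \<times> carrier G)"
    and "x \<in> carrier G \<Longrightarrow> y \<in> carrier G \<Longrightarrow> \<beta> (x, y) \<in> carrier G"
    and "x \<in> carrier G \<Longrightarrow> x' \<in> carrier G \<Longrightarrow> y \<in> carrier G \<Longrightarrow>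
      \<beta> (x \<otimes>\<^bsub>G\<^esub> x', y) = \<beta> (x, y) \<otimes>\<^bsub>G\<^esub> \<beta> (x', y)"
    and "x \<in> carrier G \<Longrightarrow> y \<in> carrier G \<Longrightarrow> y' \<in> carrier G \<Longrightarrow>
      \<beta> (x, y \<otimes>\<^bsub>G\<^esub> y') = \<beta> (x, y) \<otimes>\<^bsub>G\<^esub> \<beta> (x, y')"
  using assms unfolding bilinear_maps_def by blast+

lemma bilinear_mapsI:
  assumes "\<beta> \<in> extensional (carrier G \<times> carrier G)"
    and "\<And>x y. x \<in> carrier G \<Longrightarrow> y \<in> carrier G \<Longrightarrow> \<beta> (x, y) \<in> carrier G"
    and "\<And>x x' y. x \<in> carrier G \<Longrightarrow> x' \<in> carrier G \<Longrightarrow> y \<in> carrier G \<Longrightarrow>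
      \<beta> (x \<otimes>\<^bsub>G\<^esub> x', y) = \<beta> (x, y) \<otimes>\<^bsub>G\<^esub> \<beta> (x', y)"
    and "\<And>x y y'. x \<in> carrier G \<Longrightarrow> y \<in> carrier G \<Longrightarrow> y' \<in> carrier G \<Longrightarrow>
      \<beta> (x, y \<otimes>\<^bsub>G\<^esub> y') = \<beta> (x, y) \<otimes>\<^bsub>G\<^esub> \<beta> (x, y')"
  shows "\<beta> \<in> bilinear_maps G"
  using assms unfolding bilinear_maps_def by blast

lemma bilinear_group_simps [simp]:
  "carrier (bilinear_group G) = bilinear_maps G"
  "\<beta> \<otimes>\<^bsub>bilinear_group G\<^esub> \<gamma> = (\<lambda>p\<in>carrier G \<times> carrier G. \<beta> p \<otimes>\<^bsub>G\<^esub> \<gamma> p)"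
  by (simp_all add: bilinear_group_def)

text \<open>Conjugation by mutually inverse homomorphisms. The conclusions are one-sided: a second
  application with \<open>G\<close> and \<open>H\<close> exchanged completes the bijection.\<close>

lemma bilinear_group_transport:
  assumes "group H" and f: "f \<in> hom G H" and g: "g \<in> hom H G" and gf: "\<And>x. x \<in> carrier G \<Longrightarrow> g (f x) = x"
    and fg: "\<And>y. y \<in> carrier H \<Longrightarrow> f (g y) = y"
  defines "\<Phi> \<equiv> \<lambda>\<beta>. \<lambda>(u, v)\<in>carrier H \<times> carrier H. f (\<beta> (g u, g v))"
  shows "\<beta> \<in> bilinear_maps G \<Longrightarrow> \<Phi> \<beta> \<in> bilinear_maps H"
    and "\<beta> \<in> bilinear_maps G \<Longrightarrow> \<gamma> \<in> bilinear_maps G \<Longrightarrow>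
      \<Phi> (\<beta> \<otimes>\<^bsub>bilinear_group G\<^esub> \<gamma>) = \<Phi> \<beta> \<otimes>\<^bsub>bilinear_group H\<^esub> \<Phi> \<gamma>"
    and "\<beta> \<in> bilinear_maps G \<Longrightarrow>
      (\<lambda>(x, y)\<in>carrier G \<times> carrier G. g (\<Phi> \<beta> (f x, f y))) = \<beta>"
proof -
  interpret H: group H by fact
  note cl = hom_in_carrier[OF f] hom_in_carrier[OF g]
  show "\<Phi> \<beta> \<in> bilinear_maps H" if \<beta>: "\<beta> \<in> bilinear_maps G"
  proof (rule bilinear_mapsI)
    fix x x' y assume h: "x \<in> carrier H" "x' \<in> carrier H" "y \<in> carrier H"
    show "\<Phi> \<beta> (x, y) \<in> carrier H" using h cl bilinear_mapsD(2)[OF \<beta>] by (simp add: \<Phi>_def)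
    show "\<Phi> \<beta> (x \<otimes>\<^bsub>H\<^esub> x', y) = \<Phi> \<beta> (x, y) \<otimes>\<^bsub>H\<^esub> \<Phi> \<beta> (x', y)"
      using h cl bilinear_mapsD(2)[OF \<beta>]
      by (simp add: \<Phi>_def hom_mult[OF g] bilinear_mapsD(3)[OF \<beta>] hom_mult[OF f])
    show "\<Phi> \<beta> (y, x \<otimes>\<^bsub>H\<^esub> x') = \<Phi> \<beta> (y, x) \<otimes>\<^bsub>H\<^esub> \<Phi> \<beta> (y, x')"
      using h cl bilinear_mapsD(2)[OF \<beta>]
      by (simp add: \<Phi>_def hom_mult[OF g] bilinear_mapsD(4)[OF \<beta>] hom_mult[OF f])
  qed (simp add: \<Phi>_def)
  show "\<Phi> (\<beta> \<otimes>\<^bsub>bilinear_group G\<^esub> \<gamma>) = \<Phi> \<beta> \<otimes>\<^bsub>bilinear_group H\<^esub> \<Phi> \<gamma>"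
    if "\<beta> \<in> bilinear_maps G" "\<gamma> \<in> bilinear_maps G"
    using cl bilinear_mapsD(2)[OF that(1)] bilinear_mapsD(2)[OF that(2)]
    by (auto simp: \<Phi>_def hom_mult[OF f] intro!: restrict_ext)
  show "(\<lambda>(x, y)\<in>carrier G \<times> carrier G. g (\<Phi> \<beta> (f x, f y))) = \<beta>"
    if "\<beta> \<in> bilinear_maps G"
  proof
    fix p
    show "(\<lambda>(x, y)\<in>carrier G \<times> carrier G. g (\<Phi> \<beta> (f x, f y))) p = \<beta> p"
      using cl gf bilinear_mapsD(2)[OF that] extensional_arb[OF bilinear_mapsD(1)[OF that], of p]
      by (cases p) (auto simp: \<Phi>_def)
  qed
qed

lemma bilinear_group_cong:
  assumes "group G" "group H" "G \<cong> H"
  shows "bilinear_group G \<cong> bilinear_group H"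
proof -
  interpret G: group G by fact
  interpret H: group H by fact
  obtain f where f: "f \<in> iso G H" using assms by (auto simp: is_iso_def)
  define g where "g = inv_into (carrier G) f"
  have g: "g \<in> iso H G" unfolding g_def by (rule G.iso_set_sym[OF f])
  have fh: "f \<in> hom G H" and gh: "g \<in> hom H G" using f g by (auto simp: iso_def)
  have bij: "bij_betw f (carrier G) (carrier H)" using f by (simp add: iso_def)
  have gf: "g (f x) = x" if "x \<in> carrier G" for x
    unfolding g_def using bij that by (simp add: bij_betw_def)
  have fg: "f (g y) = y" if "y \<in> carrier H" for y
    unfolding g_def using bij that by (simp add: bij_betw_def f_inv_into_f)
  let ?\<Phi> = "\<lambda>\<beta>. \<lambda>(u, v)\<in>carrier H \<times> carrier H. f (\<beta> (g u, g v))"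
  let ?\<Psi> = "\<lambda>\<beta>. \<lambda>(u, v)\<in>carrier G \<times> carrier G. g (\<beta> (f u, f v))"
  have T1: "?\<Phi> \<beta> \<in> bilinear_maps H" if "\<beta> \<in> bilinear_maps G" for \<beta>
    using that by - (rule bilinear_group_transport(1)[OF H.is_group fh gh gf fg])
  have T2: "?\<Phi> (\<beta> \<otimes>\<^bsub>bilinear_group G\<^esub> \<gamma>) = ?\<Phi> \<beta> \<otimes>\<^bsub>bilinear_group H\<^esub> ?\<Phi> \<gamma>"
    if "\<beta> \<in> bilinear_maps G" "\<gamma> \<in> bilinear_maps G" for \<beta> \<gamma>
    using that by - (rule bilinear_group_transport(2)[OF H.is_group fh gh gf fg])
  have T3: "?\<Psi> (?\<Phi> \<beta>) = \<beta>" if "\<beta> \<in> bilinear_maps G" for \<beta>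
    using that by - (rule bilinear_group_transport(3)[OF H.is_group fh gh gf fg])
  have S1: "?\<Psi> \<beta> \<in> bilinear_maps G" if "\<beta> \<in> bilinear_maps H" for \<beta>
    using that by - (rule bilinear_group_transport(1)[OF G.is_group gh fh fg gf])
  have S3: "?\<Phi> (?\<Psi> \<beta>) = \<beta>" if "\<beta> \<in> bilinear_maps H" for \<beta>
    using that by - (rule bilinear_group_transport(3)[OF G.is_group gh fh fg gf])
  have "?\<Phi> \<in> iso (bilinear_group G) (bilinear_group H)"
  proof (rule isoI)
    show "?\<Phi> \<in> hom (bilinear_group G) (bilinear_group H)"
    proof (rule homI)
      fix \<beta> \<gamma> assume h: "\<beta> \<in> carrier (bilinear_group G)" "\<gamma> \<in> carrier (bilinear_group G)"
      then have h: "\<beta> \<in> bilinear_maps G" "\<gamma> \<in> bilinear_maps G" by simp_all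
      show "?\<Phi> \<beta> \<in> carrier (bilinear_group H)"
        unfolding bilinear_group_simps(1) by (rule T1[OF h(1)])
      show "?\<Phi> (\<beta> \<otimes>\<^bsub>bilinear_group G\<^esub> \<gamma>) = ?\<Phi> \<beta> \<otimes>\<^bsub>bilinear_group H\<^esub> ?\<Phi> \<gamma>"
        by (rule T2[OF h])
    qed
    show "bij_betw ?\<Phi> (carrier (bilinear_group G)) (carrier (bilinear_group H))"
      unfolding bilinear_group_simps
    proof (rule bij_betwI[where g = ?\<Psi>])
      show "?\<Phi> \<in> bilinear_maps G \<rightarrow> bilinear_maps H" by (rule Pi_I) (rule T1)
      show "?\<Psi> \<in> bilinear_maps H \<rightarrow> bilinear_maps G" by (rule Pi_I) (rule S1)
      show "?\<Psi> (?\<Phi> \<beta>) = \<beta>" if "\<beta> \<in> bilinear_maps G" for \<beta> by (rule T3[OF that])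
      show "?\<Phi> (?\<Psi> \<beta>) = \<beta>" if "\<beta> \<in> bilinear_maps H" for \<beta> by (rule S3[OF that])
    qed
  qed
  then show ?thesis by (rule is_isoI)
qed

section \<open>The universal property of the tensor product\<close>

lemma tensor_relations_subset:
  assumes "group A" "group B"
  shows "tensor_relations A B \<subseteq> carrier (free_Abelian_group (carrier A \<times> carrier B))"
proof -
  interpret A: group A by fact
  interpret B: group B by fact
  let ?F = "free_Abelian_group (carrier A \<times> carrier B)"
  have "x - y - z \<in> carrier ?F" if "x \<in> carrier ?F" "y \<in> carrier ?F" "z \<in> carrier ?F" for x y z
    using that keys_diff[of x y] keys_diff[of "x - y" z]
    unfolding carrier_free_Abelian_group_iff by blast
  then show ?thesis unfolding tensor_relations_def
    by (auto simp del: carrier_free_Abelian_group_iff simp: frag_of_in_free_Abelian_group)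
qed

lemma group_tensor_product:
  assumes "group A" "group B"
  shows "group (tensor_product A B)"
proof -
  let ?F = "free_Abelian_group (carrier A \<times> carrier B)"
  interpret F: comm_group ?F by (rule abelian_free_Abelian_group)
  have "generate ?F (tensor_relations A B) \<lhd> ?F"
    by (intro F.subgroup_imp_normal F.generate_is_subgroup tensor_relations_subset assms)
  then show ?thesis
    unfolding tensor_product_def Let_def by (rule normal.factorgroup_is_group)
qed

text \<open>\<open>\<Phi>\<close> evaluates a homomorphism on pure tensors, the cosets of the free
  generators. These generate the quotient, whence injectivity. A biadditive map extends to the free
  group, kills the relations and descends to the quotient, whence surjectivity.\<close>

lemma Mult_iso_bilinear_group:
  assumes "comm_group G"
  shows "Mult G \<cong> bilinear_group G"
proof -
  interpret G: comm_group G by fact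
  define C where "C = carrier G \<times> carrier G"
  define F where "F = free_Abelian_group C"
  define N where "N = generate F (tensor_relations G G)"
  interpret F: comm_group F unfolding F_def by (rule abelian_free_Abelian_group)
  have rel: "tensor_relations G G \<subseteq> carrier F"
    unfolding F_def C_def by (rule tensor_relations_subset) unfold_locales
  then have N: "subgroup N F" unfolding N_def by (rule F.generate_is_subgroup)
  then have normal: "N \<lhd> F" by (rule F.subgroup_imp_normal)
  have T: "tensor_product G G = F Mod N"
    by (simp add: tensor_product_def F_def C_def N_def Let_def)
  interpret T: group "F Mod N" using normal by (rule normal.factorgroup_is_group)
  let ?q = "\<lambda>c. N #>\<^bsub>F\<^esub> c"
  have q_hom: "?q \<in> hom F (F Mod N)" using normal normal.r_coset_hom_Mod by blast
  have frag: "frag_of p \<in> carrier F" if "p \<in> C" for p using that by (simp add: F_def)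
  have q_in: "?q c \<in> carrier (F Mod N)" if "c \<in> carrier F" for c using hom_in_carrier[OF q_hom that] .
  have q_eq: "?q c = ?q d" if "c \<in> carrier F" "d \<in> carrier F" "c - d \<in> N" for c d
  proof -
    have "c = (c - d) \<otimes>\<^bsub>F\<^esub> d" by (simp add: F_def)
    then show ?thesis using that F.repr_independence[OF _ that(2) N, of c]
      unfolding r_coset_def by blast
  qed
  have q_rel: "?q (frag_of (x \<otimes>\<^bsub>G\<^esub> x', y)) = ?q (frag_of (x, y)) \<otimes>\<^bsub>F Mod N\<^esub> ?q (frag_of (x', y))"
    "?q (frag_of (y, x \<otimes>\<^bsub>G\<^esub> x')) = ?q (frag_of (y, x)) \<otimes>\<^bsub>F Mod N\<^esub> ?q (frag_of (y, x'))"
    if h: "x \<in> carrier G" "x' \<in> carrier G" "y \<in> carrier G" for x x' y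
  proof -
    have mem: "(x, y) \<in> C" "(x', y) \<in> C" "(x \<otimes>\<^bsub>G\<^esub> x', y) \<in> C" "(y, x) \<in> C" "(y, x') \<in> C" "(y, x \<otimes>\<^bsub>G\<^esub> x') \<in> C"
      using h by (auto simp: C_def)
    have "frag_of (x \<otimes>\<^bsub>G\<^esub> x', y) - frag_of (x, y) - frag_of (x', y) \<in> N"
      unfolding N_def by (rule generate.incl) (use h in \<open>unfold tensor_relations_def, blast\<close>)
    then have "?q (frag_of (x \<otimes>\<^bsub>G\<^esub> x', y)) = ?q (frag_of (x, y) \<otimes>\<^bsub>F\<^esub> frag_of (x', y))"
      by (intro q_eq F.m_closed frag mem) (simp add: F_def diff_diff_eq)
    then show "?q (frag_of (x \<otimes>\<^bsub>G\<^esub> x', y)) = ?q (frag_of (x, y)) \<otimes>\<^bsub>F Mod N\<^esub> ?q (frag_of (x', y))"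
      using hom_mult[OF q_hom frag frag] mem by simp
    have "frag_of (y, x \<otimes>\<^bsub>G\<^esub> x') - frag_of (y, x) - frag_of (y, x') \<in> N"
      unfolding N_def by (rule generate.incl) (use h in \<open>unfold tensor_relations_def, blast\<close>)
    then have "?q (frag_of (y, x \<otimes>\<^bsub>G\<^esub> x')) = ?q (frag_of (y, x) \<otimes>\<^bsub>F\<^esub> frag_of (y, x'))"
      by (intro q_eq F.m_closed frag mem) (simp add: F_def diff_diff_eq)
    then show "?q (frag_of (y, x \<otimes>\<^bsub>G\<^esub> x')) = ?q (frag_of (y, x)) \<otimes>\<^bsub>F Mod N\<^esub> ?q (frag_of (y, x'))"
      using hom_mult[OF q_hom frag frag] mem by simp
  qed
  have carr: "carrier (F Mod N) = ?q ` carrier F" by (auto simp: FactGroup_def RCOSETS_def)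
  have M: "Mult G = hom_group (F Mod N) G" by (simp add: Mult_def T)
  define \<Phi> where "\<Phi> = (\<lambda>f. \<lambda>p\<in>C. f (?q (frag_of p)) :: 'a)"
  have \<Phi>_in: "\<Phi> f \<in> bilinear_maps G" if f: "f \<in> hom (F Mod N) G" for f
  proof (rule bilinear_mapsI)
    fix x x' y assume h: "x \<in> carrier G" "x' \<in> carrier G" "y \<in> carrier G"
    have mem: "(x, y) \<in> C" "(x', y) \<in> C" "(x \<otimes>\<^bsub>G\<^esub> x', y) \<in> C" "(y, x) \<in> C" "(y, x') \<in> C" "(y, x \<otimes>\<^bsub>G\<^esub> x') \<in> C"
      using h by (auto simp: C_def)
    show "\<Phi> f (x, y) \<in> carrier G"
      using mem by (auto simp: \<Phi>_def intro!: hom_in_carrier[OF f] q_in frag)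
    show "\<Phi> f (x \<otimes>\<^bsub>G\<^esub> x', y) = \<Phi> f (x, y) \<otimes>\<^bsub>G\<^esub> \<Phi> f (x', y)"
      using mem by (simp add: \<Phi>_def q_rel(1)[OF h] hom_mult[OF f q_in q_in] frag del: mult_FactGroup)
    show "\<Phi> f (y, x \<otimes>\<^bsub>G\<^esub> x') = \<Phi> f (y, x) \<otimes>\<^bsub>G\<^esub> \<Phi> f (y, x')"
      using mem by (simp add: \<Phi>_def q_rel(2)[OF h] hom_mult[OF f q_in q_in] frag del: mult_FactGroup)
  qed (auto simp: \<Phi>_def C_def)
  have inj: "f = g" if f: "f \<in> hom (F Mod N) G \<inter> extensional (carrier (F Mod N))"
    and g: "g \<in> hom (F Mod N) G \<inter> extensional (carrier (F Mod N))" and eq: "\<Phi> f = \<Phi> g" for f g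
  proof (rule extensionalityI)
    fix X assume "X \<in> carrier (F Mod N)"
    then obtain c where c: "c \<in> carrier F" "X = ?q c" using carr by blast
    have fh: "f \<in> hom (F Mod N) G" and gh: "g \<in> hom (F Mod N) G" using f g by auto
    interpret fg: group_hom "F Mod N" G f by unfold_locales (rule fh)
    interpret gg: group_hom "F Mod N" G g by unfold_locales (rule gh)
    interpret qq: group_hom F "F Mod N" ?q by unfold_locales (rule q_hom)
    have "Poly_Mapping.keys c \<subseteq> C" using c(1) by (simp add: F_def)
    then have "c \<in> carrier F \<and> f (?q c) = g (?q c)"
    proof (rule free_Abelian_group_induct)
      have "f (?q \<one>\<^bsub>F\<^esub>) = g (?q \<one>\<^bsub>F\<^esub>)" unfolding qq.hom_one fg.hom_one gg.hom_one ..
      then show "0 \<in> carrier F \<and> f (?q 0) = g (?q 0)" by (simp add: F_def)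
    next
      fix x y
      assume h: "x \<in> carrier F \<and> f (?q x) = g (?q x)" "y \<in> carrier F \<and> f (?q y) = g (?q y)"
      have "x - y = x \<otimes>\<^bsub>F\<^esub> inv\<^bsub>F\<^esub> y" using h by (simp add: F_def)
      moreover have "f (?q (x \<otimes>\<^bsub>F\<^esub> inv\<^bsub>F\<^esub> y)) = g (?q (x \<otimes>\<^bsub>F\<^esub> inv\<^bsub>F\<^esub> y))"
        using h by (simp add: qq.hom_inv fg.hom_inv gg.hom_inv q_in del: mult_FactGroup)
      ultimately show "x - y \<in> carrier F \<and> f (?q (x - y)) = g (?q (x - y))"
        using h by (metis F.inv_closed F.m_closed)
    next
      fix a assume "a \<in> C"
      then show "frag_of a \<in> carrier F \<and> f (?q (frag_of a)) = g (?q (frag_of a))"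
        using fun_cong[OF eq, of a] frag by (simp add: \<Phi>_def)
    qed
    then show "f X = g X" using c(2) by simp
  qed (use f g in auto)
  have surj: "\<exists>f\<in>hom (F Mod N) G \<inter> extensional (carrier (F Mod N)). \<Phi> f = \<beta>"
    if \<beta>: "\<beta> \<in> bilinear_maps G" for \<beta>
  proof -
    have "\<beta> ` C \<subseteq> carrier G" using bilinear_mapsD(2)[OF \<beta>] by (auto simp: C_def)
    then obtain h where h: "h \<in> hom F G" "\<And>p. p \<in> C \<Longrightarrow> h (frag_of p) = \<beta> p"
      using G.free_Abelian_group_universal[of \<beta> C] unfolding F_def by blast
    interpret h: group_hom F G h by unfold_locales (rule h(1))
    have diff: "h (x - y - z) = h x \<otimes>\<^bsub>G\<^esub> inv\<^bsub>G\<^esub> (h y \<otimes>\<^bsub>G\<^esub> h z)"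
      if "x \<in> carrier F" "y \<in> carrier F" "z \<in> carrier F" for x y z
    proof -
      have "x - y - z = x \<otimes>\<^bsub>F\<^esub> inv\<^bsub>F\<^esub> (y \<otimes>\<^bsub>F\<^esub> z)"
        using that F.m_closed[OF that(2,3)] by (simp add: F_def diff_diff_eq)
      then show ?thesis using that by simp
    qed
    have "tensor_relations G G \<subseteq> kernel F G h"
    proof
      fix c assume c: "c \<in> tensor_relations G G"
      then have "c \<in> carrier F" using rel by blast
      moreover have "h c = \<one>\<^bsub>G\<^esub>"
        using c unfolding tensor_relations_def
      proof (elim UnE CollectE exE conjE)
        fix x x' y assume e: "c = frag_of (x \<otimes>\<^bsub>G\<^esub> x', y) - frag_of (x, y) - frag_of (x', y)"
          and m: "x \<in> carrier G" "x' \<in> carrier G" "y \<in> carrier G"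
        have mem: "(x, y) \<in> C" "(x', y) \<in> C" "(x \<otimes>\<^bsub>G\<^esub> x', y) \<in> C" using m by (auto simp: C_def)
        show ?thesis unfolding e diff[OF frag[OF mem(3)] frag[OF mem(1)] frag[OF mem(2)]]
          using m mem by (simp add: h(2) bilinear_mapsD(2,3)[OF \<beta>])
      next
        fix x y y' assume e: "c = frag_of (x, y \<otimes>\<^bsub>G\<^esub> y') - frag_of (x, y) - frag_of (x, y')"
          and m: "x \<in> carrier G" "y \<in> carrier G" "y' \<in> carrier G"
        have mem: "(x, y) \<in> C" "(x, y') \<in> C" "(x, y \<otimes>\<^bsub>G\<^esub> y') \<in> C" using m by (auto simp: C_def)
        show ?thesis unfolding e diff[OF frag[OF mem(3)] frag[OF mem(1)] frag[OF mem(2)]]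
          using m mem by (simp add: h(2) bilinear_mapsD(2,4)[OF \<beta>])
      qed
      ultimately show "c \<in> kernel F G h" by (simp add: kernel_def)
    qed
    then have ker: "N \<subseteq> kernel F G h"
      unfolding N_def by (rule F.generate_subgroup_incl) (rule h.subgroup_kernel)
    have "h x = h y" if xy: "x \<in> carrier F" "y \<in> carrier F" "?q x = ?q y" for x y
    proof -
      have "x \<in> ?q y" using F.rcos_self[OF xy(1) N] xy(3) by simp
      then obtain n where n: "n \<in> N" "x = n \<otimes>\<^bsub>F\<^esub> y" unfolding r_coset_def by blast
      then have "n \<in> carrier F" "h n = \<one>\<^bsub>G\<^esub>" using ker by (auto simp: kernel_def)
      then show ?thesis using n(2) xy(2) by simp
    qed
    then obtain g where g: "g \<in> hom (F Mod N) G" "\<And>x. x \<in> carrier F \<Longrightarrow> g (?q x) = h x"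
      using FactGroup_universal[OF h(1) normal] by metis
    let ?g = "restrict g (carrier (F Mod N))"
    have "?g \<in> hom (F Mod N) G"
      using g(1) T.m_closed by (auto simp: hom_def)
    moreover have "\<Phi> ?g = \<beta>"
    proof
      fix p
      show "\<Phi> ?g p = \<beta> p"
        using g(2)[OF frag] h(2) q_in[OF frag] extensional_arb[OF bilinear_mapsD(1)[OF \<beta>], of p]
        by (cases "p \<in> C") (auto simp: \<Phi>_def C_def)
    qed
    ultimately show ?thesis by (intro bexI[of _ ?g]) auto
  qed
  have "\<Phi> \<in> iso (Mult G) (bilinear_group G)"
  proof (rule isoI)
    show "\<Phi> \<in> hom (Mult G) (bilinear_group G)"
    proof (rule homI)
      fix f g assume fg: "f \<in> carrier (Mult G)" "g \<in> carrier (Mult G)"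
      show "\<Phi> f \<in> carrier (bilinear_group G)" using fg \<Phi>_in by (simp add: M hom_group_def)
      show "\<Phi> (f \<otimes>\<^bsub>Mult G\<^esub> g) = \<Phi> f \<otimes>\<^bsub>bilinear_group G\<^esub> \<Phi> g"
        using q_in[OF frag] by (auto simp: M hom_group_def \<Phi>_def C_def intro!: restrict_ext)
    qed
    show "bij_betw \<Phi> (carrier (Mult G)) (carrier (bilinear_group G))"
      unfolding bij_betw_def
    proof
      show "inj_on \<Phi> (carrier (Mult G))"
        by (rule inj_onI) (use inj in \<open>auto simp: M hom_group_def\<close>)
      show "\<Phi> ` carrier (Mult G) = carrier (bilinear_group G)"
        using \<Phi>_in surj by (force simp: M hom_group_def)
    qed
  qed
  then show ?thesis by (rule is_isoI)
qed

section \<open>Multiplications of the model groups\<close>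

context acd_data
begin

lemma unit_vec_loc: "i \<in> I \<Longrightarrow> unit_vec i \<in> loc_vecs I P"
  by (auto simp: loc_vecs_def unit_vec_def)

lemma unit_divisible:
  assumes "i \<in> I" "p \<in> P i"
  shows "\<exists>y\<in>X. unit_vec i = (\<lambda>j. of_nat (p ^ k) * y j)"
  by (rule block_divisible[OF unit_vec_loc[OF assms(1)], of "P i"])
     (use assms primes in \<open>auto simp: unit_vec_def split: if_splits\<close>)

text \<open>Divisibility by all powers of the primes in \<open>P i\<close> forces
  \<open>P i \<subseteq> P l\<close> at every nonzero coordinate \<open>l\<close>, hence equality by
  the antichain condition. The element lives in one block, and \<open>block_pure\<close>
  applies.\<close>

lemma divisible_block:
  assumes i: "i \<in> I" and x: "x \<in> X"
    and div: "\<And>p k. p \<in> P i \<Longrightarrow> \<exists>y\<in>X. x = (\<lambda>j. of_nat (p ^ k) * y j)"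
  shows "x \<in> loc_vecs I P" and "l \<in> I \<Longrightarrow> x l \<noteq> 0 \<Longrightarrow> P l = P i"
proof -
  have *: "P l = P i" if l: "l \<in> I" "x l \<noteq> 0" for l
  proof -
    have "P i \<subseteq> P l"
      using divisible_imp_mem[OF div] primes[OF i] l by blast
    then show ?thesis using antichain[OF i l(1)] by simp
  qed
  then show "l \<in> I \<Longrightarrow> x l \<noteq> 0 \<Longrightarrow> P l = P i" by blast
  show "x \<in> loc_vecs I P" using block_pure[OF x *] .
qed

text \<open>If \<open>i\<close> or \<open>j\<close> is in \<open>B\<close>, then the structure constants \<open>(i, j, l)\<close> of a multiplication are divisible
  by the denominator, once for each; dividing by the weights makes them range over a model group again.\<close>

definition weight :: "'i \<Rightarrow> rat" where
  "weight i = (if i \<in> B then of_int (m (P i)) else 1)"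

lemma weight_nz: "i \<in> I \<Longrightarrow> weight i \<noteq> 0"
  using den_pos[of i] by (auto simp: weight_def)

text \<open>Structure constants whose three indices are not all in one block vanish, so they need no
  coordinates.\<close>

definition I3 :: "('i \<times> 'i \<times> 'i) set" where
  "I3 = {(i, j, l). i \<in> I \<and> j \<in> I \<and> l \<in> I \<and> P i = P l \<and> P j = P l}"

definition P3 :: "'i \<times> 'i \<times> 'i \<Rightarrow> nat set" where
  "P3 = (\<lambda>(i, j, l). P l)"

lemma P3_apply: "P3 (i, j, l) = P l"
  by (simp add: P3_def)

text \<open>In each block the diagonal triple of the base index is the only one that can carry a
  denominator.\<close>

definition B3 :: "('i \<times> 'i \<times> 'i) set" where
  "B3 = (\<lambda>b. (b, b, b)) ` B"

lemma in_B3: "(i, j, l) \<in> I3 \<Longrightarrow> (i, j, l) \<in> B3 \<longleftrightarrow> i \<in> B \<and> j \<in> B \<and> l \<in> B"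
  using base_unique by (auto simp: I3_def B3_def)

lemma acd_data_cube:
  assumes r: "\<And>i. i \<in> I \<Longrightarrow> m (P i) dvd 1 - s (P i) * r (P i)"
  shows "acd_data I3 P3 B3 m r"
proof
  show "finite I3" by (rule finite_subset[of _ "I \<times> I \<times> I"]) (use finite_index in \<open>auto simp: I3_def\<close>)
  show "m (P3 b) dvd k" if b: "b \<in> B3" and h: "\<And>j. j \<in> B3 \<Longrightarrow> j \<noteq> b \<Longrightarrow> m (P3 j) dvd k" for b k
  proof -
    obtain c where c: "c \<in> B" "b = (c, c, c)" using b by (auto simp: B3_def)
    have "m (P j) dvd k" if "j \<in> B" "j \<noteq> c" for j
      using h[of "(j, j, j)"] that c by (auto simp: B3_def P3_def)
    then show ?thesis using base_pure[OF c(1)] c(2) by (auto simp: P3_def)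
  qed
  show "\<exists>j\<in>B3. P3 j = P3 i" if "i \<in> I3" for i
  proof -
    obtain l where l: "l \<in> I" "P3 i = P l" using \<open>i \<in> I3\<close> by (auto simp: I3_def P3_def)
    then obtain b where "b \<in> B" "P b = P l" using base_surj by blast
    then show ?thesis using l by (auto simp: B3_def P3_def intro!: bexI[of _ "(b, b, b)"])
  qed
  show "coprime (r (P3 i)) (m (P3 i))" if "i \<in> I3" for i
  proof -
    obtain l where l: "l \<in> I" "P3 i = P l" using \<open>i \<in> I3\<close> by (auto simp: I3_def P3_def)
    then show ?thesis using coprime_if_dvd_one_diff[of "m (P l)" "r (P l)" "s (P l)"] r[of l]
      by (simp add: mult.commute)
  qed
  show "P3 i = P3 j" if "i \<in> I3" "j \<in> I3" "P3 i \<subseteq> P3 j" for i j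
    using antichain[of "snd (snd i)" "snd (snd j)"] that by (auto simp: I3_def P3_def)
qed (use primes base_subset den_coprime base_unique in
      \<open>auto simp: I3_def P3_def B3_def inj_on_def\<close>)

lemma card_cube_block: "card {x\<in>I3. P3 x = t} = card {i\<in>I. P i = t} ^ 3"
proof -
  have "{x\<in>I3. P3 x = t} = {i\<in>I. P i = t} \<times> {i\<in>I. P i = t} \<times> {i\<in>I. P i = t}"
    by (auto simp: I3_def P3_def)
  then show ?thesis by (simp add: card_cartesian_product power3_eq_cube)
qed

lemma image_P3: "P3 ` I3 = P ` I"
proof (intro equalityI subsetI)
  show "t \<in> P3 ` I3" if "t \<in> P ` I" for t
  proof -
    obtain i where "i \<in> I" "t = P i" using \<open>t \<in> P ` I\<close> by blast
    then show ?thesis by (intro image_eqI[of _ _ "(i, i, i)"]) (auto simp: I3_def P3_def)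
  qed
qed (auto simp: I3_def P3_def)

end

section \<open>Structure constants of a multiplication\<close>

locale acd_bilinear = acd_data I P B m s for I :: "'i set" and P B m s +
  fixes \<beta> :: "('i \<Rightarrow> rat) \<times> ('i \<Rightarrow> rat) \<Rightarrow> 'i \<Rightarrow> rat"
  assumes bilinear: "\<beta> \<in> bilinear_maps (vec_group X)"
begin

lemma \<beta>_in: "x \<in> X \<Longrightarrow> y \<in> X \<Longrightarrow> \<beta> (x, y) \<in> X"
  and \<beta>_add_left: "x \<in> X \<Longrightarrow> x' \<in> X \<Longrightarrow> y \<in> X \<Longrightarrow> \<beta> (x + x', y) = \<beta> (x, y) + \<beta> (x', y)"
  and \<beta>_add_right: "x \<in> X \<Longrightarrow> y \<in> X \<Longrightarrow> y' \<in> X \<Longrightarrow> \<beta> (x, y + y') = \<beta> (x, y) + \<beta> (x, y')"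
  using bilinear_mapsD[OF bilinear] by simp_all

lemma flipped: "acd_bilinear I P B m s (\<lambda>(x, y)\<in>X \<times> X. \<beta> (y, x))"
proof
  show "(\<lambda>(x, y)\<in>X \<times> X. \<beta> (y, x)) \<in> bilinear_maps (vec_group X)"
    by (rule bilinear_mapsI) (auto simp: \<beta>_in \<beta>_add_left \<beta>_add_right add_in)
qed

lemma \<beta>_sum_left: "x \<in> X \<Longrightarrow> y \<in> X \<Longrightarrow> \<beta> (x, y) l = (\<Sum>i\<in>I. x i * \<beta> (unit_vec i, y) l)"
  using additive_eq_sum[of "\<lambda>x. \<beta> (x, y) l" x] \<beta>_add_left by simp

lemma \<beta>_sum_right: "x \<in> X \<Longrightarrow> y \<in> X \<Longrightarrow> \<beta> (x, y) l = (\<Sum>i\<in>I. y i * \<beta> (x, unit_vec i) l)"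
  using additive_eq_sum[of "\<lambda>y. \<beta> (x, y) l" y] \<beta>_add_right by simp

text \<open>A biadditive map preserves divisibility in each argument, so the product inherits the
  infinite divisibility of \<open>unit_vec i\<close>. The other factor may be any element of
  \<open>X\<close>, in particular \<open>gen\<close>.\<close>

lemma \<beta>_unit_left:
  assumes i: "i \<in> I" and y: "y \<in> X"
  shows "\<beta> (unit_vec i, y) \<in> loc_vecs I P"
    and "l \<in> I \<Longrightarrow> \<beta> (unit_vec i, y) l \<noteq> 0 \<Longrightarrow> P l = P i"
proof -
  have div: "\<exists>z\<in>X. \<beta> (unit_vec i, y) = (\<lambda>j. of_nat (p ^ k) * z j)" if p: "p \<in> P i" for p k
  proof -
    obtain z where z: "z \<in> X" "unit_vec i = (\<lambda>j. of_nat (p ^ k) * z j)"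
      using unit_divisible[OF i p] by blast
    have "\<beta> (unit_vec i, y) = (\<lambda>j. of_nat (p ^ k) * \<beta> (z, y) j)"
      unfolding z(2)
      using additive_nmult[of "\<lambda>x. \<beta> (x, y) _" z "p ^ k"] \<beta>_add_left z(1) y by auto
    then show ?thesis using \<beta>_in[OF z(1) y] by blast
  qed
  have in_X: "\<beta> (unit_vec i, y) \<in> X" using \<beta>_in unit_in i y by blast
  show "\<beta> (unit_vec i, y) \<in> loc_vecs I P" using divisible_block(1)[OF i in_X div] .
  show "l \<in> I \<Longrightarrow> \<beta> (unit_vec i, y) l \<noteq> 0 \<Longrightarrow> P l = P i" using divisible_block(2)[OF i in_X div] .
qed

lemma \<beta>_unit_right:
  assumes i: "i \<in> I" and x: "x \<in> X"
  shows "\<beta> (x, unit_vec i) \<in> loc_vecs I P"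
    and "l \<in> I \<Longrightarrow> \<beta> (x, unit_vec i) l \<noteq> 0 \<Longrightarrow> P l = P i"
  using acd_bilinear.\<beta>_unit_left[OF flipped i x] unit_in[OF i] x by simp_all

lemma \<beta>_gen_left:
  assumes b: "b \<in> B" and l: "l \<in> I" "P l = P b" and y: "y \<in> X"
  shows "\<beta> (gen, y) l = gen b * \<beta> (unit_vec b, y) l"
proof -
  have "\<beta> (gen, y) l = (\<Sum>i\<in>I. gen i * \<beta> (unit_vec i, y) l)"
    by (rule \<beta>_sum_left[OF gen_in y])
  also have "\<dots> = (\<Sum>i\<in>{b}. gen i * \<beta> (unit_vec i, y) l)"
  proof (rule sum.mono_neutral_right[OF finite_index])
    show "\<forall>i\<in>I - {b}. gen i * \<beta> (unit_vec i, y) l = 0"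
    proof
      fix i assume i: "i \<in> I - {b}"
      show "gen i * \<beta> (unit_vec i, y) l = 0"
        using \<beta>_unit_left(2)[of i y l] base_unique[OF _ b, of i] i l y by (auto simp: gen_def)
    qed
  qed (use base_subset b in auto)
  finally show ?thesis by simp
qed

lemma \<beta>_gen_right:
  assumes "b \<in> B" and "l \<in> I" "P l = P b" and "x \<in> X"
  shows "\<beta> (x, gen) l = gen b * \<beta> (x, unit_vec b) l"
  using acd_bilinear.\<beta>_gen_left[OF flipped assms] assms gen_in unit_in base_subset by auto

lemma \<beta>_expand:
  assumes "x \<in> X" "y \<in> X"
  shows "\<beta> (x, y) l = (\<Sum>i\<in>I. \<Sum>j\<in>I. x i * y j * \<beta> (unit_vec i, unit_vec j) l)"
  unfolding \<beta>_sum_left[OF assms]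
proof (rule sum.cong[OF refl])
  fix i assume "i \<in> I"
  then show "x i * \<beta> (unit_vec i, y) l = (\<Sum>j\<in>I. x i * y j * \<beta> (unit_vec i, unit_vec j) l)"
    using \<beta>_sum_right[OF unit_in assms(2)] by (simp add: sum_distrib_left mult.assoc)
qed

end

context acd_data
begin

text \<open>If s r + m z = 1, then c/m = r (s/m) c + z c, and both terms are local.\<close>

lemma loc_divide_den:
  assumes b: "b \<in> B" and r: "m (P b) dvd 1 - s (P b) * r" and c: "c \<in> loc (P b)" "gen b * c \<in> loc (P b)"
  shows "c / of_int (m (P b)) \<in> loc (P b)"
proof -
  have m: "m (P b) > 0" using b base_subset den_pos by blast
  obtain z where z: "1 - s (P b) * r = m (P b) * z" using r by blast
  have "of_int r * (gen b * c) + of_int z * c \<in> loc (P b)" by (intro loc_add loc_mult[OF loc_of_int] c)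
  also have "of_int r * (gen b * c) + of_int z * c = of_int (s (P b) * r + m (P b) * z) * c / of_int (m (P b))"
    using b m by (simp add: gen_def field_simps)
  also have "s (P b) * r + m (P b) * z = 1" using z by simp
  finally show ?thesis by simp
qed

end

locale acd_cube = acd_data I P B m s for I :: "'i set" and P B m s +
  fixes r :: "nat set \<Rightarrow> int"
  assumes inverse: "i \<in> I \<Longrightarrow> m (P i) dvd 1 - s (P i) * r (P i)"
begin

sublocale cube: acd_data I3 P3 B3 m r
  by (rule acd_data_cube[OF inverse])

definition coords :: "(('i \<Rightarrow> rat) \<times> ('i \<Rightarrow> rat) \<Rightarrow> 'i \<Rightarrow> rat) \<Rightarrow> 'i \<times> 'i \<times> 'i \<Rightarrow> rat" where
  "coords \<beta> = (\<lambda>(i, j, l). if (i, j, l) \<in> I3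
     then \<beta> (unit_vec i, unit_vec j) l / (weight i * weight j) else 0)"

definition of_coords :: "('i \<times> 'i \<times> 'i \<Rightarrow> rat) \<Rightarrow> ('i \<Rightarrow> rat) \<times> ('i \<Rightarrow> rat) \<Rightarrow> 'i \<Rightarrow> rat" where
  "of_coords F = (\<lambda>(x, y)\<in>X \<times> X. \<lambda>l. \<Sum>i\<in>I. \<Sum>j\<in>I. (x i * weight i) * (y j * weight j) * F (i, j, l))"

text \<open>Products of \<open>gen\<close> with unit vectors are local, which gives a factor
  \<open>m\<close> as soon as \<open>i\<close> or \<open>j\<close> is a base index. If both are, the
  second division is controlled by \<open>\<beta> (gen, gen)\<close> instead: the number
  \<open>k\<close> of copies of \<open>gen\<close> in it is also the number of copies of the new
  generator, uniformly in all blocks.\<close>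

lemma coords_in:
  assumes "\<beta> \<in> bilinear_maps (vec_group X)"
  shows "coords \<beta> \<in> cube.X"
proof -
  interpret acd_bilinear I P B m s \<beta> by unfold_locales (rule assms)
  obtain k where k: "\<And>l. l \<in> I \<Longrightarrow> \<beta> (gen, gen) l - of_int k * gen l \<in> loc (P l)"
    using X_obtain[OF \<beta>_in[OF gen_in gen_in]] by blast
  have c_loc: "\<beta> (unit_vec i, unit_vec j) l \<in> loc (P l)" if "i \<in> I" "j \<in> I" "l \<in> I" for i j l
    using \<beta>_unit_left(1)[OF that(1) unit_in[OF that(2)]] that(3) by (simp add: loc_vecs_def)
  have left: "\<beta> (unit_vec i, unit_vec j) l / of_int (m (P l)) \<in> loc (P l)"
    if h: "(i, j, l) \<in> I3" "i \<in> B" for i j l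
  proof -
    have hI: "i \<in> I" "j \<in> I" "l \<in> I" "P i = P l" using h by (auto simp: I3_def)
    have "gen i * \<beta> (unit_vec i, unit_vec j) l \<in> loc (P l)"
      using \<beta>_unit_right(1)[OF hI(2) gen_in] \<beta>_gen_left[OF h(2) hI(3) _ unit_in[OF hI(2)]] hI
      by (auto simp: loc_vecs_def)
    then show ?thesis
      using loc_divide_den[OF h(2) inverse[OF hI(1)]] c_loc[OF hI(1-3)] hI(4) by simp
  qed
  have right: "\<beta> (unit_vec i, unit_vec j) l / of_int (m (P l)) \<in> loc (P l)"
    if h: "(i, j, l) \<in> I3" "j \<in> B" for i j l
  proof -
    have hI: "i \<in> I" "j \<in> I" "l \<in> I" "P j = P l" using h by (auto simp: I3_def)
    have "gen j * \<beta> (unit_vec i, unit_vec j) l \<in> loc (P l)"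
      using \<beta>_unit_left(1)[OF hI(1) gen_in] \<beta>_gen_right[OF h(2) hI(3) _ unit_in[OF hI(1)]] hI
      by (auto simp: loc_vecs_def)
    then show ?thesis
      using loc_divide_den[OF h(2) inverse[OF hI(2)]] c_loc[OF hI(1-3)] hI(4) by simp
  qed
  \<comment> \<open>With c the constant divided once by m, \<open>\<beta> (gen, gen) l\<close> is
    s^2 c/m and agrees with \<open>k\<close> times \<open>gen l\<close> modulo local numbers.
    Multiplying by r^2 isolates c/m, and r^2 s/m agrees with r/m.\<close>
  have both: "\<beta> (unit_vec b, unit_vec b) l / (of_int (m (P l)) * of_int (m (P l)))
      - of_int k * cube.gen (b, b, l) \<in> loc (P l)"
    if h: "(b, b, l) \<in> I3" "b \<in> B" for b l
  proof -
    have hI: "b \<in> I" "l \<in> I" "P b = P l" using h by (auto simp: I3_def)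
    let ?m = "of_int (m (P l)) :: rat" and ?s = "of_int (s (P l)) :: rat" and ?r = "of_int (r (P l)) :: rat"
    define c where "c = \<beta> (unit_vec b, unit_vec b) l / ?m"
    have m: "?m \<noteq> 0" using den_pos[OF hI(2)] by simp
    have c: "c \<in> loc (P l)" using left h unfolding c_def by blast
    obtain z where "1 - s (P l) * r (P l) = m (P l) * z" using inverse[OF hI(2)] by blast
    then have "of_int (1 - s (P l) * r (P l)) = (of_int (m (P l) * z) :: rat)" by (rule arg_cong)
    then have z: "?s * ?r = 1 - ?m * of_int z" by simp
    have gb: "gen b = ?s / ?m" using h(2) hI(3) by (simp add: gen_def)
    have "\<beta> (gen, gen) l = gen b * gen b * (c * ?m)"
      using \<beta>_gen_left[OF h(2) hI(2) _ gen_in] \<beta>_gen_right[OF h(2) hI(2) _ unit_in[OF hI(1)]] hI m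
      by (simp add: c_def)
    also have "\<dots> = ?s * ?s * c / ?m" using m by (simp add: gb)
    finally have 1: "?s * ?s * c / ?m - of_int k * gen l \<in> loc (P l)" using k[OF hI(2)] by simp
    \<comment> \<open>Since s r = 1 - m z, the square of s r falls short of 1 by m (2 z - m z^2).
      The second summand restores the coefficient 1 of c/m.\<close>
    have "?r * ?r * (?s * ?s * c / ?m - of_int k * gen l) + (2 * of_int z - ?m * of_int z * of_int z) * c \<in> loc (P l)"
      using 1 c loc_of_int[of "2 * z - m (P l) * z * z" "P l"]
      by (intro loc_add loc_mult[OF _ 1] loc_mult[OF _ c] loc_mult loc_of_int) simp
    also have "?r * ?r * (?s * ?s * c / ?m - of_int k * gen l) + (2 * of_int z - ?m * of_int z * of_int z) * c
       = ((?s * ?r) * (?s * ?r) + ?m * (2 * of_int z - ?m * of_int z * of_int z)) * c / ?m - of_int k * (?r * ?r * gen l)"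
      using m by (simp add: field_simps)
    also have "(?s * ?r) * (?s * ?r) + ?m * (2 * of_int z - ?m * of_int z * of_int z) = 1"
      unfolding z by (simp add: algebra_simps)
    finally have 2: "c / ?m - of_int k * (?r * ?r * gen l) \<in> loc (P l)" by simp
    have cg: "cube.gen (b, b, l) = (if l \<in> B then ?r / ?m else 0)"
      using in_B3[OF h(1)] h(2) by (simp add: cube.gen_def P3_apply)
    have "c / ?m - of_int k * cube.gen (b, b, l) \<in> loc (P l)"
    proof (cases "l \<in> B")
      case True
      then have "?r * ?r * gen l = ?r * (?s * ?r) / ?m" by (simp add: gen_def)
      also have "\<dots> = ?r / ?m - ?r * of_int z" unfolding z using m by (simp add: field_simps)
      finally have rm: "?r / ?m = ?r * ?r * gen l + ?r * of_int z" by simp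
      have "c / ?m - of_int k * (?r / ?m) =
          c / ?m - of_int k * (?r * ?r * gen l) - of_int (k * r (P l) * z)"
        unfolding rm by (simp add: algebra_simps)
      also have "\<dots> \<in> loc (P l)" by (intro loc_diff 2 loc_of_int)
      finally show ?thesis using True by (simp add: cg)
    next
      case False
      then show ?thesis using 2 by (simp add: cg gen_def)
    qed
    then show ?thesis by (simp add: c_def)
  qed
  show ?thesis
  proof (rule cube.XI[where k = k])
    fix t assume t: "t \<in> I3"
    obtain i j l where ijl: "t = (i, j, l)" by (cases t)
    have h: "(i, j, l) \<in> I3" using t ijl by simp
    then have hI: "i \<in> I" "j \<in> I" "l \<in> I" "P i = P l" "P j = P l" by (auto simp: I3_def)
    have F: "coords \<beta> (i, j, l) = \<beta> (unit_vec i, unit_vec j) l / (weight i * weight j)"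
      using h by (simp add: coords_def)
    have "coords \<beta> (i, j, l) - of_int k * cube.gen (i, j, l) \<in> loc (P l)"
    proof (cases "i \<in> B \<and> j \<in> B")
      case True
      then have "i = j" using base_unique hI by simp
      then show ?thesis using both[of i l] h True F hI by (simp add: weight_def)
    next
      case False
      then have "cube.gen (i, j, l) = 0" using in_B3[OF h] by (auto simp: cube.gen_def)
      then show ?thesis
        using False left[OF h] right[OF h] c_loc[OF hI(1-3)] hI F
        by (cases "i \<in> B"; cases "j \<in> B") (simp_all add: weight_def)
    qed
    then show "coords \<beta> t - of_int k * cube.gen t \<in> loc (P3 t)" by (simp add: ijl P3_apply)
  qed (auto simp: coords_def)
qed

lemma mult_weight_loc:
  assumes x: "x \<in> X" and i: "i \<in> I"
  shows "x i * weight i \<in> loc (P i)"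
proof (cases "i \<in> B")
  case True
  obtain k where k: "x i - of_int k * gen i \<in> loc (P i)" using X_obtain[OF x] i by blast
  have "of_int (m (P i)) * (x i - of_int k * gen i) + of_int k * (of_int (m (P i)) * gen i) \<in> loc (P i)"
    by (intro loc_add loc_mult[OF loc_of_int] k den_mult_gen i)
  then show ?thesis using True by (simp add: weight_def algebra_simps)
next
  case False
  obtain k where "x i - of_int k * gen i \<in> loc (P i)" using X_obtain[OF x] i by blast
  then show ?thesis using False by (simp add: weight_def gen_def)
qed

text \<open>After weighting, all summands are local except the one at a base triple. There
  \<open>x\<close> and \<open>y\<close> contribute k s and k' s modulo m, and \<open>F\<close>
  contributes n r/m up to a local number. As s r is 1 modulo m, this leaves
  \<open>n * k * k'\<close> copies of s/m, the same number in every block.\<close>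

lemma of_coords_in_X:
  assumes F: "F \<in> cube.X" and x: "x \<in> X" and y: "y \<in> X"
  shows "of_coords F (x, y) \<in> X"
proof -
  obtain k where k: "\<And>i. i \<in> I \<Longrightarrow> x i - of_int k * gen i \<in> loc (P i)" using X_obtain[OF x] by blast
  obtain k' where k': "\<And>i. i \<in> I \<Longrightarrow> y i - of_int k' * gen i \<in> loc (P i)" using X_obtain[OF y] by blast
  obtain n where n: "\<And>t. t \<in> I3 \<Longrightarrow> F t - of_int n * cube.gen t \<in> loc (P3 t)"
    using cube.X_obtain[OF F] by blast
  define T where "T = (\<lambda>l i j. (x i * weight i) * (y j * weight j) * F (i, j, l))"
  define K where "K = n * k * k'"
  have F0: "F t = 0" if "t \<notin> I3" for t using cube.supp[OF F that] .
  have T_loc: "T l i j - (if i = l \<and> j = l then of_int K * gen l else 0) \<in> loc (P l)"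
    if i: "i \<in> I" and j: "j \<in> I" and l: "l \<in> I" for i j l
  proof (cases "(i, j, l) \<in> I3")
    case h: True
    then have P: "P i = P l" "P j = P l" by (auto simp: I3_def)
    have a: "x i * weight i \<in> loc (P l)" "y j * weight j \<in> loc (P l)"
      using mult_weight_loc[OF x i] mult_weight_loc[OF y j] P by simp_all
    have f: "F (i, j, l) - of_int n * cube.gen (i, j, l) \<in> loc (P l)"
      using n[OF h] by (simp add: P3_apply)
    show ?thesis
    proof (cases "i \<in> B \<and> j \<in> B \<and> l \<in> B")
      case True
      then have ij: "i = l" "j = l" using base_unique P by auto
      have b: "l \<in> B" using True by blast
      let ?m = "of_int (m (P l)) :: rat" and ?s = "of_int (s (P l)) :: rat" and ?r = "of_int (r (P l)) :: rat"
      have m: "?m \<noteq> 0" using den_pos[OF l] by simp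
      obtain z where "1 - s (P l) * r (P l) = m (P l) * z" using inverse[OF l] by blast
      then have "of_int (1 - s (P l) * r (P l)) = (of_int (m (P l) * z) :: rat)" by (rule arg_cong)
      then have z: "?s * ?r = 1 - ?m * of_int z" by simp
      have gl: "gen l = ?s / ?m" and wl: "weight l = ?m"
        using b by (auto simp: gen_def weight_def)
      have cg: "cube.gen (l, l, l) = ?r / ?m"
        using in_B3[OF h] True unfolding ij by (simp add: cube.gen_def P3_apply)
      define \<rho> where "\<rho> = x l - of_int k * gen l"
      define \<rho>' where "\<rho>' = y l - of_int k' * gen l"
      define \<rho>'' where "\<rho>'' = F (l, l, l) - of_int n * cube.gen (l, l, l)"
      have \<rho>: "\<rho> \<in> loc (P l)" "\<rho>' \<in> loc (P l)" "\<rho>'' \<in> loc (P l)"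
        using k[OF l] k'[OF l] f ij by (simp_all add: \<rho>_def \<rho>'_def \<rho>''_def)
      have xl: "x l * weight l = of_int k * ?s + ?m * \<rho>"
        using m by (simp add: \<rho>_def wl gl algebra_simps)
      have yl: "y l * weight l = of_int k' * ?s + ?m * \<rho>'"
        using m by (simp add: \<rho>'_def wl gl algebra_simps)
      have Fl: "F (l, l, l) = of_int n * (?r / ?m) + \<rho>''" by (simp add: \<rho>''_def cg)
      have "T l l l - of_int K * gen l =
          x l * weight l * (y l * weight l) * \<rho>'' +
          of_int n * ?r * (of_int k * ?s * \<rho>' + of_int k' * ?s * \<rho> + ?m * \<rho> * \<rho>') +
          of_int n * of_int k * of_int k' * ?s * (?s * ?r - 1) / ?m"
        unfolding T_def Fl xl yl K_def gl using m by (simp add: field_simps)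
      also have "of_int n * of_int k * of_int k' * ?s * (?s * ?r - 1) / ?m = 
          of_int (- (n * k * k' * s (P l) * z))"
        unfolding z using m by simp
      also have "x l * weight l * (y l * weight l) * \<rho>'' +
          of_int n * ?r * (of_int k * ?s * \<rho>' + of_int k' * ?s * \<rho> + ?m * \<rho> * \<rho>') +
          of_int (- (n * k * k' * s (P l) * z)) \<in> loc (P l)"
        by (intro loc_add loc_mult[OF loc_mult[OF a, unfolded ij] \<rho>(3)] loc_mult loc_of_int \<rho>)
      finally show ?thesis by (simp add: ij)
    next
      case False
      then have "cube.gen (i, j, l) = 0" using in_B3[OF h] by (auto simp: cube.gen_def)
      then have "F (i, j, l) \<in> loc (P l)" using f by simp
      then have "T l i j \<in> loc (P l)" unfolding T_def by (rule loc_mult[OF loc_mult[OF a]])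
      moreover have "gen l = 0" if "i = l \<and> j = l" using that False by (auto simp: gen_def)
      ultimately show ?thesis by auto
    qed
  next
    case False
    then have "\<not> (i = l \<and> j = l)" using l by (auto simp: I3_def)
    then show ?thesis using F0[OF False] by (auto simp: T_def)
  qed
  show ?thesis
  proof (rule XI[where k = K])
    fix l assume l: "l \<in> I"
    have "of_coords F (x, y) l - of_int K * gen l =
        (\<Sum>i\<in>I. \<Sum>j\<in>I. T l i j) - (\<Sum>i\<in>I. \<Sum>j\<in>I. if i = l \<and> j = l then of_int K * gen l else 0)"
    proof -
      have "(\<Sum>i\<in>I. \<Sum>j\<in>I. if i = l \<and> j = l then of_int K * gen l else 0) =
          (\<Sum>i\<in>I. if i = l then \<Sum>j\<in>I. if j = l then of_int K * gen l else 0 else 0)"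
        by (rule sum.cong) auto
      also have "\<dots> = of_int K * gen l" using l finite_index by simp
      finally show ?thesis using x y by (simp add: of_coords_def T_def)
    qed
    also have "\<dots> = (\<Sum>i\<in>I. \<Sum>j\<in>I. T l i j - (if i = l \<and> j = l then of_int K * gen l else 0))"
      by (simp add: sum_subtractf)
    also have "\<dots> \<in> loc (P l)" by (intro loc_sum T_loc l)
    finally show "of_coords F (x, y) l - of_int K * gen l \<in> loc (P l)" .
  next
    fix l assume "l \<notin> I"
    then have "F (i, j, l) = 0" for i j using F0[of "(i, j, l)"] by (auto simp: I3_def)
    then show "of_coords F (x, y) l = 0" using x y by (simp add: of_coords_def)
  qed
qed

lemma of_coords_in:
  assumes F: "F \<in> cube.X"
  shows "of_coords F \<in> bilinear_maps (vec_group X)"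
proof (rule bilinear_mapsI)
  show "of_coords F \<in> extensional (carrier (vec_group X) \<times> carrier (vec_group X))"
    by (simp add: of_coords_def)
  show "of_coords F (x, y) \<in> carrier (vec_group X)"
    if "x \<in> carrier (vec_group X)" "y \<in> carrier (vec_group X)" for x y
    using of_coords_in_X[OF F] that by simp
qed (auto simp: add_in of_coords_def fun_eq_iff algebra_simps sum.distrib)

lemma coords_of_coords:
  assumes F: "F \<in> cube.X"
  shows "coords (of_coords F) = F"
proof
  fix t :: "'i \<times> 'i \<times> 'i"
  obtain i j l where t: "t = (i, j, l)" by (cases t)
  show "coords (of_coords F) t = F t"
  proof (cases "t \<in> I3")
    case True
    then have I: "i \<in> I" "j \<in> I" "l \<in> I" by (auto simp: t I3_def)
    have "of_coords F (unit_vec i, unit_vec j) l =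
        (\<Sum>i'\<in>I. \<Sum>j'\<in>I. if i' = i then if j' = j then weight i * weight j * F (i, j, l) else 0 else 0)"
      using unit_in I by (auto simp: of_coords_def unit_vec_def intro!: sum.cong)
    also have "\<dots> = (\<Sum>i'\<in>I. if i' = i then (\<Sum>j'\<in>I. if j' = j then weight i * weight j * F (i, j, l) else 0) else 0)"
      by (rule sum.cong) auto
    also have "\<dots> = weight i * weight j * F (i, j, l)" using I finite_index by simp
    finally show ?thesis using True weight_nz I by (simp add: coords_def t)
  next
    case False
    then show ?thesis using cube.supp[OF F] by (simp add: coords_def t)
  qed
qed

lemma of_coords_coords:
  assumes \<beta>: "\<beta> \<in> bilinear_maps (vec_group X)"
  shows "of_coords (coords \<beta>) = \<beta>"
proof
  interpret acd_bilinear I P B m s \<beta> by unfold_locales (rule \<beta>)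
  fix p
  show "of_coords (coords \<beta>) p = \<beta> p"
  proof (cases "p \<in> X \<times> X")
    case True
    then obtain x y where p: "p = (x, y)" "x \<in> X" "y \<in> X" by blast
    have "of_coords (coords \<beta>) (x, y) l = \<beta> (x, y) l" for l
    proof (cases "l \<in> I")
      case l: True
      have eq: "(x i * weight i) * (y j * weight j) * coords \<beta> (i, j, l) =
          x i * y j * \<beta> (unit_vec i, unit_vec j) l" if i: "i \<in> I" and j: "j \<in> I" for i j
      proof (cases "(i, j, l) \<in> I3")
        case True
        then show ?thesis using weight_nz i j by (simp add: coords_def)
      next
        case False
        then have "\<beta> (unit_vec i, unit_vec j) l = 0"
          using \<beta>_unit_left(2)[OF i unit_in[OF j] l] \<beta>_unit_right(2)[OF j unit_in[OF i] l] i j l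
          by (auto simp: I3_def)
        then show ?thesis using False by (simp add: coords_def)
      qed
      have "of_coords (coords \<beta>) (x, y) l =
          (\<Sum>i\<in>I. \<Sum>j\<in>I. (x i * weight i) * (y j * weight j) * coords \<beta> (i, j, l))"
        using p by (simp add: of_coords_def)
      also have "\<dots> = \<beta> (x, y) l"
        unfolding \<beta>_expand[OF p(2,3)] by (intro sum.cong refl eq)
      finally show ?thesis .
    next
      case False
      have "coords \<beta> (i, j, l) = 0" for i j using False by (auto simp: coords_def I3_def)
      then show ?thesis using supp[OF \<beta>_in[OF p(2,3)] False] p by (simp add: of_coords_def)
    qed
    then show ?thesis by (simp add: p(1) fun_eq_iff)
  next
    case False
    then show ?thesis
      using extensional_arb[OF bilinear_mapsD(1)[OF \<beta>], of p] by (auto simp: of_coords_def)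
  qed
qed

lemma bilinear_group_iso_cube: "bilinear_group (vec_group X) \<cong> vec_group cube.X"
proof (rule is_isoI[OF isoI])
  show "coords \<in> hom (bilinear_group (vec_group X)) (vec_group cube.X)"
  proof (rule homI)
    fix \<beta> \<gamma>
    assume "\<beta> \<in> carrier (bilinear_group (vec_group X))" "\<gamma> \<in> carrier (bilinear_group (vec_group X))"
    show "coords (\<beta> \<otimes>\<^bsub>bilinear_group (vec_group X)\<^esub> \<gamma>) = coords \<beta> \<otimes>\<^bsub>vec_group cube.X\<^esub> coords \<gamma>"
      using unit_in by (auto simp: coords_def fun_eq_iff I3_def add_divide_distrib)
  qed (simp add: coords_in)
  show "bij_betw coords (carrier (bilinear_group (vec_group X))) (carrier (vec_group cube.X))"
    by (rule bij_betwI[where g = of_coords])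
       (auto simp: coords_in of_coords_in coords_of_coords of_coords_coords)
qed

end

section \<open>Subgroups of the rationals\<close>

locale rat_subgroup =
  fixes J :: "rat set"
  assumes one_in: "1 \<in> J" and add_in: "x \<in> J \<Longrightarrow> y \<in> J \<Longrightarrow> x + y \<in> J" and minus_in: "x \<in> J \<Longrightarrow> - x \<in> J"
begin

lemma zero_in: "0 \<in> J"
  using add_in[OF one_in minus_in[OF one_in]] by simp

lemma nmult_in: "x \<in> J \<Longrightarrow> of_nat k * x \<in> J"
  by (induction k) (auto simp: zero_in algebra_simps intro: add_in)

lemma zmult_in: "x \<in> J \<Longrightarrow> of_int k * x \<in> J"
  using nmult_in[of x "nat k"] minus_in[OF nmult_in[of x "nat (- k)"]] by (cases "k \<ge> 0") auto

text \<open>Partial fractions: u b + v c = 1 gives 1/(b c) = u/c + v/b.\<close>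

lemma inverse_mult_in:
  assumes "coprime b c" "b > 0" "c > 0" "1 / of_nat b \<in> J" "1 / of_nat c \<in> J"
  shows "1 / of_nat (b * c) \<in> J"
proof -
  obtain u v where uv: "u * int b + v * int c = 1"
    using bezout_int[of "int b" "int c"] assms(1) by auto
  have "of_int u * (1 / of_nat c) + of_int v * (1 / of_nat b) \<in> J"
    by (intro add_in zmult_in assms)
  also have "of_int u * (1 / of_nat c) + of_int v * (1 / of_nat b) =
      (of_int (u * int b + v * int c) / of_nat (b * c) :: rat)"
    using assms(2,3) by (simp add: field_simps)
  finally show ?thesis unfolding uv by simp
qed

lemma inverse_den_in:
  assumes "of_int a / of_int b \<in> J" "coprime a b" "b \<noteq> 0"
  shows "1 / of_int b \<in> J"
proof -
  obtain u v where uv: "u * a + v * b = 1" using bezout_int[of a b] assms(2) by auto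
  have "of_int u * (of_int a / of_int b) + of_int v * 1 \<in> J"
    by (intro add_in zmult_in assms one_in)
  also have "of_int u * (of_int a / of_int b) + of_int v * 1 = (of_int (u * a + v * b) / of_int b :: rat)"
    using assms(3) by (simp add: field_simps)
  finally show ?thesis unfolding uv by simp
qed

text \<open>A subgroup containing 1 contains 1/b for each of its reduced fractions a/b, and unit
  fractions are assembled from prime powers by \<open>inverse_mult_in\<close>. So the inverse prime
  powers in the subgroup determine it.\<close>

lemma eq_loc:
  assumes P: "\<And>p. p \<in> P \<Longrightarrow> prime p" "\<And>p k. p \<in> P \<Longrightarrow> 1 / of_nat p ^ k \<in> J"
    and not_P: "\<And>p. prime p \<Longrightarrow> p \<notin> P \<Longrightarrow> 1 / of_nat p \<notin> J"
  shows "J = loc P"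
proof (intro equalityI subsetI)
  fix q assume q: "q \<in> J"
  obtain a b where ab: "q = of_int a / of_int b" "b > 0" "coprime a b"
    by (metis Rat_cases Fract_of_int_quotient)
  have b: "1 / of_int b \<in> J" using inverse_den_in[of a b] ab q by simp
  have "p \<in> P" if p: "prime p" "p dvd nat b" for p
  proof (rule ccontr)
    assume np: "p \<notin> P"
    obtain c where c: "nat b = p * c" using p by blast
    then have "b = int p * int c" using ab(2) by (metis int_nat_eq of_nat_mult order_less_imp_le)
    then have "of_nat c * (1 / of_int b) = (1 / of_nat p :: rat)" using ab(2) by auto
    then show False using nmult_in[OF b, of c] not_P[OF p(1) np] by simp
  qed
  then have "nat b \<in> dens P" using ab(2) by (auto simp: dens_def)
  then show "q \<in> loc P" using locI[of "nat b" P a] ab by simp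
next
  fix q assume "q \<in> loc P"
  then obtain a b where ab: "q = of_int a / of_nat b" "b \<in> dens P" by (rule locE)
  have "1 / of_nat b \<in> J" using ab(2)
  proof (induction b rule: less_induct)
    case (less b)
    show ?case
    proof (cases "b = 1")
      case True
      then show ?thesis using one_in by simp
    next
      case False
      then obtain p where p: "prime p" "p dvd b" using prime_factor_nat by blast
      have b0: "b > 0" using less.prems dens_pos by blast
      have pP: "p \<in> P" using less.prems p by (auto simp: dens_def)
      have "\<exists>e c. b = p ^ e * c \<and> \<not> p dvd c"
        using multiplicity_decompose'[of b p] b0 p by (metis not_prime_unit neq0_conv)
      then obtain e c where c: "b = p ^ e * c" "\<not> p dvd c" by blast
      have "e \<noteq> 0" using c p(2) by (cases e) auto
      then have e: "p ^ e > 1" using prime_gt_1_nat[OF p(1)] by (metis neq0_conv one_less_power)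
      have c0: "c > 0" using c b0 by (cases c) auto
      have "c < b" using e c0 by (simp add: c(1))
      moreover have "c \<in> dens P"
        using less.prems c0 unfolding c(1) dens_def by (auto intro: dvd_mult)
      ultimately have cJ: "1 / of_nat c \<in> J" using less.IH by blast
      have "coprime (p ^ e) c" using p(1) c(2) by (simp add: prime_imp_coprime)
      then show ?thesis
        unfolding c(1) using cJ P(2)[OF pP, of e] prime_gt_0_nat[OF p(1)] c0
        by (intro inverse_mult_in) auto
    qed
  qed
  then show "q \<in> J" using zmult_in[of "1 / of_nat b" a] ab by simp
qed

text \<open>\<open>E\<close> collects finitely many primes with bounded, possibly nonzero exponents.
  Multiplying by the product of the maximal powers \<open>p ^ h p\<close> brings all of them to
  zero. This absorbs the finite changes of height that a type does not see.\<close>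

lemma eq_loc_scaled:
  assumes fin: "finite E" and E: "\<And>p. p \<in> E \<Longrightarrow> prime p \<and> p \<notin> P \<and> (\<exists>k. 1 / of_nat p ^ k \<notin> J)"
    and P: "\<And>p. p \<in> P \<Longrightarrow> prime p" "\<And>p k. p \<in> P \<Longrightarrow> 1 / of_nat p ^ k \<in> J"
    and not_P: "\<And>p. prime p \<Longrightarrow> p \<notin> P \<Longrightarrow> p \<notin> E \<Longrightarrow> 1 / of_nat p \<notin> J"
  obtains N :: nat where "N > 0" "(\<lambda>q. of_nat N * q) ` J = loc P"
proof -
  have "\<exists>h. 1 / of_nat p ^ h \<in> J \<and> 1 / of_nat p ^ Suc h \<notin> J" if p: "p \<in> E" for p
  proof (rule ccontr)
    assume no: "\<nexists>h. 1 / of_nat p ^ h \<in> J \<and> 1 / of_nat p ^ Suc h \<notin> J"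
    have "1 / of_nat p ^ k \<in> J" for k
      by (induction k) (use one_in no in auto)
    then show False using E p by blast
  qed
  then obtain h where h: "\<And>p. p \<in> E \<Longrightarrow> 1 / of_nat p ^ h p \<in> J" "\<And>p. p \<in> E \<Longrightarrow> 1 / of_nat p ^ Suc (h p) \<notin> J"
    by metis
  define N where "N = (\<Prod>p\<in>E. p ^ h p)"
  have N0: "N > 0" using E prime_gt_0_nat fin by (auto simp: N_def prod_pos)
  have cop: "coprime (p ^ k) (\<Prod>p\<in>F. p ^ h p)" if "F \<subseteq> E" "prime p" "p \<notin> F" for p k F
    using that E by (intro prod_coprime_right) (metis coprime_power_left_iff coprime_power_right_iff primes_coprime subsetD)
  have NJ: "1 / of_nat N \<in> J"
  proof -
    have "1 / of_nat (\<Prod>p\<in>F. p ^ h p) \<in> J" if "F \<subseteq> E" for F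
      using finite_subset[OF that fin] that
    proof (induction F rule: finite_induct)
      case empty
      then show ?case using one_in by simp
    next
      case (insert p F)
      let ?c = "\<Prod>p\<in>F. p ^ h p"
      have "?c > 0" using insert E prime_gt_0_nat by (intro prod_pos) auto
      moreover have "p ^ h p > 0" using insert E prime_gt_0_nat by auto
      moreover have "coprime (p ^ h p) ?c" using cop[of F p "h p"] insert E by auto
      moreover have "1 / of_nat (p ^ h p) \<in> J" using h(1) insert by simp
      moreover have "1 / of_nat ?c \<in> J" using insert by simp
      ultimately have "1 / of_nat (p ^ h p * ?c) \<in> J" by (intro inverse_mult_in)
      then show ?case using insert by simp
    qed
    then show ?thesis by (simp add: N_def)
  qed
  let ?K = "(\<lambda>q. of_nat N * q) ` J"
  interpret K: rat_subgroup ?K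
  proof
    show "1 \<in> ?K" using NJ N0 by (intro image_eqI[of _ _ "1 / of_nat N"]) auto
    show "x + y \<in> ?K" if "x \<in> ?K" "y \<in> ?K" for x y
      using that add_in by (auto simp: distrib_left[symmetric])
    show "- x \<in> ?K" if "x \<in> ?K" for x
      using that minus_in by (auto simp: image_iff) (metis mult_minus_right)
  qed
  have inv: "q / of_nat N \<in> J" if "q \<in> ?K" for q
    using that N0 by auto
  have "?K = loc P"
  proof (rule K.eq_loc)
    show "prime p" if "p \<in> P" for p using P that by blast
    show "1 / of_nat p ^ k \<in> ?K" if p: "p \<in> P" for p k
    proof -
      have "coprime (p ^ k) N" unfolding N_def using cop[of E p k] E P p by blast
      then have "1 / of_nat (p ^ k * N) \<in> J"
        using NJ P(2)[OF p, of k] P(1)[OF p] N0 by (intro inverse_mult_in) (auto simp: prime_gt_0_nat)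
      then show ?thesis
        using N0 by (intro image_eqI[of _ _ "1 / of_nat (p ^ k * N)"]) auto
    qed
    show "1 / of_nat p \<notin> ?K" if p: "prime p" "p \<notin> P" for p
    proof
      assume "1 / of_nat p \<in> ?K"
      then have 1: "1 / of_nat p / of_nat N \<in> J" by (rule inv)
      show False
      proof (cases "p \<in> E")
        case True
        define c where "c = (\<Prod>p\<in>E - {p}. p ^ h p)"
        have c: "N = p ^ h p * c"
          unfolding N_def c_def using fin True by (simp add: prod.remove)
        then have "c > 0" using N0 by (cases c) auto
        then have "of_nat c * (1 / of_nat p / of_nat N) = (1 / of_nat p ^ Suc (h p) :: rat)"
          by (simp add: c)
        then show False using nmult_in[OF 1, of c] h(2)[OF True] by simp
      next
        case False
        then show False using nmult_in[OF 1, of N] not_P[OF p False] N0 by simp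
      qed
    qed
  qed
  with N0 show ?thesis using that by blast
qed

end

section \<open>Additive functionals on abelian groups\<close>

locale additive_functional = comm_group G for G (structure) +
  fixes h :: "'a \<Rightarrow> rat"
  assumes mult: "x \<in> carrier G \<Longrightarrow> y \<in> carrier G \<Longrightarrow> h (x \<otimes> y) = h x + h y"
begin

lemma one: "h \<one> = 0"
  using mult[of \<one> \<one>] by simp

lemma inv: "x \<in> carrier G \<Longrightarrow> h (inv x) = - h x"
  using mult[of x "inv x"] one by simp

lemma nat_pow: "x \<in> carrier G \<Longrightarrow> h (x [^] (n::nat)) = of_nat n * h x"
  by (induction n) (auto simp: one mult algebra_simps)

lemma int_pow: "x \<in> carrier G \<Longrightarrow> h (x [^] (n::int)) = of_int n * h x"
  by (cases n rule: int_cases2) (auto simp: int_pow_int int_pow_neg nat_pow inv)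

lemma finprod: "finite F \<Longrightarrow> f \<in> F \<rightarrow> carrier G \<Longrightarrow> h (finprod G f F) = (\<Sum>x\<in>F. h (f x))"
  by (induction F rule: finite_induct) (auto simp: one mult Pi_def)

end

section \<open>Groups of rank one\<close>

lemma torsion_free_int_pow:
  assumes "torsion_free_group G" "x \<in> carrier G" "x [^]\<^bsub>G\<^esub> (n::int) = \<one>\<^bsub>G\<^esub>" "n \<noteq> 0"
  shows "x = \<one>\<^bsub>G\<^esub>"
proof -
  interpret comm_group G using assms(1) by (simp add: torsion_free_group_def)
  have pow: "x [^]\<^bsub>G\<^esub> nat \<bar>n\<bar> = \<one>\<^bsub>G\<^esub>"
  proof (cases "n > 0")
    case True
    then show ?thesis using assms(3) by (metis abs_of_pos int_nat_eq int_pow_int order_less_imp_le)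
  next
    case False
    have "x [^]\<^bsub>G\<^esub> (- n) = \<one>\<^bsub>G\<^esub>" using assms by (simp add: int_pow_neg)
    then show ?thesis using False assms(4) by (metis abs_of_nonpos int_nat_eq int_pow_int neg_0_le_iff_le not_less)
  qed
  have "nat \<bar>n\<bar> > 0" using assms(4) by simp
  then show ?thesis using pow assms(1,2) unfolding torsion_free_group_def by blast
qed

text \<open>Both elements depend on the single member \<open>s\<close> of a maximal independent set;
  eliminating \<open>s\<close> relates them directly.\<close>

lemma rank1_dependent:
  fixes K :: "('a, 'm) monoid_scheme"
  assumes K: "rank1_group K" and g: "g \<in> carrier K" "g \<noteq> \<one>\<^bsub>K\<^esub>" and x: "x \<in> carrier K"
  shows "\<exists>(a::int) (b::int). b \<noteq> 0 \<and> x [^]\<^bsub>K\<^esub> b = g [^]\<^bsub>K\<^esub> a"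
proof -
  have tf: "torsion_free_group K" using K by (simp add: rank1_group_def)
  interpret comm_group K using tf by (simp add: torsion_free_group_def)
  obtain S where S: "independent_in K S" "\<And>S'. independent_in K S' \<Longrightarrow> S \<subseteq> S' \<Longrightarrow> S' = S" "card S = 1"
    using K by (auto simp: rank1_group_def has_rank_def)
  obtain s where s: "S = {s}" using S(3) by (auto simp: card_1_singleton_iff)
  have sK: "s \<in> carrier K" using S(1) s by (auto simp: independent_in_def)
  have s1: "s [^]\<^bsub>K\<^esub> (n::int) = \<one>\<^bsub>K\<^esub> \<Longrightarrow> n = 0" for n
  proof -
    assume "s [^]\<^bsub>K\<^esub> n = \<one>\<^bsub>K\<^esub>"
    then have "finprod K (\<lambda>x. x [^]\<^bsub>K\<^esub> n) {s} = \<one>\<^bsub>K\<^esub>" using sK by simp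
    moreover have "\<forall>F (c :: 'a \<Rightarrow> int). finite F \<and> F \<subseteq> {s} \<and> finprod K (\<lambda>x. x [^]\<^bsub>K\<^esub> c x) F = \<one>\<^bsub>K\<^esub> \<longrightarrow>
        (\<forall>x\<in>F. c x = 0)"
      using S(1) unfolding independent_in_def s by blast
    from this[rule_format, of "{s}" "\<lambda>_. n"] show "n = 0" using calculation by simp
  qed
  have dep: "\<exists>b a. b \<noteq> 0 \<and> y [^]\<^bsub>K\<^esub> (b::int) = s [^]\<^bsub>K\<^esub> (a::int)" if y: "y \<in> carrier K" for y
  proof (cases "y = s")
    case True
    then show ?thesis by (intro exI[of _ 1]) auto
  next
    case False
    then have "\<not> independent_in K {s, y}" using S(2)[of "{s, y}"] s by auto
    then have "\<exists>F (c :: 'a \<Rightarrow> int). finite F \<and> F \<subseteq> {s, y} \<and>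
        finprod K (\<lambda>x. x [^]\<^bsub>K\<^esub> c x) F = \<one>\<^bsub>K\<^esub> \<and> \<not> (\<forall>x\<in>F. c x = 0)"
      using y sK unfolding independent_in_def by simp
    then obtain F c where F: "finite F" "F \<subseteq> {s, y}" "finprod K (\<lambda>x. x [^]\<^bsub>K\<^esub> (c x :: int)) F = \<one>\<^bsub>K\<^esub>"
      "\<not> (\<forall>x\<in>F. c x = 0)" by (elim exE conjE)
    \<comment> \<open>Extension by zero gives a relation on the whole of \<open>{s, y}\<close>. Its
      coefficient at \<open>y\<close> cannot vanish, since \<open>s\<close> has infinite
      order.\<close>
    define c' where "c' = (\<lambda>x. if x \<in> F then c x else 0)"
    have "finprod K (\<lambda>x. x [^]\<^bsub>K\<^esub> c' x) {s, y} = finprod K (\<lambda>x. x [^]\<^bsub>K\<^esub> c x) F"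
      by (rule finprod_mono_neutral_cong_right) (use F(2) y sK in \<open>auto simp: c'_def\<close>)
    then have e: "s [^]\<^bsub>K\<^esub> c' s \<otimes>\<^bsub>K\<^esub> y [^]\<^bsub>K\<^esub> c' y = \<one>\<^bsub>K\<^esub>"
      using F(3) False y sK by simp
    have "c' y \<noteq> 0"
    proof
      assume z: "c' y = 0"
      then have "c' s = 0" using e s1 sK by simp
      then show False using z F by (auto simp: c'_def split: if_splits)
    qed
    moreover have "y [^]\<^bsub>K\<^esub> c' y = s [^]\<^bsub>K\<^esub> (- c' s)"
      using e y sK by (metis int_pow_closed int_pow_neg inv_equality m_comm)
    ultimately show ?thesis by blast
  qed
  obtain b a :: int where xa: "b \<noteq> 0" "x [^]\<^bsub>K\<^esub> b = s [^]\<^bsub>K\<^esub> a" using dep[OF x] by blast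
  obtain d e :: int where ge: "d \<noteq> 0" "g [^]\<^bsub>K\<^esub> d = s [^]\<^bsub>K\<^esub> e" using dep[OF g(1)] by blast
  have "e \<noteq> 0"
  proof
    assume "e = 0"
    then have "g [^]\<^bsub>K\<^esub> d = \<one>\<^bsub>K\<^esub>" using ge by simp
    then show False using torsion_free_int_pow[OF tf g(1) _ ge(1)] g(2) by blast
  qed
  have "x [^]\<^bsub>K\<^esub> (b * e) = s [^]\<^bsub>K\<^esub> (a * e)" using xa x sK by (metis int_pow_pow)
  also have "\<dots> = g [^]\<^bsub>K\<^esub> (d * a)" using ge g sK by (metis int_pow_pow mult.commute)
  finally have eq: "x [^]\<^bsub>K\<^esub> (b * e) = g [^]\<^bsub>K\<^esub> (d * a)" .
  show ?thesis
  proof (intro exI conjI)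
    show "b * e \<noteq> 0" using xa(1) \<open>e \<noteq> 0\<close> by simp
    show "x [^]\<^bsub>K\<^esub> (b * e) = g [^]\<^bsub>K\<^esub> (d * a)" by (rule eq)
  qed
qed

text \<open>In additive terms, a relation b x = a g determines the ratio a/b, because
  \<open>g\<close> has infinite order. The ratio embeds the group into the rationals.\<close>

lemma rank1_functional:
  assumes K: "rank1_group K" and g: "g \<in> carrier K" "g \<noteq> \<one>\<^bsub>K\<^esub>"
  obtains \<rho> where "additive_functional K \<rho>" "\<rho> g = 1" "\<And>x. x \<in> carrier K \<Longrightarrow> \<rho> x = 0 \<Longrightarrow> x = \<one>\<^bsub>K\<^esub>"
proof -
  have tf: "torsion_free_group K" using K by (simp add: rank1_group_def)
  interpret comm_group K using tf by (simp add: torsion_free_group_def)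
  have "\<forall>x\<in>carrier K. \<exists>ab::int \<times> int. snd ab \<noteq> 0 \<and> x [^]\<^bsub>K\<^esub> snd ab = g [^]\<^bsub>K\<^esub> fst ab"
    using rank1_dependent[OF K g] by fastforce
  then obtain q where q: "\<And>x. x \<in> carrier K \<Longrightarrow> snd (q x) \<noteq> (0::int) \<and> x [^]\<^bsub>K\<^esub> snd (q x) = g [^]\<^bsub>K\<^esub> (fst (q x) :: int)"
    by metis
  define \<rho> where "\<rho> = (\<lambda>x. of_int (fst (q x)) / of_int (snd (q x)) :: rat)"
  have g1: "a = 0" if "g [^]\<^bsub>K\<^esub> (a::int) = \<one>\<^bsub>K\<^esub>" for a
    using torsion_free_int_pow[OF tf g(1) that] g(2) by blast
  have uniq: "\<rho> x = of_int a / of_int b" if x: "x \<in> carrier K" and b: "b \<noteq> 0" "x [^]\<^bsub>K\<^esub> (b::int) = g [^]\<^bsub>K\<^esub> (a::int)" for x a b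
  proof -
    have "g [^]\<^bsub>K\<^esub> (a * snd (q x)) = x [^]\<^bsub>K\<^esub> (b * snd (q x))" using x g b(2) by (metis int_pow_pow)
    also have "\<dots> = g [^]\<^bsub>K\<^esub> (fst (q x) * b)" using q[OF x] x g by (metis int_pow_pow mult.commute)
    finally have "g [^]\<^bsub>K\<^esub> (a * snd (q x) - fst (q x) * b) = \<one>\<^bsub>K\<^esub>"
      using g by (simp add: int_pow_diff)
    then have "a * snd (q x) = fst (q x) * b" using g1 by fastforce
    then have "of_int (a * snd (q x)) = (of_int (fst (q x) * b) :: rat)" by (rule arg_cong)
    then show ?thesis using b(1) q[OF x] by (simp add: \<rho>_def field_simps)
  qed
  have "additive_functional K \<rho>"
  proof
    fix x y assume xy: "x \<in> carrier K" "y \<in> carrier K"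
    let ?a = "fst (q x)" and ?b = "snd (q x)" and ?c = "fst (q y)" and ?d = "snd (q y)"
    have "(x \<otimes>\<^bsub>K\<^esub> y) [^]\<^bsub>K\<^esub> (?b * ?d) = (x [^]\<^bsub>K\<^esub> ?b) [^]\<^bsub>K\<^esub> ?d \<otimes>\<^bsub>K\<^esub> (y [^]\<^bsub>K\<^esub> ?d) [^]\<^bsub>K\<^esub> ?b"
      using xy by (simp add: int_pow_distrib int_pow_pow mult.commute)
    also have "\<dots> = g [^]\<^bsub>K\<^esub> (?a * ?d + ?c * ?b)"
      using q xy g by (simp add: int_pow_pow int_pow_mult)
    finally have "\<rho> (x \<otimes>\<^bsub>K\<^esub> y) = of_int (?a * ?d + ?c * ?b) / of_int (?b * ?d)"
      using q[OF xy(1)] q[OF xy(2)] xy by (intro uniq) auto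
    then show "\<rho> (x \<otimes>\<^bsub>K\<^esub> y) = \<rho> x + \<rho> y"
      using q[OF xy(1)] q[OF xy(2)] by (simp add: \<rho>_def field_simps)
  qed
  moreover have "\<rho> g = 1" using uniq[of g 1 1] g by simp
  moreover have "x = \<one>\<^bsub>K\<^esub>" if x: "x \<in> carrier K" "\<rho> x = 0" for x
  proof -
    have "fst (q x) = 0" using x(2) q[OF x(1)] by (simp add: \<rho>_def)
    then have "x [^]\<^bsub>K\<^esub> snd (q x) = \<one>\<^bsub>K\<^esub>" using q[OF x(1)] by simp
    then show ?thesis using torsion_free_int_pow[OF tf x(1)] q[OF x(1)] by blast
  qed
  ultimately show ?thesis using that by blast
qed

lemma rank1_nontrivial:
  assumes K: "rank1_group K"
  shows "\<exists>g\<in>carrier K. g \<noteq> \<one>\<^bsub>K\<^esub>"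
proof -
  interpret comm_group K using K by (simp add: rank1_group_def torsion_free_group_def)
  obtain S where S: "independent_in K S" "card S = 1"
    using K by (auto simp: rank1_group_def has_rank_def)
  then obtain s where s: "S = {s}" by (auto simp: card_1_singleton_iff)
  have sK: "s \<in> carrier K" using S(1) s by (auto simp: independent_in_def)
  have "\<forall>F (c :: 'a \<Rightarrow> int). finite F \<and> F \<subseteq> {s} \<and> finprod K (\<lambda>x. x [^]\<^bsub>K\<^esub> c x) F = \<one>\<^bsub>K\<^esub> \<longrightarrow>
      (\<forall>x\<in>F. c x = 0)"
    using S(1) unfolding independent_in_def s by blast
  from this[rule_format, of "{s}" "\<lambda>_. 1"] have "s \<noteq> \<one>\<^bsub>K\<^esub>" using sK by auto
  then show ?thesis using sK by blast
qed

lemma SUP_enat_eq_infinity: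
  assumes "(SUP k\<in>{k. Q k}. enat k) = \<infinity>"
  shows "\<exists>l\<ge>k. Q l"
proof (rule ccontr)
  assume no: "\<not> (\<exists>l\<ge>k. Q l)"
  have "(SUP k\<in>{k. Q k}. enat k) \<le> enat k"
  proof (rule SUP_least)
    fix l assume "l \<in> {k. Q k}"
    then have "\<not> k \<le> l" using no by blast
    then show "enat l \<le> enat k" by simp
  qed
  then show False using assms by simp
qed

text \<open>Let \<open>J\<close> be the image of \<open>rank1_functional\<close>; the height of
  \<open>g\<close> at \<open>p\<close> is the supremum of the exponents k with 1/p^k in
  \<open>J\<close>. Idempotency makes these heights 0 or infinite outside the finite set
  \<open>E\<close>, and rescaling repairs the primes in \<open>E\<close>.\<close>

lemma rank1_loc:
  assumes K: "rank1_group K" and idem: "idempotent_type (group_type K)"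
  shows "\<exists>\<rho> P. additive_functional K \<rho> \<and> (\<forall>x\<in>carrier K. \<rho> x = 0 \<longrightarrow> x = \<one>\<^bsub>K\<^esub>) \<and> \<rho> ` carrier K = loc P \<and>
    (\<forall>p\<in>P. prime p) \<and> group_type K = abs_htype (\<lambda>p. if p \<in> P then \<infinity> else 0)"
proof -
  interpret comm_group K using K by (simp add: rank1_group_def torsion_free_group_def)
  \<comment> \<open>The same choice as in \<open>group_type\<close>, so the heights of
    \<open>g\<close> represent the type by definition.\<close>
  define g where "g = (SOME g. g \<in> carrier K \<and> g \<noteq> \<one>\<^bsub>K\<^esub>)"
  have g: "g \<in> carrier K" "g \<noteq> \<one>\<^bsub>K\<^esub>"
    using rank1_nontrivial[OF K] someI_ex[of "\<lambda>g. g \<in> carrier K \<and> g \<noteq> \<one>\<^bsub>K\<^esub>"] unfolding g_def by blast+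
  obtain \<rho> where \<rho>: "additive_functional K \<rho>" "\<rho> g = 1" "\<And>x. x \<in> carrier K \<Longrightarrow> \<rho> x = 0 \<Longrightarrow> x = \<one>\<^bsub>K\<^esub>"
    using rank1_functional[OF K g] by blast
  interpret \<rho>: additive_functional K \<rho> by (rule \<rho>(1))
  define J where "J = \<rho> ` carrier K"
  interpret J: rat_subgroup J
  proof
    show "1 \<in> J" unfolding J_def using \<rho>(2) g by (metis imageI)
    show "x + y \<in> J" if "x \<in> J" "y \<in> J" for x y
      using that unfolding J_def by (auto simp: \<rho>.mult[symmetric])
    show "- x \<in> J" if "x \<in> J" for x
      using that unfolding J_def by (auto simp: \<rho>.inv[symmetric])
  qed
  have inj: "x = y" if "x \<in> carrier K" "y \<in> carrier K" "\<rho> x = \<rho> y" for x y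
  proof -
    have "x \<otimes>\<^bsub>K\<^esub> inv\<^bsub>K\<^esub> y = \<one>\<^bsub>K\<^esub>" by (rule \<rho>(3)) (use that in \<open>auto simp: \<rho>.mult \<rho>.inv\<close>)
    then show ?thesis using that by (metis inv_closed inv_equality inv_inv)
  qed
  have div: "(\<exists>y\<in>carrier K. y [^]\<^bsub>K\<^esub> (p ^ k) = g) \<longleftrightarrow> 1 / of_nat p ^ k \<in> J" if p: "prime p" for p k :: nat
  proof
    assume "\<exists>y\<in>carrier K. y [^]\<^bsub>K\<^esub> (p ^ k) = g"
    then obtain y where y: "y \<in> carrier K" "y [^]\<^bsub>K\<^esub> (p ^ k) = g" by blast
    then have "of_nat (p ^ k) * \<rho> y = 1" using \<rho>.nat_pow[OF y(1), of "p ^ k"] \<rho>(2) by simp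
    then have "\<rho> y = 1 / of_nat p ^ k" using prime_gt_0_nat[OF p] by (simp add: field_simps)
    then show "1 / of_nat p ^ k \<in> J" using y(1) unfolding J_def by (metis imageI)
  next
    assume "1 / of_nat p ^ k \<in> J"
    then obtain y where y: "y \<in> carrier K" "\<rho> y = 1 / of_nat p ^ k" unfolding J_def by (metis imageE)
    have "\<rho> (y [^]\<^bsub>K\<^esub> (p ^ k)) = 1" using \<rho>.nat_pow[OF y(1), of "p ^ k"] y(2) prime_gt_0_nat[OF p] by simp
    then have "y [^]\<^bsub>K\<^esub> (p ^ k) = g" using y(1) g(1) \<rho>(2) by (intro inj) auto
    then show "\<exists>y\<in>carrier K. y [^]\<^bsub>K\<^esub> (p ^ k) = g" using y(1) by blast
  qed
  have height: "height K g p = (SUP k\<in>{k. 1 / of_nat p ^ k \<in> J}. enat k)" if "prime p" for p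
    unfolding height_def div[OF that] ..
  have gt: "group_type K = abs_htype (height K g)" by (simp add: group_type_def g_def)
  obtain \<chi> where \<chi>: "group_type K = abs_htype \<chi>" "\<And>p. prime p \<Longrightarrow> \<chi> p \<in> {0, \<infinity>}"
    using idem unfolding idempotent_type_iff by blast
  have ce: "char_equiv (height K g) \<chi>" using gt \<chi>(1) htype.abs_eq_iff by metis
  define P where "P = {p. prime p \<and> \<chi> p = \<infinity>}"
  define E where "E = {p. prime p \<and> height K g p \<noteq> \<chi> p}"
  have E: "height K g p \<noteq> \<infinity>" "\<chi> p \<noteq> \<infinity>" "prime p" if "p \<in> E" for p
    using ce that unfolding char_equiv_def E_def by blast+
  have down: "1 / of_nat p ^ k \<in> J" if l: "1 / of_nat p ^ l \<in> J" "k \<le> l" "prime p" for p k l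
  proof -
    obtain d where d: "l = k + d" using l(2) le_Suc_ex by blast
    have "of_nat (p ^ d) * (1 / of_nat p ^ l) \<in> J" by (rule J.nmult_in[OF l(1)])
    also have "of_nat (p ^ d) * (1 / of_nat p ^ l) = (1 / of_nat p ^ k :: rat)"
      using prime_gt_0_nat[OF l(3)] by (simp add: d power_add)
    finally show ?thesis .
  qed
  obtain N :: nat where N: "N > 0" "(\<lambda>q. of_nat N * q) ` J = loc P"
  proof (rule J.eq_loc_scaled[of E P])
    show "finite E" using ce unfolding char_equiv_def E_def by blast
    show "prime p \<and> p \<notin> P \<and> (\<exists>k. 1 / of_nat p ^ k \<notin> J)" if p: "p \<in> E" for p
    proof (intro conjI)
      show "p \<notin> P" using E(2)[OF p] by (simp add: P_def)
      show "\<exists>k. 1 / of_nat p ^ k \<notin> J"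
      proof (rule ccontr)
        assume no: "\<nexists>k. 1 / of_nat p ^ k \<notin> J"
        obtain n where n: "height K g p = enat n" using E(1)[OF p] by blast
        have "enat (Suc n) \<le> height K g p"
          unfolding height[OF E(3)[OF p]] by (rule SUP_upper) (use no in auto)
        then show False using n by simp
      qed
    qed (use E p in auto)
    show "prime p" if "p \<in> P" for p using that by (simp add: P_def)
    show "1 / of_nat p ^ k \<in> J" if p: "p \<in> P" for p k
    proof -
      have pp: "prime p" using p by (simp add: P_def)
      have "height K g p = \<infinity>"
      proof (rule ccontr)
        assume "height K g p \<noteq> \<infinity>"
        then have "p \<in> E" using p by (simp add: P_def E_def)
        then have "\<chi> p \<noteq> \<infinity>" by (rule E(2))
        then show False using p by (simp add: P_def)
      qed
      then obtain l where "l \<ge> k" "1 / of_nat p ^ l \<in> J"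
        using SUP_enat_eq_infinity[of "\<lambda>k. 1 / of_nat p ^ k \<in> J" k] unfolding height[OF pp] by blast
      then show ?thesis using down pp by blast
    qed
    show "1 / of_nat p \<notin> J" if p: "prime p" "p \<notin> P" "p \<notin> E" for p
    proof
      assume J: "1 / of_nat p \<in> J"
      have "height K g p = 0" using p \<chi>(2)[OF p(1)] by (auto simp: P_def E_def)
      moreover have "enat 1 \<le> height K g p"
        unfolding height[OF p(1)] by (rule SUP_upper) (use J in simp)
      ultimately show False by (simp add: zero_enat_def)
    qed
  qed
  have "additive_functional K (\<lambda>x. of_nat N * \<rho> x)"
    by unfold_locales (simp add: \<rho>.mult algebra_simps)
  moreover have "\<forall>x\<in>carrier K. of_nat N * \<rho> x = 0 \<longrightarrow> x = \<one>\<^bsub>K\<^esub>" using \<rho>(3) N(1) by auto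
  moreover have "(\<lambda>x. of_nat N * \<rho> x) ` carrier K = loc P" using N(2) by (simp add: J_def image_image)
  moreover have "\<forall>p\<in>P. prime p" by (simp add: P_def)
  moreover have "group_type K = abs_htype (\<lambda>p. if p \<in> P then \<infinity> else 0)"
  proof -
    have "\<chi> p = (if p \<in> P then \<infinity> else 0)" if "prime p" for p
      using \<chi>(2)[OF that] that by (cases "\<chi> p = \<infinity>") (simp_all add: P_def)
    then have none: "{p. prime p \<and> \<chi> p \<noteq> (if p \<in> P then \<infinity> else 0)} = {}" by blast
    have "char_equiv \<chi> (\<lambda>p. if p \<in> P then \<infinity> else 0)"
      unfolding char_equiv_def none using none by blast
    then show ?thesis unfolding \<chi>(1) htype.abs_eq_iff .
  qed
  ultimately show ?thesis by (intro exI conjI)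
qed

section \<open>Completely decomposable groups\<close>

lemma (in comm_group) subgroup_comm_group:
  assumes "subgroup H G"
  shows "comm_group (G\<lparr>carrier := H\<rparr>)"
  by (rule group.group_comm_groupI[OF subgroup_imp_group[OF assms]])
     (use subgroup.mem_carrier[OF assms] m_comm in auto)

text \<open>The coordinate axes, pulled back along \<open>h\<close>, are the rank one summands. They
  are pairwise distinct, since \<open>A i\<close> contains the preimage of
  \<open>unit_vec i\<close>.\<close>

lemma completely_decomposableI:
  fixes K :: "('a, 'm) monoid_scheme" and I :: "'i set"
  assumes "comm_group K" and fin: "finite I" and h: "h \<in> iso K (vec_group (loc_vecs I P))"
  shows "completely_decomposable K"
proof -
  interpret comm_group K by fact
  have hh: "h \<in> hom K (vec_group (loc_vecs I P))" and bij: "bij_betw h (carrier K) (loc_vecs I P)"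
    using h by (auto simp: iso_def)
  have h_in: "h x \<in> loc_vecs I P" if "x \<in> carrier K" for x using hom_in_carrier[OF hh that] by simp
  interpret hi: additive_functional K "\<lambda>x. h x i" for i
    by unfold_locales (simp add: hom_mult[OF hh])
  have inj: "x = y" if "x \<in> carrier K" "y \<in> carrier K" "\<And>i. i \<in> I \<Longrightarrow> h x i = h y i" for x y
  proof -
    have "h x = h y" using h_in[OF that(1)] h_in[OF that(2)] that(3) by (force simp: loc_vecs_def fun_eq_iff)
    then show ?thesis using bij that by (auto simp: bij_betw_def inj_on_def)
  qed
  have surj: "\<exists>x\<in>carrier K. h x = v" if "v \<in> loc_vecs I P" for v
    using bij that unfolding bij_betw_def by (metis imageE)
  define A where "A = (\<lambda>i. {x \<in> carrier K. \<forall>j. j \<noteq> i \<longrightarrow> h x j = 0})"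
  have subA: "subgroup (A i) K" for i
    by unfold_locales (auto simp: A_def hi.mult hi.one hi.inv)
  have "\<exists>x\<in>carrier K. h x = unit_vec i" if "i \<in> I" for i
    by (rule surj) (use that in \<open>auto simp: loc_vecs_def unit_vec_def\<close>)
  then obtain e where e: "\<And>i. i \<in> I \<Longrightarrow> e i \<in> carrier K" "\<And>i. i \<in> I \<Longrightarrow> h (e i) = unit_vec i" by metis
  have eA: "e i \<in> A i" if "i \<in> I" for i using e that by (simp add: A_def unit_vec_def)
  have injA: "inj_on A I"
  proof (rule inj_onI)
    fix i j assume ij: "i \<in> I" "j \<in> I" "A i = A j"
    show "i = j"
    proof (rule ccontr)
      assume ne: "i \<noteq> j"
      have "e i \<in> A j" using eA ij by blast
      then have "h (e i) i = 0" using ne by (simp add: A_def)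
      then show False using e(2)[OF ij(1)] by (simp add: unit_vec_def)
    qed
  qed
  have A_eq: "x = y" if "x \<in> A i" "y \<in> A i" "h x i = h y i" for x y i
    by (rule inj) (use that in \<open>auto simp: A_def\<close>, metis)
  define \<D> where "\<D> = A ` I"
  have finD: "finite \<D>" using fin by (simp add: \<D>_def)
  let ?S = "sum_group \<D> (\<lambda>A. K\<lparr>carrier := A\<rparr>)"
  have grp: "group (K\<lparr>carrier := X\<rparr>)" if "X \<in> \<D>" for X
    using that subA subgroup.subgroup_is_group[OF _ is_group] by (auto simp: \<D>_def)
  have carS: "x \<in> carrier ?S \<longleftrightarrow> x \<in> extensional \<D> \<and> (\<forall>X\<in>\<D>. x X \<in> X)" for x
    using finD by (auto simp: carrier_sum_group[OF grp] PiE_iff)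
  have DK: "X \<subseteq> carrier K" if "X \<in> \<D>" for X using that by (auto simp: \<D>_def A_def)
  have comp: "h (gfinprod K x \<D>) i = h (x (A i)) i" if x: "x \<in> carrier ?S" and i: "i \<in> I" for x i
  proof -
    have xc: "x \<in> \<D> \<rightarrow> carrier K" using x DK carS by fastforce
    have "h (gfinprod K x \<D>) i = (\<Sum>X\<in>\<D>. h (x X) i)"
      using gfinprod_eq_finprod[OF finD xc] hi.finprod[OF finD xc] by simp
    also have "\<dots> = (\<Sum>j\<in>I. h (x (A j)) i)" unfolding \<D>_def by (simp add: sum.reindex[OF injA])
    also have "\<dots> = (\<Sum>j\<in>{i}. h (x (A j)) i)"
    proof (rule sum.mono_neutral_right[OF fin])
      show "\<forall>j\<in>I - {i}. h (x (A j)) i = 0"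
      proof
        fix j assume j: "j \<in> I - {i}"
        then have "x (A j) \<in> A j" using x carS by (simp add: \<D>_def)
        then show "h (x (A j)) i = 0" using j by (auto simp: A_def)
      qed
    qed (use i in auto)
    finally show ?thesis by simp
  qed
  have iso: "(\<lambda>x. gfinprod K x \<D>) \<in> iso ?S K"
  proof (rule isoI)
    have "(\<lambda>x. gfinprod K (\<lambda>X. id (x X)) \<D>) \<in> hom ?S K"
      by (rule hom_group_sum[OF _ grp]) (use DK in \<open>auto simp: hom_def\<close>)
    then show hom: "(\<lambda>x. gfinprod K x \<D>) \<in> hom ?S K" by simp
    show "bij_betw (\<lambda>x. gfinprod K x \<D>) (carrier ?S) (carrier K)"
      unfolding bij_betw_def
    proof
      show "inj_on (\<lambda>x. gfinprod K x \<D>) (carrier ?S)"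
      proof (rule inj_onI)
        fix x y assume xy: "x \<in> carrier ?S" "y \<in> carrier ?S" "gfinprod K x \<D> = gfinprod K y \<D>"
        show "x = y"
        proof (rule extensionalityI[of _ \<D>])
          fix X assume "X \<in> \<D>"
          then obtain i where i: "i \<in> I" "X = A i" by (auto simp: \<D>_def)
          have "h (x (A i)) i = h (y (A i)) i" using comp[OF xy(1) i(1)] comp[OF xy(2) i(1)] xy(3) by simp
          then show "x X = y X" using A_eq[of "x X" i "y X"] xy carS i \<open>X \<in> \<D>\<close> by auto
        qed (use xy carS in auto)
      qed
      show "(\<lambda>x. gfinprod K x \<D>) ` carrier ?S = carrier K"
      proof (intro equalityI subsetI)
        fix u assume u: "u \<in> carrier K"
        have "\<exists>z\<in>A i. h z i = h u i" if i: "i \<in> I" for i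
        proof -
          have "(\<lambda>j. if j = i then h u i else 0) \<in> loc_vecs I P"
            using h_in[OF u] i by (auto simp: loc_vecs_def)
          from surj[OF this] obtain z where "z \<in> carrier K" "h z = (\<lambda>j. if j = i then h u i else 0)" by blast
          then show ?thesis by (intro bexI[of _ z]) (auto simp: A_def)
        qed
        then obtain z where z: "\<And>i. i \<in> I \<Longrightarrow> z i \<in> A i" "\<And>i. i \<in> I \<Longrightarrow> h (z i) i = h u i" by metis
        define x where "x = (\<lambda>X\<in>\<D>. z (inv_into I A X))"
        have xA: "x (A i) = z i" if "i \<in> I" for i using that injA by (simp add: x_def \<D>_def)
        have xS: "x \<in> carrier ?S" unfolding carS using z xA by (auto simp: \<D>_def x_def)
        have "gfinprod K x \<D> = u"
        proof (rule inj)
          show "gfinprod K x \<D> \<in> carrier K" using hom_in_carrier[OF hom xS] .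
          show "h (gfinprod K x \<D>) i = h u i" if "i \<in> I" for i using comp[OF xS that] xA z that by simp
        qed (rule u)
        then show "u \<in> (\<lambda>x. gfinprod K x \<D>) ` carrier ?S" using xS by blast
      qed (use hom_in_carrier[OF hom] in auto)
    qed
  qed
  have tf: "x = \<one>\<^bsub>K\<^esub>" if x: "x \<in> carrier K" and n: "n > 0" "x [^]\<^bsub>K\<^esub> (n::nat) = \<one>\<^bsub>K\<^esub>" for x n
  proof (rule inj)
    fix i
    show "h x i = h \<one>\<^bsub>K\<^esub> i" using hi.nat_pow[OF x, of n i] n hi.one by simp
  qed (use x in auto)
  have "rank1_group (K\<lparr>carrier := A i\<rparr>)" if i: "i \<in> I" for i
  proof -
    let ?L = "K\<lparr>carrier := A i\<rparr>"
    interpret L: comm_group ?L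
      by (rule subgroup_comm_group[OF subA])
    have pow: "x [^]\<^bsub>?L\<^esub> n = x [^]\<^bsub>K\<^esub> n" for x and n :: nat by (simp add: nat_pow_def)
    have tfL: "torsion_free_group ?L"
      unfolding torsion_free_group_def pow using L.comm_group_axioms tf by (auto simp: A_def)
    interpret Li: additive_functional ?L "\<lambda>x. h x i"
      by unfold_locales (auto simp: A_def hi.mult)
    have zero: "x = \<one>\<^bsub>K\<^esub>" if "x \<in> A i" "h x i = 0" for x
      by (rule A_eq[of _ i]) (use that subgroup.one_closed[OF subA] hi.one in auto)
    have ind: "independent_in ?L {e i}"
      unfolding independent_in_def
    proof (intro conjI allI impI ballI)
      fix F and c :: "'a \<Rightarrow> int" and x
      assume F: "finite F \<and> F \<subseteq> {e i} \<and> finprod ?L (\<lambda>x. x [^]\<^bsub>?L\<^esub> c x) F = \<one>\<^bsub>?L\<^esub>" and x: "x \<in> F"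
      then have Fe: "F = {e i}" "x = e i" by blast+
      have "(\<lambda>x. x [^]\<^bsub>?L\<^esub> c x) \<in> F \<rightarrow> carrier ?L" using Fe eA[OF i] L.int_pow_closed[of "e i"] by simp
      from Li.finprod[OF _ this] have "h \<one>\<^bsub>K\<^esub> i = (\<Sum>x\<in>F. h (x [^]\<^bsub>?L\<^esub> c x) i)" using F by simp
      then have "h (e i [^]\<^bsub>?L\<^esub> c (e i)) i = 0" using hi.one Fe by simp
      then have "of_int (c (e i)) * h (e i) i = 0" using Li.int_pow[of "e i" "c (e i)"] eA[OF i] by simp
      then show "c x = 0" using e(2)[OF i] Fe by (simp add: unit_vec_def)
    qed (use eA i in auto)
    \<comment> \<open>Another element \<open>y\<close> of the axis has a coordinate a/b, so b y - a
      e_i = 0 in additive terms is a nontrivial relation.\<close>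
    have max: "S' = {e i}" if S': "independent_in ?L S'" "{e i} \<subseteq> S'" for S'
    proof (rule ccontr)
      assume "S' \<noteq> {e i}"
      then obtain y where y: "y \<in> S'" "y \<noteq> e i" using S'(2) by blast
      have yA: "y \<in> A i" using S'(1) y(1) by (auto simp: independent_in_def)
      obtain a b where ab: "h y i = of_int a / of_int b" "b > 0" by (metis Rat_cases Fract_of_int_quotient)
      define c where "c = (\<lambda>x. if x = y then b else - a)"
      let ?f = "\<lambda>x. x [^]\<^bsub>?L\<^esub> c x"
      have fin2: "?f \<in> {e i, y} \<rightarrow> carrier ?L"
        using yA eA[OF i] L.int_pow_closed by simp
      have "h (finprod ?L ?f {e i, y}) i = (\<Sum>x\<in>{e i, y}. h (?f x) i)"
        by (rule Li.finprod[OF _ fin2]) simp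
      also have "\<dots> = of_int (- a) * h (e i) i + of_int b * h y i"
        using y(2) yA eA[OF i] Li.int_pow by (simp add: c_def)
      also have "\<dots> = 0" using e(2)[OF i] ab by (simp add: unit_vec_def)
      finally have "finprod ?L ?f {e i, y} = \<one>\<^bsub>?L\<^esub>"
        using zero L.finprod_closed[OF fin2] by simp
      moreover have "{e i, y} \<subseteq> S'" using S'(2) y(1) by simp
      moreover have indep: "\<forall>F (c :: 'a \<Rightarrow> int). finite F \<and> F \<subseteq> S' \<and> finprod ?L (\<lambda>x. x [^]\<^bsub>?L\<^esub> c x) F = \<one>\<^bsub>?L\<^esub> \<longrightarrow>
          (\<forall>x\<in>F. c x = 0)"
        using S'(1) unfolding independent_in_def by blast
      ultimately have "\<forall>x\<in>{e i, y}. c x = 0"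
        by (intro indep[THEN spec, THEN spec, THEN mp] conjI) simp_all
      then have "c y = 0" by blast
      then show False using ab(2) by (simp add: c_def)
    qed
    have "has_rank ?L 1"
      unfolding has_rank_def
    proof (intro exI[of _ "{e i}"] conjI allI impI)
      show "S' = {e i}" if "independent_in ?L S' \<and> {e i} \<subseteq> S'" for S'
        using max that by blast
    qed (use ind in simp_all)
    then show ?thesis using tfL by (simp add: rank1_group_def)
  qed
  then have "\<forall>X\<in>\<D>. rank1_group (K\<lparr>carrier := X\<rparr>)" by (simp add: \<D>_def)
  moreover have "\<forall>X\<in>\<D>. subgroup X K" using subA by (simp add: \<D>_def)
  ultimately have "rank1_decomposition K \<D>"
    using iso by (simp add: rank1_decomposition_def internal_direct_sum_def)
  then have "\<exists>\<D>. rank1_decomposition K \<D>" by (rule exI)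
  with comm_group_axioms show ?thesis by (simp add: completely_decomposable_def)
qed

section \<open>The regulator\<close>

text \<open>Lagrange in the quotient; for infinite index \<open>card\<close> is 0 and the power is
  \<open>\<one>\<close>.\<close>

lemma (in comm_group) finite_index_power:
  assumes C: "subgroup C G" and x: "x \<in> carrier G"
  shows "x [^] card (rcosets C) \<in> C"
proof -
  have N: "C \<lhd> G" using C by (rule subgroup_imp_normal)
  interpret Q: group "G Mod C" using N by (rule normal.factorgroup_is_group)
  have h: "(#>) C \<in> hom G (G Mod C)" using N by (rule normal.r_coset_hom_Mod)
  have "C #> (x [^] card (rcosets C)) = (C #> x) [^]\<^bsub>G Mod C\<^esub> card (rcosets C)"
    by (rule hom_nat_pow[OF h x]) unfold_locales
  also have "\<dots> = \<one>\<^bsub>G Mod C\<^esub>"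
    using Q.pow_order_eq_1[OF hom_in_carrier[OF h x]] by (simp add: order_def FactGroup_def)
  finally show ?thesis
    using coset_join1[OF _ _ C, of "x [^] card (rcosets C)"] x by (simp add: FactGroup_def)
qed

text \<open>The quotient by \<open>C\<close> is cyclic, generated by the coset of \<open>d\<close>.
  Its order is therefore the least positive exponent that takes \<open>d\<close> into
  \<open>C\<close>, and this divides every such exponent.\<close>

lemma (in comm_group) index_dvd:
  assumes C: "subgroup C G" and fin: "finite (rcosets C)" and R: "R \<subseteq> C" and d: "d \<in> carrier G"
    and gen: "\<And>g. g \<in> carrier G \<Longrightarrow> \<exists>r\<in>R. \<exists>n::int. g = r \<otimes> d [^] n"
    and n: "d [^] (n::int) \<in> C"
  shows "int (card (rcosets C)) dvd n"
proof -
  define j where "j = card (rcosets C)"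
  have "C \<in> rcosets C" using C subgroup.subgroup_in_rcosets[OF C is_group] by blast
  then have j0: "j > 0" using fin unfolding j_def by (auto simp: card_gt_0_iff)
  define S where "S = {k::nat. k > 0 \<and> d [^] k \<in> C}"
  have "j \<in> S" using finite_index_power[OF C d] j0 by (simp add: S_def j_def)
  define k where "k = (LEAST k. k \<in> S)"
  have k: "k \<in> S" "\<And>l. l \<in> S \<Longrightarrow> k \<le> l"
    unfolding k_def using \<open>j \<in> S\<close> by (auto intro: LeastI Least_le)
  have kC: "d [^] (int k * q) \<in> C" for q :: int
  proof -
    have "(d [^] k) [^] q \<in> C" using k(1) subgroup_int_pow_closed[OF C] by (simp add: S_def)
    then show ?thesis using d by (simp add: int_pow_pow flip: int_pow_int)
  qed
  have rem: "m mod int k = 0" if m: "d [^] (m::int) \<in> C" for m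
  proof (rule ccontr)
    assume ne: "m mod int k \<noteq> 0"
    have kp: "k > 0" using k(1) by (simp add: S_def)
    define r where "r = nat (m mod int k)"
    have r: "int r = m mod int k" using kp by (simp add: r_def)
    have "m mod int k = m + int k * (- (m div int k))" by (simp add: minus_div_mult_eq_mod[symmetric] mult.commute)
    then have "d [^] r = d [^] m \<otimes> d [^] (int k * (- (m div int k)))"
      using d by (simp only: r int_pow_int[symmetric] int_pow_mult)
    then have "d [^] r \<in> C" using subgroup.m_closed[OF C m kC] by (simp only:)
    then have "r \<in> S" using ne r by (simp add: S_def)
    then have "k \<le> r" by (rule k(2))
    moreover have "int r < int k" unfolding r using kp by simp
    ultimately show False by simp
  qed
  \<comment> \<open>The cosets of the first \<open>k\<close> powers of \<open>d\<close> exhaust the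
    quotient, so the index is at most \<open>k\<close>; minimality of \<open>k\<close> gives the
    other inequality.\<close>
  have "rcosets C \<subseteq> (\<lambda>i. C #> d [^] i) ` {..<k}"
  proof
    fix X assume "X \<in> rcosets C"
    then obtain g where g: "g \<in> carrier G" "X = C #> g" by (auto simp: RCOSETS_def)
    obtain r n where rn: "r \<in> R" "g = r \<otimes> d [^] (n::int)" using gen[OF g(1)] by blast
    have kp: "k > 0" using k(1) by (simp add: S_def)
    have rC: "r \<in> C" "r \<in> carrier G" using rn(1) R subgroup.mem_carrier[OF C] by auto
    define i where "i = nat (n mod int k)"
    have i: "int i = n mod int k" "i < k" using kp by (auto simp: i_def nat_less_iff)
    have "n = int k * (n div int k) + int i" unfolding i by simp
    then have "d [^] n = d [^] (int k * (n div int k)) \<otimes> d [^] i"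
      using d by (metis int_pow_int int_pow_mult)
    then have "g = (r \<otimes> d [^] (int k * (n div int k))) \<otimes> d [^] i"
      using rn(2) rC d by (simp add: m_assoc)
    then have "C #> g = (C #> (r \<otimes> d [^] (int k * (n div int k)))) #> d [^] i"
      using coset_mult_assoc[OF subgroup.subset[OF C]] rC d by simp
    also have "C #> (r \<otimes> d [^] (int k * (n div int k))) = C"
      using rC kC subgroup.m_closed[OF C] d by (intro coset_join2[OF _ C]) auto
    finally show "X \<in> (\<lambda>i. C #> d [^] i) ` {..<k}" using g(2) i(2) by blast
  qed
  then have "j \<le> card ((\<lambda>i. C #> d [^] i) ` {..<k})" unfolding j_def by (intro card_mono) auto
  also have "\<dots> \<le> k" using card_image_le[of "{..<k}"] by simp
  finally have "j = k" using k(2)[OF \<open>j \<in> S\<close>] by simp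
  then show ?thesis using rem[OF n] by (auto simp: j_def)
qed

text \<open>Enlarging cosets maps the cosets of \<open>C\<close> onto those of \<open>C'\<close>,
  and an element of \<open>C'\<close> outside \<open>C\<close> produces a collision.\<close>

lemma (in comm_group) card_rcosets_less:
  assumes C: "subgroup C G" and C': "subgroup C' G" and sub: "C \<subset> C'" and fin: "finite (rcosets C)"
  shows "finite (rcosets C')" and "card (rcosets C') < card (rcosets C)"
proof -
  let ?f = "\<lambda>X. C' <#> X"
  have f: "C' <#> (C #> x) = C' #> x" if "x \<in> carrier G" for x
  proof -
    have "C' <#> C = C'"
    proof
      show "C' <#> C \<subseteq> C'" using sub subgroup.m_closed[OF C'] by (auto simp: set_mult_def)
      show "C' \<subseteq> C' <#> C"
        using subgroup.one_closed[OF C] subgroup.mem_carrier[OF C'] by (force simp: set_mult_def)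
    qed
    then show ?thesis
      using setmult_rcos_assoc[of C' C x] that subgroup.subset[OF C] subgroup.subset[OF C'] by simp
  qed
  have surj: "rcosets C' = ?f ` (rcosets C)"
    using f by (auto simp: RCOSETS_def image_iff)
  then show "finite (rcosets C')" using fin by simp
  obtain y where y: "y \<in> C'" "y \<notin> C" using sub by blast
  then have yG: "y \<in> carrier G" using subgroup.mem_carrier[OF C'] by blast
  have "C #> y \<in> rcosets C" "C #> \<one> \<in> rcosets C" using yG by (auto simp: RCOSETS_def)
  moreover have "?f (C #> y) = ?f (C #> \<one>)"
    using f[OF yG] f[OF one_closed] coset_join2[OF yG C' y(1)] coset_join2[OF one_closed C' subgroup.one_closed[OF C']]
    by simp
  moreover have "C #> y \<noteq> C #> \<one>"
    using coset_join1[OF _ yG C] coset_join2[OF one_closed C subgroup.one_closed[OF C]] y(2) by auto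
  ultimately have "\<not> inj_on ?f (rcosets C)" by (meson inj_onD)
  then have "card (?f ` (rcosets C)) \<noteq> card (rcosets C)" using fin eq_card_imp_inj_on by blast
  then show "card (rcosets C') < card (rcosets C)"
    unfolding surj using card_image_le[OF fin, of ?f] by simp
qed

text \<open>Since the quotient by the regulator is cyclic, the regulator is the only completely decomposable
  subgroup of least index.\<close>

lemma regulator_least_index:
  fixes G (structure)
  assumes G: "class_A0 G"
  obtains d where "regulator G \<in> cd_finite_index_subgroups G"
    "\<And>C. C \<in> cd_finite_index_subgroups G \<Longrightarrow> card (rcosets (regulator G)) \<le> card (rcosets C)"
    "d \<in> carrier G" "\<And>g. g \<in> carrier G \<Longrightarrow> \<exists>r\<in>regulator G. \<exists>n::int. g = r \<otimes> d [^] n"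
proof -
  interpret comm_group G using G by (simp add: class_A0_def ACD_group_def torsion_free_group_def)
  let ?cd = "cd_finite_index_subgroups G"
  define M where "M = {C \<in> ?cd. \<forall>C'\<in>?cd. card (rcosets C) \<le> card (rcosets C')}"
  have "?cd \<noteq> {}" using G by (simp add: class_A0_def ACD_group_def)
  then have "\<exists>C\<in>?cd. \<forall>C'\<in>?cd. card (rcosets C) \<le> card (rcosets C')"
    using exists_least_lemma[of "\<lambda>n. \<exists>C\<in>?cd. card (rcosets C) = n"] ex_has_least_nat[of "\<lambda>C. C \<in> ?cd" _ "\<lambda>C. card (rcosets C)"]
    by blast
  then obtain C where C: "C \<in> M" by (auto simp: M_def)
  have reg: "regulator G = \<Inter> M" by (simp add: regulator_def M_def)
  have sub: "subgroup D G" "finite (rcosets D)" "regulator G \<subseteq> D" if "D \<in> M" for D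
    using that by (auto simp: M_def cd_finite_index_subgroups_def reg)
  have R: "subgroup (regulator G) G" unfolding reg using sub(1) C by (intro subgroup_Inter) auto
  then have N: "regulator G \<lhd> G" by (rule subgroup_imp_normal)
  interpret Q: group "G Mod regulator G" using N by (rule normal.factorgroup_is_group)
  have h: "(#>) (regulator G) \<in> hom G (G Mod regulator G)" using N by (rule normal.r_coset_hom_Mod)
  obtain X where X: "X \<in> carrier (G Mod regulator G)"
    "carrier (G Mod regulator G) = range (\<lambda>n::int. X [^]\<^bsub>G Mod regulator G\<^esub> n)"
    using G Q.cyclic_group by (auto simp: class_A0_def)
  obtain d where d: "d \<in> carrier G" "X = regulator G #> d" using X(1) by (auto simp: FactGroup_def RCOSETS_def)
  have gen: "\<exists>r\<in>regulator G. \<exists>n::int. g = r \<otimes> d [^] n" if g: "g \<in> carrier G" for g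
  proof -
    have "regulator G #> g \<in> carrier (G Mod regulator G)" using hom_in_carrier[OF h g] .
    then obtain n :: int where "regulator G #> g = X [^]\<^bsub>G Mod regulator G\<^esub> n" using X(2) by auto
    also have "\<dots> = regulator G #> (d [^] n)"
      unfolding d(2) by (rule hom_int_pow[OF h d(1), symmetric]) unfold_locales
    finally have "g \<in> regulator G #> (d [^] n)" using rcos_self[OF g R] by simp
    then show ?thesis by (auto simp: r_coset_def)
  qed
  have card: "card (rcosets D) = card (rcosets C)" if "D \<in> M" for D
    using that C by (auto simp: M_def intro!: antisym)
  \<comment> \<open>Both subgroups contain the regulator and have the same index. Any power of
    \<open>d\<close> in \<open>C\<close> has an exponent divisible by that index and hence lies in
    \<open>D\<close>.\<close>
  have "C \<subseteq> D" if D: "D \<in> M" for D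
  proof
    fix g assume g: "g \<in> C"
    then have gG: "g \<in> carrier G" using subgroup.mem_carrier[OF sub(1)[OF C]] by blast
    obtain r n where rn: "r \<in> regulator G" "g = r \<otimes> d [^] (n::int)" using gen[OF gG] by blast
    have rG: "r \<in> carrier G" "r \<in> C" "r \<in> D"
      using rn(1) subgroup.mem_carrier[OF R] sub(3)[OF C] sub(3)[OF D] by auto
    have "d [^] n = inv r \<otimes> g" using rn(2) rG d by (simp add: m_assoc[symmetric])
    then have "d [^] n \<in> C" using g rG(2) sub(1)[OF C] by (simp add: subgroup.m_closed subgroup.m_inv_closed)
    then obtain q where q: "n = int (card (rcosets D)) * q"
      using index_dvd[OF sub(1,2)[OF C] sub(3)[OF C] d(1) gen] card[OF D] by (metis dvdE)
    have "(d [^] card (rcosets D)) [^] q \<in> D"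
      using finite_index_power[OF sub(1)[OF D] d(1)] subgroup_int_pow_closed[OF sub(1)[OF D]] by blast
    then have "d [^] n \<in> D" using d q by (simp add: int_pow_pow flip: int_pow_int)
    then show "g \<in> D" using rn(2) rG(3) subgroup.m_closed[OF sub(1)[OF D]] by simp
  qed
  then have "regulator G = C" using C unfolding reg by blast
  then have "regulator G \<in> M" using C by simp
  then show ?thesis using that[OF _ _ d(1) gen] by (auto simp: M_def)
qed

section \<open>Rational coordinates adapted to the regulator\<close>

lemma independent_inD:
  fixes c :: "'a \<Rightarrow> int"
  assumes "independent_in G S" "finite F" "F \<subseteq> S" "finprod G (\<lambda>x. x [^]\<^bsub>G\<^esub> c x) F = \<one>\<^bsub>G\<^esub>" "x \<in> F"
  shows "c x = 0"
  using assms(1)[unfolded independent_in_def, THEN conjunct2, THEN spec, THEN spec, THEN mp, of F c] assms(2-5)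
  by blast

text \<open>The rank one summands of the regulator serve as indices, each identified with some
  \<open>loc (P A)\<close>. A fixed multiple of every element of \<open>G\<close> lies in the
  regulator, so its coordinates extend to \<open>G\<close> by division, and the generator
  \<open>d\<close> of the cyclic quotient becomes the extra vector.\<close>

lemma regulator_embedding:
  fixes G :: "('a, 'm) monoid_scheme" (structure)
  assumes G: "class_A0 G"
  shows "\<exists>(I :: 'a set set) P b \<Psi>. finite I \<and> (\<forall>i\<in>I. \<forall>p\<in>P i. prime p) \<and>
    (\<forall>i\<in>I. \<forall>j\<in>I. P i \<subseteq> P j \<longrightarrow> P i = P j) \<and>
    \<Psi> \<in> iso G (vec_group (ext_set I P b)) \<and> \<Psi> ` regulator G = loc_vecs I P"
proof -
  have acd: "ACD_group G" and br: "block_rigid G" and rt: "of_ring_type G"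
    using G by (simp_all add: class_A0_def)
  have tf: "torsion_free_group G" using acd by (simp add: ACD_group_def)
  interpret comm_group G using tf by (simp add: torsion_free_group_def)
  obtain d where reg: "regulator G \<in> cd_finite_index_subgroups G" and d: "d \<in> carrier G"
    and gen: "\<And>g. g \<in> carrier G \<Longrightarrow> \<exists>r\<in>regulator G. \<exists>n::int. g = r \<otimes> d [^] n"
    using regulator_least_index[OF G] by metis
  define C where "C = regulator G"
  define K where "K = G\<lparr>carrier := C\<rparr>"
  have C: "subgroup C G" "completely_decomposable K" "finite (rcosets C)"
    using reg by (simp_all add: cd_finite_index_subgroups_def C_def K_def)
  have CG: "C \<subseteq> carrier G" using subgroup.subset[OF C(1)] .
  have powK: "x [^]\<^bsub>K\<^esub> n = x [^] n" for x and n :: nat by (simp add: nat_pow_def K_def)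
  interpret K: comm_group K unfolding K_def by (rule subgroup_comm_group[OF C(1)])
  obtain \<D> where \<D>: "rank1_decomposition K \<D>" using C(2) by (auto simp: completely_decomposable_def)
  have subA: "subgroup A K" and r1: "rank1_group (K\<lparr>carrier := A\<rparr>)" if "A \<in> \<D>" for A
    using \<D> that by (auto simp: rank1_decomposition_def internal_direct_sum_def)
  have AC: "A \<subseteq> C" if "A \<in> \<D>" for A using subgroup.subset[OF subA[OF that]] by (simp add: K_def)
  have crit: "group_type (K\<lparr>carrier := A\<rparr>) \<in> critical_types G" if A: "A \<in> \<D>" for A
  proof -
    obtain g where g: "g \<in> A" "g \<noteq> \<one>" using rank1_nontrivial[OF r1[OF A]] by (auto simp: K_def)
    have "g \<in> type_component K \<D> (group_type (K\<lparr>carrier := A\<rparr>))"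
      unfolding type_component_def by (rule generate.incl) (use g A in auto)
    then have "type_component K \<D> (group_type (K\<lparr>carrier := A\<rparr>)) \<noteq> {\<one>}" using g(2) by blast
    with \<D> show ?thesis unfolding critical_types_def K_def C_def by blast
  qed
  have "\<forall>A\<in>\<D>. \<exists>\<rho>P. additive_functional (K\<lparr>carrier := A\<rparr>) (fst \<rho>P) \<and>
      (\<forall>x\<in>A. fst \<rho>P x = 0 \<longrightarrow> x = \<one>) \<and> fst \<rho>P ` A = loc (snd \<rho>P) \<and> (\<forall>p\<in>snd \<rho>P. prime p) \<and>
      group_type (K\<lparr>carrier := A\<rparr>) = abs_htype (\<lambda>p. if p \<in> snd \<rho>P then \<infinity> else 0)"
  proof
    fix A assume A: "A \<in> \<D>"
    have "idempotent_type (group_type (K\<lparr>carrier := A\<rparr>))"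
      using rt crit[OF A] by (simp add: of_ring_type_def)
    from rank1_loc[OF r1[OF A] this] obtain \<rho> P where "additive_functional (K\<lparr>carrier := A\<rparr>) \<rho>"
      "\<forall>x\<in>carrier (K\<lparr>carrier := A\<rparr>). \<rho> x = 0 \<longrightarrow> x = \<one>\<^bsub>K\<lparr>carrier := A\<rparr>\<^esub>"
      "\<rho> ` carrier (K\<lparr>carrier := A\<rparr>) = loc P" "\<forall>p\<in>P. prime p"
      "group_type (K\<lparr>carrier := A\<rparr>) = abs_htype (\<lambda>p. if p \<in> P then \<infinity> else 0)" by blast
    then show "\<exists>\<rho>P. additive_functional (K\<lparr>carrier := A\<rparr>) (fst \<rho>P) \<and>
      (\<forall>x\<in>A. fst \<rho>P x = 0 \<longrightarrow> x = \<one>) \<and> fst \<rho>P ` A = loc (snd \<rho>P) \<and> (\<forall>p\<in>snd \<rho>P. prime p) \<and>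
      group_type (K\<lparr>carrier := A\<rparr>) = abs_htype (\<lambda>p. if p \<in> snd \<rho>P then \<infinity> else 0)"
      by (intro exI[of _ "(\<rho>, P)"]) (simp add: K_def)
  qed
  from bchoice[OF this] obtain \<rho>P where \<rho>P: "\<forall>A\<in>\<D>. additive_functional (K\<lparr>carrier := A\<rparr>) (fst (\<rho>P A)) \<and>
      (\<forall>x\<in>A. fst (\<rho>P A) x = 0 \<longrightarrow> x = \<one>) \<and> fst (\<rho>P A) ` A = loc (snd (\<rho>P A)) \<and> (\<forall>p\<in>snd (\<rho>P A). prime p) \<and>
      group_type (K\<lparr>carrier := A\<rparr>) = abs_htype (\<lambda>p. if p \<in> snd (\<rho>P A) then \<infinity> else 0)" ..
  define \<rho> where "\<rho> = (\<lambda>A. fst (\<rho>P A))"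
  define P where "P = (\<lambda>A. snd (\<rho>P A))"
  have \<rho>: "additive_functional (K\<lparr>carrier := A\<rparr>) (\<rho> A)" "\<And>x. x \<in> A \<Longrightarrow> \<rho> A x = 0 \<Longrightarrow> x = \<one>" "\<rho> A ` A = loc (P A)"
    and P: "\<And>p. p \<in> P A \<Longrightarrow> prime p"
    and gt: "group_type (K\<lparr>carrier := A\<rparr>) = abs_htype (\<lambda>p. if p \<in> P A then \<infinity> else 0)" if "A \<in> \<D>" for A
    using \<rho>P[THEN bspec, OF that] by (simp_all add: \<rho>_def P_def)
  \<comment> \<open>Inclusion of the prime sets makes the types comparable, hence equal by block
    rigidity; characteristics with values 0 and infinity are equivalent only if they agree at all
    primes.\<close>
  have anti: "P A = P A'" if A: "A \<in> \<D>" "A' \<in> \<D>" "P A \<subseteq> P A'" for A A'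
  proof -
    have "type_le (group_type (K\<lparr>carrier := A\<rparr>)) (group_type (K\<lparr>carrier := A'\<rparr>))"
      unfolding gt[OF A(1)] gt[OF A(2)] type_le_def using A(3)
      by (intro exI[of _ "\<lambda>p. if p \<in> P A then \<infinity> else 0"] exI[of _ "\<lambda>p. if p \<in> P A' then \<infinity> else 0"]) auto
    then have "group_type (K\<lparr>carrier := A\<rparr>) = group_type (K\<lparr>carrier := A'\<rparr>)"
      using br crit A(1,2) unfolding block_rigid_def by blast
    then have "char_equiv (\<lambda>p. if p \<in> P A then \<infinity> else 0) (\<lambda>p. if p \<in> P A' then \<infinity> else 0)"
      unfolding gt[OF A(1)] gt[OF A(2)] htype.abs_eq_iff .
    then have ce: "\<And>p. prime p \<Longrightarrow> (if p \<in> P A then \<infinity> else 0 :: enat) \<noteq> (if p \<in> P A' then \<infinity> else 0) \<Longrightarrow>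
        (if p \<in> P A' then \<infinity> else 0 :: enat) \<noteq> \<infinity>"
      unfolding char_equiv_def by blast
    have "P A' \<subseteq> P A"
    proof
      fix p assume p: "p \<in> P A'"
      show "p \<in> P A"
      proof (rule ccontr)
        assume "p \<notin> P A"
        then show False using ce[OF P[OF A(2) p]] p by simp
      qed
    qed
    then show ?thesis using A(3) by blast
  qed
  have Ks: "carrier K = C" "monoid.mult K = monoid.mult G" "one K = one G" by (simp_all add: K_def)
  let ?S = "sum_group \<D> (\<lambda>A. K\<lparr>carrier := A\<rparr>)"
  let ?\<theta> = "\<lambda>x. gfinprod K x \<D>"
  have \<theta>: "?\<theta> \<in> iso ?S K" using \<D> by (simp add: rank1_decomposition_def internal_direct_sum_def)
  have grp: "group (K\<lparr>carrier := A\<rparr>)" if "A \<in> \<D>" for A using K.subgroup_imp_group[OF subA[OF that]] .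
  interpret S: group ?S by (rule sum_group[OF grp])
  have carS: "x \<in> carrier ?S \<longleftrightarrow> x \<in> extensional \<D> \<and> (\<forall>A\<in>\<D>. x A \<in> A) \<and> finite {A\<in>\<D>. x A \<noteq> \<one>}" for x
    by (auto simp: carrier_sum_group[OF grp] PiE_iff Ks)
  define \<eta> where "\<eta> = inv_into (carrier ?S) ?\<theta>"
  have \<eta>: "\<eta> \<in> iso K ?S" unfolding \<eta>_def by (rule S.iso_set_sym[OF \<theta>])
  then have \<eta>h: "\<eta> \<in> hom K ?S" by (simp add: iso_def)
  have inj\<theta>: "inj_on ?\<theta> (carrier ?S)" using \<theta> by (simp add: iso_def bij_betw_def)
  have \<eta>\<theta>: "\<eta> (?\<theta> x) = x" if "x \<in> carrier ?S" for x
    unfolding \<eta>_def by (rule inv_into_f_f[OF inj\<theta> that])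
  have \<eta>_in: "\<eta> c \<in> carrier ?S" if "c \<in> C" for c using hom_in_carrier[OF \<eta>h] that by (simp add: Ks)
  have \<theta>_in: "?\<theta> x \<in> C" if "x \<in> carrier ?S" for x
    using hom_in_carrier[of ?\<theta> ?S K x] \<theta> that by (simp add: iso_def Ks)
  have \<eta>_mult: "\<eta> (c \<otimes> c') A = \<eta> c A \<otimes> \<eta> c' A" if "c \<in> C" "c' \<in> C" "A \<in> \<D>" for c c' A
    using hom_mult[OF \<eta>h, of c c'] that by (simp add: Ks)
  define F where "F = (\<lambda>c A. if A \<in> \<D> then \<rho> A (\<eta> c A) else 0)"
  have F_add: "F (c \<otimes> c') A = F c A + F c' A" if "c \<in> C" "c' \<in> C" for c c' A
  proof (cases "A \<in> \<D>")
    case True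
    have "\<eta> c A \<in> A" "\<eta> c' A \<in> A" using \<eta>_in that True carS by auto
    then show ?thesis
      using \<eta>_mult[OF that True] additive_functional.mult[OF \<rho>(1)[OF True], of "\<eta> c A" "\<eta> c' A"] True
      by (simp add: F_def Ks)
  qed (simp add: F_def)
  interpret FK: additive_functional K "\<lambda>c. F c A" for A
    by unfold_locales (use F_add in \<open>simp add: Ks\<close>)
  have \<rho>_one: "\<rho> A \<one> = 0" if "A \<in> \<D>" for A
    using additive_functional.one[OF \<rho>(1)[OF that]] by (simp add: Ks)
  have F_fin: "finite {A. F c A \<noteq> 0}" if "c \<in> C" for c
  proof (rule finite_subset)
    show "{A. F c A \<noteq> 0} \<subseteq> {A\<in>\<D>. \<eta> c A \<noteq> \<one>}" using \<rho>_one by (auto simp: F_def)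
    show "finite {A\<in>\<D>. \<eta> c A \<noteq> \<one>}" using \<eta>_in[OF that] carS by blast
  qed
  have F_inj: "c = \<one>" if c: "c \<in> C" "\<And>A. F c A = 0" for c
  proof -
    have "\<eta> c = \<one>\<^bsub>?S\<^esub>"
    proof (rule extensionalityI[of _ \<D>])
      fix A assume A: "A \<in> \<D>"
      have "\<rho> A (\<eta> c A) = 0" using c(2)[of A] A by (simp add: F_def)
      then show "\<eta> c A = \<one>\<^bsub>?S\<^esub> A" using \<rho>(2)[OF A] \<eta>_in[OF c(1)] carS A by (simp add: Ks)
    qed (use \<eta>_in[OF c(1)] carS in auto)
    moreover have "\<eta> \<one> = \<one>\<^bsub>?S\<^esub>" using hom_one[OF \<eta>h K.is_group S.is_group] by (simp add: Ks)
    moreover have "inj_on \<eta> C" using \<eta> by (simp add: iso_def bij_betw_def Ks)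
    ultimately show ?thesis using c(1) subgroup.one_closed[OF C(1)] by (metis inj_onD)
  qed
  define N where "N = card (rcosets C)"
  have "C \<in> rcosets C" using subgroup.subgroup_in_rcosets[OF C(1) is_group] .
  then have N: "N > 0" using C(3) unfolding N_def by (auto simp: card_gt_0_iff)
  have NC: "x [^] N \<in> C" if "x \<in> carrier G" for x using finite_index_power[OF C(1) that] by (simp add: N_def)
  \<comment> \<open>The \<open>N\<close>-th multiple lies in the regulator; dividing its coordinates
    by \<open>N\<close> is the only additive extension of \<open>F\<close>.\<close>
  define \<Psi> where "\<Psi> = (\<lambda>x A. F (x [^] N) A / of_nat N)"
  interpret \<Psi>: additive_functional G "\<lambda>x. \<Psi> x A" for A
    by unfold_locales (simp add: \<Psi>_def nat_pow_distrib F_add NC add_divide_distrib)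
  have \<Psi>_zero: "x = \<one>" if x: "x \<in> carrier G" "\<Psi> x = 0" for x
  proof -
    have "F (x [^] N) A = 0" for A using fun_cong[OF x(2), of A] N by (simp add: \<Psi>_def)
    then have "x [^] N = \<one>" using F_inj NC[OF x(1)] by blast
    then show ?thesis using tf x(1) N unfolding torsion_free_group_def by blast
  qed
  have \<Psi>_C: "\<Psi> c = F c" if "c \<in> C" for c
    using FK.nat_pow[of c N] that N by (simp add: \<Psi>_def powK fun_eq_iff Ks)
  have \<Psi>_fin: "finite {A. \<Psi> x A \<noteq> 0}" if "x \<in> carrier G" for x
    using F_fin[OF NC[OF that]] N by (simp add: \<Psi>_def)
  have \<Psi>_out: "\<Psi> x A = 0" if "A \<notin> \<D>" for x A using that by (simp add: \<Psi>_def F_def)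
  have \<D>_nonzero: "\<exists>g\<in>carrier G. \<Psi> g A \<noteq> 0" if A: "A \<in> \<D>" for A
  proof -
    obtain g where g: "g \<in> A" "g \<noteq> \<one>" using rank1_nontrivial[OF r1[OF A]] by (auto simp: Ks)
    define x where "x = (\<lambda>B\<in>\<D>. if B = A then g else \<one>)"
    have oneB: "\<one> \<in> B" if "B \<in> \<D>" for B using subgroup.one_closed[OF subA[OF that]] by (simp add: Ks)
    have xS: "x \<in> carrier ?S"
      unfolding carS using g A oneB by (auto simp: x_def intro!: finite_subset[of _ "{A}"])
    have "\<eta> (?\<theta> x) A = g" using \<eta>\<theta>[OF xS] A by (simp add: x_def)
    then have "F (?\<theta> x) A \<noteq> 0" using \<rho>(2)[OF A g(1)] g(2) A by (auto simp: F_def)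
    then show ?thesis using \<Psi>_C[OF \<theta>_in[OF xS]] \<theta>_in[OF xS] CG by (metis subsetD)
  qed
  \<comment> \<open>A decomposition may a priori be infinite. If every member of a maximal
    independent set \<open>S\<close> had coordinate 0 at \<open>A\<close>, an element with nonzero
    coordinate there could be added to \<open>S\<close>. So \<open>A\<close> lies in the union of
    the finite supports of the finitely many members of \<open>S\<close>.\<close>
  have fin\<D>: "finite \<D>"
  proof -
    obtain S where S: "independent_in G S" "\<And>S'. independent_in G S' \<Longrightarrow> S \<subseteq> S' \<Longrightarrow> S' = S" "finite S"
      using acd by (auto simp: ACD_group_def has_rank_def)
    have SG: "S \<subseteq> carrier G" using S(1) by (simp add: independent_in_def)
    have "\<D> \<subseteq> (\<Union>s\<in>S. {A. \<Psi> s A \<noteq> 0})"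
    proof
      fix A assume A: "A \<in> \<D>"
      show "A \<in> (\<Union>s\<in>S. {A. \<Psi> s A \<noteq> 0})"
      proof (rule ccontr)
        assume no: "A \<notin> (\<Union>s\<in>S. {A. \<Psi> s A \<noteq> 0})"
        then have S0: "\<Psi> s A = 0" if "s \<in> S" for s using that by blast
        obtain g where g: "g \<in> carrier G" "\<Psi> g A \<noteq> 0" using \<D>_nonzero[OF A] by blast
        have "independent_in G (insert g S)"
          unfolding independent_in_def
        proof (intro conjI allI impI)
          show "insert g S \<subseteq> carrier G" using g SG by blast
          fix F and c :: "'a \<Rightarrow> int"
          assume h: "finite F \<and> F \<subseteq> insert g S \<and> finprod G (\<lambda>x. x [^] c x) F = \<one>"
          have FG: "(\<lambda>x. x [^] c x) \<in> F \<rightarrow> carrier G" using h g SG by auto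
          have "(\<Sum>x\<in>F. \<Psi> (x [^] c x) A) = 0"
            using \<Psi>.finprod[OF _ FG, of A] h \<Psi>.one by simp
          moreover have "(\<Sum>x\<in>F. \<Psi> (x [^] c x) A) = (\<Sum>x\<in>F. if x = g then of_int (c g) * \<Psi> g A else 0)"
          proof (rule sum.cong[OF refl])
            fix x assume "x \<in> F"
            then have "x \<in> insert g S" using h by blast
            then show "\<Psi> (x [^] c x) A = (if x = g then of_int (c g) * \<Psi> g A else 0)"
              using \<Psi>.int_pow[of x "c x" A] g SG S0 by auto
          qed
          ultimately have gc: "g \<in> F \<Longrightarrow> c g = 0" using h g(2) by simp
          have "finprod G (\<lambda>x. x [^] c x) (F - {g}) = finprod G (\<lambda>x. x [^] c x) F"
            using FG gc h by (intro finprod_mono_neutral_cong_left) auto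
          then have one: "finprod G (\<lambda>x. x [^] c x) (F - {g}) = \<one>" using h by simp
          show "\<forall>x\<in>F. c x = 0"
          proof
            fix x assume x: "x \<in> F"
            show "c x = 0"
            proof (cases "x = g")
              case False
              show ?thesis
                by (rule independent_inD[OF S(1) _ _ one]) (use h x False in auto)
            qed (use gc x in simp)
          qed
        qed
        then have "insert g S = S" using S(2) by blast
        then show False using S0 g(2) by blast
      qed
    qed
    moreover have "finite (\<Union>s\<in>S. {A. \<Psi> s A \<noteq> 0})" using S(3) \<Psi>_fin SG by blast
    ultimately show ?thesis by (rule finite_subset)
  qed
  have img_C: "\<Psi> ` C = loc_vecs \<D> P"
  proof (intro equalityI subsetI)
    fix v assume "v \<in> \<Psi> ` C"
    then obtain c where c: "c \<in> C" "v = F c" using \<Psi>_C by auto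
    show "v \<in> loc_vecs \<D> P"
      unfolding loc_vecs_def
    proof (intro CollectI conjI allI impI ballI)
      fix A assume A: "A \<in> \<D>"
      then have "\<eta> c A \<in> A" using \<eta>_in[OF c(1)] carS by blast
      then show "v A \<in> loc (P A)" using \<rho>(3)[OF A] A by (auto simp: c(2) F_def)
    qed (simp add: c(2) F_def)
  next
    fix v assume v: "v \<in> loc_vecs \<D> P"
    have "\<forall>A\<in>\<D>. \<exists>x. x \<in> A \<and> \<rho> A x = v A"
    proof
      fix A assume A: "A \<in> \<D>"
      then have "v A \<in> \<rho> A ` A" unfolding \<rho>(3)[OF A] using v by (simp add: loc_vecs_def)
      then show "\<exists>x. x \<in> A \<and> \<rho> A x = v A" by (metis imageE)
    qed
    from bchoice[OF this] obtain x0 where x0: "\<forall>A\<in>\<D>. x0 A \<in> A \<and> \<rho> A (x0 A) = v A" ..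
    define x where "x = restrict x0 \<D>"
    have xS: "x \<in> carrier ?S" unfolding carS using x0 fin\<D> by (auto simp: x_def)
    have "F (?\<theta> x) = v"
      using \<eta>\<theta>[OF xS] x0 v by (auto simp: F_def fun_eq_iff x_def loc_vecs_def)
    then show "v \<in> \<Psi> ` C" using \<Psi>_C[OF \<theta>_in[OF xS]] \<theta>_in[OF xS] by (metis imageI)
  qed
  have gen: "\<exists>r\<in>C. \<exists>n::int. g = r \<otimes> d [^] n" if "g \<in> carrier G" for g
    using gen[OF that] by (simp add: C_def)
  have \<Psi>_gen: "\<Psi> (r \<otimes> d [^] (n::int)) A = \<Psi> r A + of_int n * \<Psi> d A" if "r \<in> C" for r n A
    using that CG d by (simp add: \<Psi>.mult \<Psi>.int_pow subset_iff)
  have img_G: "\<Psi> ` carrier G = ext_set \<D> P (\<Psi> d)"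
  proof (intro equalityI subsetI)
    fix v assume "v \<in> \<Psi> ` carrier G"
    then obtain r n where rn: "r \<in> C" "v = \<Psi> (r \<otimes> d [^] (n::int))" using gen by blast
    have "\<Psi> r \<in> loc_vecs \<D> P" using rn(1) img_C by blast
    then show "v \<in> ext_set \<D> P (\<Psi> d)"
      using \<Psi>_out \<Psi>_gen[OF rn(1), of n] unfolding ext_set_def rn(2) loc_vecs_def
      by (intro CollectI conjI exI[of _ n]) simp_all
  next
    fix v assume v: "v \<in> ext_set \<D> P (\<Psi> d)"
    obtain n where n: "\<And>A. A \<in> \<D> \<Longrightarrow> v A - of_int n * \<Psi> d A \<in> loc (P A)"
      using v unfolding ext_set_def by blast
    have "(\<lambda>A. v A - of_int n * \<Psi> d A) \<in> loc_vecs \<D> P"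
      using v n \<Psi>_out unfolding ext_set_def loc_vecs_def by simp
    then obtain r where r: "r \<in> C" "(\<lambda>A. v A - of_int n * \<Psi> d A) = \<Psi> r" unfolding img_C[symmetric] by blast
    have "v = \<Psi> (r \<otimes> d [^] n)"
    proof
      fix A show "v A = \<Psi> (r \<otimes> d [^] n) A" using \<Psi>_gen[OF r(1), of n A] fun_cong[OF r(2), of A] by simp
    qed
    then show "v \<in> \<Psi> ` carrier G" using r(1) CG d by (intro image_eqI[of _ _ "r \<otimes> d [^] n"]) auto
  qed
  have "\<Psi> \<in> iso G (vec_group (ext_set \<D> P (\<Psi> d)))"
  proof (rule isoI)
    show "\<Psi> \<in> hom G (vec_group (ext_set \<D> P (\<Psi> d)))"
    proof (rule homI)
      show "\<Psi> x \<in> carrier (vec_group (ext_set \<D> P (\<Psi> d)))" if "x \<in> carrier G" for x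
        using img_G that by auto
      show "\<Psi> (x \<otimes> y) = \<Psi> x \<otimes>\<^bsub>vec_group (ext_set \<D> P (\<Psi> d))\<^esub> \<Psi> y"
        if "x \<in> carrier G" "y \<in> carrier G" for x y
        using \<Psi>.mult[OF that] by (simp add: fun_eq_iff)
    qed
    show "bij_betw \<Psi> (carrier G) (carrier (vec_group (ext_set \<D> P (\<Psi> d))))"
      unfolding bij_betw_def
    proof
      show "inj_on \<Psi> (carrier G)"
      proof (rule inj_onI)
        fix x y assume xy: "x \<in> carrier G" "y \<in> carrier G" "\<Psi> x = \<Psi> y"
        have "x \<otimes> inv y = \<one>"
          using xy by (intro \<Psi>_zero) (auto simp: fun_eq_iff \<Psi>.mult \<Psi>.inv)
        then show "x = y" using xy by (metis inv_closed inv_equality inv_inv)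
      qed
    qed (use img_G in simp)
  qed
  then show ?thesis
    using fin\<D> P anti img_C unfolding C_def
    by (intro exI[of _ \<D>] exI[of _ P] exI[of _ "\<Psi> d"] exI[of _ \<Psi>] conjI ballI impI) auto
qed

section \<open>Normal form\<close>

text \<open>The condition on \<open>loc_vecs I P\<close> keeps track of the regulator, whose minimal
  index is used again after the change of basis.\<close>

definition ext_equiv :: "'i set \<Rightarrow> ('i \<Rightarrow> nat set) \<Rightarrow> ('i \<Rightarrow> rat) \<Rightarrow> ('i \<Rightarrow> rat) \<Rightarrow> bool" where
  "ext_equiv I P b b' \<longleftrightarrow> (\<exists>\<phi>\<in>iso (vec_group (ext_set I P b)) (vec_group (ext_set I P b')).
     \<phi> ` loc_vecs I P = loc_vecs I P)"

lemma iso_compose_image: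
  assumes "f \<in> iso G H" "f ` C = Y" "g \<in> iso H K" "g ` Y = Z"
  shows "g \<circ> f \<in> iso G K" "(g \<circ> f) ` C = Z"
  using iso_set_trans[OF assms(1,3)] assms(2,4) by (simp_all only: image_comp[symmetric])

lemma ext_equiv_refl: "ext_equiv I P b b"
  unfolding ext_equiv_def
  by (intro bexI[of _ "\<lambda>x. x"] vec_group_isoI[where \<psi> = "\<lambda>x. x"]) auto

lemma ext_equiv_trans:
  assumes "ext_equiv I P a b" "ext_equiv I P b c"
  shows "ext_equiv I P a c"
proof -
  obtain f g where f: "f \<in> iso (vec_group (ext_set I P a)) (vec_group (ext_set I P b))" "f ` loc_vecs I P = loc_vecs I P"
    and g: "g \<in> iso (vec_group (ext_set I P b)) (vec_group (ext_set I P c))" "g ` loc_vecs I P = loc_vecs I P"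
    using assms unfolding ext_equiv_def by blast
  show ?thesis
    unfolding ext_equiv_def
    using iso_compose_image[OF f g] by blast
qed

text \<open>An elementary operation within one block; its integral coefficient keeps local vectors
  local, and subtracting the same multiple inverts it.\<close>

lemma ext_equiv_add_multiple:
  assumes ij: "i \<in> I" "j \<in> I" "i \<noteq> j" "P i = P j"
  shows "ext_equiv I P b (b(j := b j + of_int z * b i))"
proof -
  define op where "op = (\<lambda>z f. f(j := f j + of_int z * f i) :: 'a \<Rightarrow> rat)"
  have op_in: "op z f \<in> ext_set I P (op z b)" if f: "f \<in> ext_set I P b" for z f b
  proof -
    obtain k where k: "\<And>l. l \<in> I \<Longrightarrow> f l - of_int k * b l \<in> loc (P l)" using f by (auto simp: ext_set_def)
    have "op z f l - of_int k * op z b l \<in> loc (P l)" if l: "l \<in> I" for l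
    proof (cases "l = j")
      case True
      have "(f j - of_int k * b j) + of_int z * (f i - of_int k * b i) \<in> loc (P j)"
        using k[OF ij(1)] k[OF ij(2)] ij(4) by (intro loc_add loc_mult[OF loc_of_int]) simp_all
      then show ?thesis using True by (simp add: op_def algebra_simps)
    qed (use k[OF l] in \<open>simp add: op_def\<close>)
    then show ?thesis using f ij unfolding ext_set_def by (intro CollectI conjI exI[of _ k]) (auto simp: op_def)
  qed
  have inv: "op (- z) (op z f) = f" for z f using ij(3) by (auto simp: op_def fun_eq_iff)
  have inv': "op z (op (- z) f) = f" for f using inv[of "- z" f] by simp
  have "op z \<in> iso (vec_group (ext_set I P b)) (vec_group (ext_set I P (op z b)))"
  proof (rule vec_group_isoI[where \<psi> = "op (- z)"])
    show "op (- z) y \<in> ext_set I P b" if "y \<in> ext_set I P (op z b)" for y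
      using op_in[OF that, of "- z"] by (simp add: inv)
    show "op z f \<in> ext_set I P (op z b)" if "f \<in> ext_set I P b" for f by (rule op_in[OF that])
    show "op z (f + f') = op z f + op z f'" for f f' by (auto simp: op_def fun_eq_iff algebra_simps)
  qed (rule inv inv')+
  moreover have "op z ` loc_vecs I P = loc_vecs I P"
  proof -
    \<comment> \<open>Local vectors are the extension by the zero vector, which the operation
      fixes.\<close>
    have z0: "op z (\<lambda>_. 0) = (\<lambda>_. 0)" for z by (auto simp: op_def)
    have "op z f \<in> loc_vecs I P" if "f \<in> loc_vecs I P" for z f
      using op_in[of f "\<lambda>_. 0" z] that unfolding z0 ext_set_0 .
    then show ?thesis using inv' by (auto intro!: image_eqI[of _ "op z" "op (- z) _"])
  qed
  ultimately show ?thesis unfolding ext_equiv_def op_def by blast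
qed

text \<open>The Euclidean algorithm inside each block.\<close>

lemma ext_equiv_reduced_aux:
  fixes x :: "'i \<Rightarrow> int"
  assumes fin: "finite I"
  shows "\<exists>x' :: 'i \<Rightarrow> int. ext_equiv I P (\<lambda>i. of_int (x i) / of_nat N) (\<lambda>i. of_int (x' i) / of_nat N) \<and>
    (\<forall>i\<in>I. \<forall>j\<in>I. i \<noteq> j \<longrightarrow> P i = P j \<longrightarrow> x' i = 0 \<or> x' j = 0)"
proof (induction "nat (\<Sum>i\<in>I. \<bar>x i\<bar>)" arbitrary: x rule: less_induct)
  case less
  show ?case
  proof (cases "\<forall>i\<in>I. \<forall>j\<in>I. i \<noteq> j \<longrightarrow> P i = P j \<longrightarrow> x i = 0 \<or> x j = 0")
    case True
    then show ?thesis using ext_equiv_refl by blast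
  next
    case False
    then obtain i0 j0 where ij0: "i0 \<in> I" "j0 \<in> I" "i0 \<noteq> j0" "P i0 = P j0" "x i0 \<noteq> 0" "x j0 \<noteq> 0" by blast
    obtain i j where ij: "i \<in> I" "j \<in> I" "i \<noteq> j" "P i = P j" "x i \<noteq> 0" "x j \<noteq> 0" "\<bar>x i\<bar> \<le> \<bar>x j\<bar>"
    proof (cases "\<bar>x i0\<bar> \<le> \<bar>x j0\<bar>")
      case True
      then show ?thesis using that[of i0 j0] ij0 by blast
    next
      case False
      then show ?thesis using that[of j0 i0] ij0 by simp
    qed
    \<comment> \<open>This sign gives the new entry the absolute value |x j| - |x i|, so the sum of
      the absolute values drops.\<close>
    define z where "z = - sgn (x i) * sgn (x j)"
    define y where "y = x(j := x j + z * x i)"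
    have abs: "\<bar>x j + z * x i\<bar> < \<bar>x j\<bar>"
      using ij(5-7) unfolding z_def by (cases "x i > 0"; cases "x j > 0") (auto simp: sgn_if)
    have "(\<Sum>i\<in>I. \<bar>y i\<bar>) < (\<Sum>i\<in>I. \<bar>x i\<bar>)"
      by (rule sum_strict_mono_ex1[OF fin]) (use abs ij(2) in \<open>auto simp: y_def\<close>)
    then have "nat (\<Sum>i\<in>I. \<bar>y i\<bar>) < nat (\<Sum>i\<in>I. \<bar>x i\<bar>)"
      by (subst nat_less_eq_zless) (simp_all add: sum_nonneg)
    then obtain x' where x': "ext_equiv I P (\<lambda>i. of_int (y i) / of_nat N) (\<lambda>i. of_int (x' i) / of_nat N)"
      "\<forall>i\<in>I. \<forall>j\<in>I. i \<noteq> j \<longrightarrow> P i = P j \<longrightarrow> x' i = 0 \<or> x' j = 0"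
      using less by blast
    have "(\<lambda>i. of_int (y i) / of_nat N) = (\<lambda>i. of_int (x i) / of_nat N :: rat)(j := of_int (x j) / of_nat N + of_int z * (of_int (x i) / of_nat N))"
      by (auto simp: y_def fun_eq_iff add_divide_distrib)
    then have "ext_equiv I P (\<lambda>i. of_int (x i) / of_nat N) (\<lambda>i. of_int (y i) / of_nat N)"
      using ext_equiv_add_multiple[OF ij(1-4), of "\<lambda>i. of_int (x i) / of_nat N" z] by simp
    then show ?thesis using x' ext_equiv_trans by blast
  qed
qed

lemma ext_set_cong:
  assumes "\<And>i. i \<in> I \<Longrightarrow> b i - b' i \<in> loc (P i)"
  shows "ext_set I P b = ext_set I P b'"
proof -
  have "f \<in> ext_set I P b'" if f: "f \<in> ext_set I P b" and h: "\<And>i. i \<in> I \<Longrightarrow> b i - b' i \<in> loc (P i)" for f b b'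
  proof -
    obtain k where k: "\<And>i. i \<in> I \<Longrightarrow> f i - of_int k * b i \<in> loc (P i)" using f by (auto simp: ext_set_def)
    have "f i - of_int k * b' i \<in> loc (P i)" if i: "i \<in> I" for i
    proof -
      have "(f i - of_int k * b i) + of_int k * (b i - b' i) \<in> loc (P i)"
        by (intro loc_add loc_mult[OF loc_of_int] k h i)
      then show ?thesis by (simp add: algebra_simps)
    qed
    then show ?thesis using f unfolding ext_set_def by (intro CollectI conjI exI[of _ k]) auto
  qed
  moreover have "b' i - b i \<in> loc (P i)" if "i \<in> I" for i
    using loc_uminus[OF assms[OF that]] by simp
  ultimately show ?thesis using assms by blast
qed

lemma ext_equiv_reduced:
  assumes fin: "finite I"
  shows "\<exists>b'. ext_equiv I P b b' \<and> (\<forall>i\<in>I. \<forall>j\<in>I. i \<noteq> j \<longrightarrow> P i = P j \<longrightarrow> b' i = 0 \<or> b' j = 0)"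
proof -
  obtain N where N: "N > (0::nat)" "\<forall>i\<in>I. \<exists>z. of_nat N * b i = of_int z"
    using common_denominator[OF fin] by blast
  from bchoice[OF N(2)] obtain x where x: "\<forall>i\<in>I. of_nat N * b i = of_int (x i)" ..
  have "ext_set I P b = ext_set I P (\<lambda>i. of_int (x i) / of_nat N)"
  proof (rule ext_set_cong)
    fix i assume "i \<in> I"
    then have "of_nat N * b i = of_int (x i)" using x by blast
    then have "b i = of_int (x i) / of_nat N" using N(1) by (simp add: field_simps)
    then show "b i - of_int (x i) / of_nat N \<in> loc (P i)" by simp
  qed
  then have "ext_equiv I P b (\<lambda>i. of_int (x i) / of_nat N)"
    using ext_equiv_refl[of I P b] unfolding ext_equiv_def by simp
  moreover obtain x' where "ext_equiv I P (\<lambda>i. of_int (x i) / of_nat N) (\<lambda>i. of_int (x' i) / of_nat N)"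
    "\<forall>i\<in>I. \<forall>j\<in>I. i \<noteq> j \<longrightarrow> P i = P j \<longrightarrow> x' i = 0 \<or> x' j = 0"
    using ext_equiv_reduced_aux[OF fin] by blast
  ultimately show ?thesis
    by (intro exI[of _ "\<lambda>i. of_int (x' i) / of_nat N"]) (auto intro: ext_equiv_trans)
qed

text \<open>The denominator \<open>m\<close> is the order of \<open>q\<close> modulo \<open>loc P\<close>.\<close>

lemma frac_mod_loc:
  assumes P: "\<And>p. p \<in> P \<Longrightarrow> prime p"
  shows "\<exists>m s. coprime_to P m \<and> coprime s m \<and> q - of_int s / of_int m \<in> loc P"
proof -
  define S where "S = {k::nat. k > 0 \<and> of_nat k * q \<in> loc P}"
  obtain a0 b0 where "q = of_int a0 / of_int b0" "b0 > 0" by (metis Rat_cases Fract_of_int_quotient)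
  then have "of_nat (nat b0) * q = of_int a0" "nat b0 > 0" by simp_all
  then have "nat b0 \<in> S" by (simp add: S_def)
  define m where "m = (LEAST k. k \<in> S)"
  have m: "m \<in> S" "\<And>l. l \<in> S \<Longrightarrow> m \<le> l"
    unfolding m_def using \<open>nat b0 \<in> S\<close> by (auto intro: LeastI Least_le)
  have m0: "m > 0" using m(1) by (simp add: S_def)
  have cop: "coprime_to P (int m)"
    unfolding coprime_to_def
  proof (intro conjI ballI impI notI)
    fix p assume p: "p \<in> P" "int p dvd int m"
    then obtain l where l: "m = p * l" by auto
    have "of_nat m * q * (1 / of_nat p) \<in> loc P"
      by (rule loc_mult[OF _ loc_inverse_prime[OF P[OF p(1)] p(1)]]) (use m(1) in \<open>simp add: S_def\<close>)
    moreover have "of_nat m * q * (1 / of_nat p) = of_nat l * q"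
      using l m0 by simp
    ultimately have "l \<in> S" using l m0 by (auto simp: S_def)
    then have "m \<le> l" by (rule m(2))
    moreover have "p \<ge> 2" using P[OF p(1)] prime_ge_2_nat by blast
    moreover have "l > 0" using l m0 by (cases l) auto
    ultimately show False using l by (metis mult_le_mono1 nat_mult_1 not_le less_le_trans one_less_numeral_iff semiring_norm(76) mult_less_cancel2)
  qed (use m0 in simp)
  obtain a c where ac: "of_nat m * q = of_int a / of_nat c" "c \<in> dens P"
    using m(1) by (auto simp: S_def elim: locE)
  \<comment> \<open>Here q = a/(c m), and \<open>c\<close> is invertible modulo \<open>m\<close>
    with inverse \<open>u\<close>; so a u/m differs from \<open>q\<close> by an element of
    \<open>loc P\<close>.\<close>
  obtain u where u: "int m dvd 1 - int c * u"
    using coprime_inverse_int[OF coprime_to_coprime[OF cop ac(2)]] by blast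
  define s where "s = a * u"
  obtain w where w: "1 - int c * u = int m * w" using u by blast
  have "q = (of_nat m * q) / of_nat m" using m0 by simp
  then have q: "q = of_int a / (of_nat c * of_nat m)" unfolding ac(1) by simp
  have cw: "1 - of_nat c * of_int u = (of_nat m * of_int w :: rat)"
    using arg_cong[OF w, of "of_int :: int \<Rightarrow> rat"] by simp
  have "q - of_int s / of_int (int m) = of_int a * (1 - of_nat c * of_int u) / (of_nat c * of_nat m)"
    using m0 dens_pos[OF ac(2)] by (simp add: q s_def field_simps)
  also have "\<dots> = of_int (a * w) / of_nat c" unfolding cw using m0 by simp
  also have "\<dots> \<in> loc P" by (rule locI[OF ac(2)])
  finally have diff: "q - of_int s / of_int (int m) \<in> loc P" .
  have "coprime s (int m)"
  proof (rule coprimeI)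
    fix e assume e: "e dvd s" "e dvd int m"
    define f where "f = nat \<bar>e\<bar>"
    have f: "int f dvd s" "int f dvd int m" using e by (simp_all add: f_def)
    then obtain s1 where s1: "s = int f * s1" by blast
    obtain m1 where m1: "m = f * m1" using f(2) by auto
    have f0: "f > 0" "m1 > 0" using m1 m0 by auto
    have "of_nat m1 * (q - of_int s / of_int (int m)) + of_int s1 \<in> loc P"
      using loc_mult[OF loc_of_int[of "int m1"] diff] by (intro loc_add) simp_all
    moreover have "of_nat m1 * (q - of_int s / of_int (int m)) + of_int s1 = of_nat m1 * q"
      using f0 by (simp add: s1 m1 field_simps)
    ultimately have "m1 \<in> S" using f0 by (simp add: S_def)
    then have "m \<le> m1" by (rule m(2))
    then have "f * m1 \<le> 1 * m1" using m1 by simp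
    then have "f \<le> 1" using f0 by (simp only: mult_le_cancel2)
    then have "f = 1" using f0 by simp
    then show "is_unit e" unfolding f_def by auto
  qed
  then show ?thesis using cop diff by blast
qed

text \<open>Modulo local numbers the coordinate is s/m with \<open>s\<close> coprime to
  \<open>m\<close>. Its multiples together with \<open>loc (P i)\<close> fill all of
  \<open>loc (P i)\<close> divided by \<open>m\<close>, so multiplication by \<open>m\<close> at
  coordinate \<open>i\<close> is the isomorphism.\<close>

lemma ext_set_single_iso:
  assumes i: "i \<in> I" and P: "\<And>p. p \<in> P i \<Longrightarrow> prime p"
  shows "\<exists>\<phi>. \<phi> \<in> iso (vec_group (ext_set I P ((\<lambda>_. 0)(i := q)))) (vec_group (loc_vecs I P))"
proof -
  obtain m s where m: "coprime_to (P i) m" "coprime s m" "q - of_int s / of_int m \<in> loc (P i)"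
    using frac_mod_loc[OF P] by blast
  have m0: "m > 0" using m(1) by (simp add: coprime_to_def)
  let ?b = "(\<lambda>_. 0)(i := of_int s / of_int m :: rat)"
  have eq: "ext_set I P ((\<lambda>_. 0)(i := q)) = ext_set I P ?b"
    by (rule ext_set_cong) (use m(3) in auto)
  define \<phi> where "\<phi> = (\<lambda>f. f(i := of_int m * f i) :: 'a \<Rightarrow> rat)"
  define \<psi> where "\<psi> = (\<lambda>f. f(i := f i / of_int m) :: 'a \<Rightarrow> rat)"
  have "\<phi> \<in> iso (vec_group (ext_set I P ?b)) (vec_group (loc_vecs I P))"
  proof (rule vec_group_isoI[where \<psi> = \<psi>])
    fix f assume f: "f \<in> ext_set I P ?b"
    obtain k where k: "\<And>j. j \<in> I \<Longrightarrow> f j - of_int k * ?b j \<in> loc (P j)" using f unfolding ext_set_def by blast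
    have "of_int m * (f i - of_int k * ?b i) + of_int (k * s) \<in> loc (P i)"
      by (intro loc_add loc_mult[OF loc_of_int] k[OF i] loc_of_int)
    then have "of_int m * f i \<in> loc (P i)" using m0 by (simp add: algebra_simps)
    moreover have "f j \<in> loc (P j)" if "j \<in> I" "j \<noteq> i" for j using k[OF that(1)] that(2) by simp
    ultimately show "\<phi> f \<in> loc_vecs I P" using f i by (auto simp: loc_vecs_def \<phi>_def ext_set_def)
  next
    fix f assume f: "f \<in> loc_vecs I P"
    have "f i \<in> loc (P i)" using f i by (simp add: loc_vecs_def)
    then obtain a c where ac: "f i = of_int a / of_nat c" "c \<in> dens (P i)" by (rule locE)
    \<comment> \<open>The inverse \<open>u\<close> of c s modulo m shows that a/(c m) is a u copies
      of s/m up to a local number.\<close>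
    have "coprime (int c * s) m" using coprime_to_coprime[OF m(1) ac(2)] m(2) by simp
    then obtain u where "m dvd 1 - int c * s * u" using coprime_inverse_int by blast
    then obtain w where w: "1 - int c * s * u = m * w" by blast
    have cw: "1 - of_nat c * of_int s * of_int u = (of_int m * of_int w :: rat)"
      using arg_cong[OF w, of "of_int :: int \<Rightarrow> rat"] by simp
    have "f i / of_int m - of_int (a * u) * (of_int s / of_int m) =
        of_int a * (1 - of_nat c * of_int s * of_int u) / (of_nat c * of_int m)"
      using m0 dens_pos[OF ac(2)] by (simp add: ac(1) field_simps)
    also have "\<dots> = of_int (a * w) / of_nat c" unfolding cw using m0 by simp
    also have "\<dots> \<in> loc (P i)" by (rule locI[OF ac(2)])
    finally have "\<psi> f j - of_int (a * u) * ?b j \<in> loc (P j)" if "j \<in> I" for j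
      using f that by (cases "j = i") (auto simp: \<psi>_def loc_vecs_def)
    moreover have "\<psi> f j = 0" if "j \<notin> I" for j using f i that by (auto simp: \<psi>_def loc_vecs_def)
    ultimately show "\<psi> f \<in> ext_set I P ?b" unfolding ext_set_def by blast
  qed (use m0 in \<open>auto simp: \<phi>_def \<psi>_def fun_eq_iff algebra_simps\<close>)
  then show ?thesis unfolding eq by blast
qed

text \<open>Otherwise adjoin to the local vectors the vector with single coordinate k b_i. It lies
  in the group, since it differs from k b by a local vector. The enlarged subgroup is completely
  decomposable by \<open>ext_set_single_iso\<close> and has smaller index.\<close>

lemma least_index_pure:
  fixes G (structure) and I :: "'i set"
  assumes G: "comm_group G" and fin: "finite I" and P: "\<And>i p. i \<in> I \<Longrightarrow> p \<in> P i \<Longrightarrow> prime p"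
    and h: "h \<in> iso G (vec_group (ext_set I P b))" and hC: "h ` C = loc_vecs I P"
    and C: "C \<in> cd_finite_index_subgroups G"
      "\<And>C'. C' \<in> cd_finite_index_subgroups G \<Longrightarrow> card (rcosets C) \<le> card (rcosets C')"
    and i: "i \<in> I" and k: "\<And>j. j \<in> I \<Longrightarrow> j \<noteq> i \<Longrightarrow> of_int k * b j \<in> loc (P j)"
  shows "of_int k * b i \<in> loc (P i)"
proof (rule ccontr)
  assume no: "of_int k * b i \<notin> loc (P i)"
  interpret comm_group G by fact
  let ?v = "(\<lambda>_. 0)(i := of_int k * b i)"
  define X' where "X' = ext_set I P ?v"
  interpret X': lattice_set I X' unfolding X'_def by (rule lattice_set_ext_set[OF fin])
  have hh: "h \<in> hom G (vec_group (ext_set I P b))" and bij: "bij_betw h (carrier G) (ext_set I P b)"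
    using h by (simp_all add: iso_def)
  have X'_sub: "X' \<subseteq> ext_set I P b"
  proof
    fix f assume f: "f \<in> X'"
    obtain n where n: "\<And>j. j \<in> I \<Longrightarrow> f j - of_int n * ?v j \<in> loc (P j)" using f unfolding X'_def ext_set_def by blast
    have "f j - of_int (n * k) * b j \<in> loc (P j)" if j: "j \<in> I" for j
    proof (cases "j = i")
      case True
      then show ?thesis using n[OF i] by (simp add: mult.assoc)
    next
      case False
      have "(f j - of_int n * ?v j) - of_int n * (of_int k * b j) \<in> loc (P j)"
        by (intro loc_diff n j loc_mult[OF loc_of_int] k False)
      then show ?thesis using False by (simp add: mult.assoc)
    qed
    then show "f \<in> ext_set I P b" using X'.supp[OF f] unfolding ext_set_def by blast
  qed
  define C' where "C' = {x \<in> carrier G. h x \<in> X'}"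
  have h_one: "h \<one> = 0"
    using hom_one[OF hh is_group comm_group.axioms(2)[OF lattice_set.comm_group_vec_group[OF lattice_set_ext_set[OF fin]]]] by simp
  have h_mult: "h (x \<otimes> y) = h x + h y" if "x \<in> carrier G" "y \<in> carrier G" for x y
    using hom_mult[OF hh that] by simp
  have h_inv: "h (inv x) = - h x" if "x \<in> carrier G" for x
  proof -
    have "h (inv x) + h x = 0" using h_mult[of "inv x" x] that h_one by simp
    then show ?thesis by (simp add: eq_neg_iff_add_eq_0)
  qed
  have C': "subgroup C' G"
    by unfold_locales (auto simp: C'_def h_one h_mult h_inv X'.zero_in X'.add_in X'.minus_in)
  have CG: "subgroup C G" "finite (rcosets C)" using C(1) by (simp_all add: cd_finite_index_subgroups_def)
  have CC': "C \<subseteq> C'"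
    using hC loc_vecs_subset_ext_set[of I P ?v] subgroup.mem_carrier[OF CG(1)] by (auto simp: C'_def X'_def)
  have vX': "?v \<in> X'" unfolding X'_def ext_set_def using i by (intro CollectI conjI exI[of _ 1]) auto
  then obtain x where x: "x \<in> carrier G" "h x = ?v"
    using X'_sub bij unfolding bij_betw_def by (metis imageE subsetD)
  have "x \<in> C'" using x vX' by (simp add: C'_def)
  moreover have "x \<notin> C"
  proof
    assume "x \<in> C"
    then have "?v \<in> loc_vecs I P" using hC x(2) by (metis imageI)
    then show False using no i by (auto simp: loc_vecs_def)
  qed
  ultimately have less: "C \<subset> C'" using CC' by blast
  have "h \<in> iso (G\<lparr>carrier := C'\<rparr>) (vec_group X')"
  proof (rule isoI)
    show "h \<in> hom (G\<lparr>carrier := C'\<rparr>) (vec_group X')"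
      by (rule homI) (auto simp: C'_def h_mult)
    have "h ` C' = X'"
      using X'_sub bij unfolding C'_def bij_betw_def by (auto simp: image_iff)
    moreover have "inj_on h C'" using bij by (auto simp: bij_betw_def C'_def intro: inj_on_subset)
    ultimately show "bij_betw h (carrier (G\<lparr>carrier := C'\<rparr>)) (carrier (vec_group X'))"
      by (simp add: bij_betw_def)
  qed
  moreover obtain \<phi> where "\<phi> \<in> iso (vec_group X') (vec_group (loc_vecs I P))"
    using ext_set_single_iso[of i I P "of_int k * b i"] i P unfolding X'_def by blast
  ultimately have "completely_decomposable (G\<lparr>carrier := C'\<rparr>)"
    using completely_decomposableI[OF subgroup_comm_group[OF C'] fin] iso_set_trans by blast
  then have "C' \<in> cd_finite_index_subgroups G"
    using C' card_rcosets_less(1)[OF CG(1) C' less CG(2)] by (simp add: cd_finite_index_subgroups_def)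
  then have "card (rcosets C) \<le> card (rcosets C')" by (rule C(2))
  then show False using card_rcosets_less(2)[OF CG(1) C' less CG(2)] by simp
qed

text \<open>After reduction the extra vector has at most one nonzero coordinate in each block;
  \<open>rep\<close> selects it, or any index if there is none. \<open>frac_mod_loc\<close> provides
  numerator and denominator, and \<open>least_index_pure\<close> provides
  \<open>base_pure\<close>.\<close>

theorem class_A0_model:
  fixes G :: "('a, 'm) monoid_scheme"
  assumes G: "class_A0 G"
  shows "\<exists>(I :: 'a set set) P B m s. acd_data I P B m s \<and> G \<cong> vec_group (acd_data.X I P B m s)"
proof -
  interpret comm_group G using G by (simp add: class_A0_def ACD_group_def torsion_free_group_def)
  obtain I :: "'a set set" and P b \<Psi> where fin: "finite I" and P: "\<forall>i\<in>I. \<forall>p\<in>P i. prime p"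
    and anti: "\<forall>i\<in>I. \<forall>j\<in>I. P i \<subseteq> P j \<longrightarrow> P i = P j"
    and \<Psi>: "\<Psi> \<in> iso G (vec_group (ext_set I P b))" "\<Psi> ` regulator G = loc_vecs I P"
    using regulator_embedding[OF G] by (elim exE conjE)
  obtain b' where b': "ext_equiv I P b b'" "\<forall>i\<in>I. \<forall>j\<in>I. i \<noteq> j \<longrightarrow> P i = P j \<longrightarrow> b' i = 0 \<or> b' j = 0"
    using ext_equiv_reduced[OF fin, of P b] by (elim exE conjE)
  have reg: "regulator G \<in> cd_finite_index_subgroups G"
    "\<And>C. C \<in> cd_finite_index_subgroups G \<Longrightarrow> card (rcosets\<^bsub>G\<^esub> (regulator G)) \<le> card (rcosets\<^bsub>G\<^esub> C)"
    by (rule regulator_least_index[OF G]; assumption)+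
  obtain \<phi> where \<phi>: "\<phi> \<in> iso (vec_group (ext_set I P b)) (vec_group (ext_set I P b'))"
    "\<phi> ` loc_vecs I P = loc_vecs I P"
    using b'(1) unfolding ext_equiv_def by (elim bexE)
  obtain h where h: "h \<in> iso G (vec_group (ext_set I P b'))" "h ` regulator G = loc_vecs I P"
    by (rule that[OF iso_compose_image[OF \<Psi> \<phi>]])
  have "\<forall>t\<in>P ` I. \<exists>i. i \<in> I \<and> P i = t \<and> (\<forall>j\<in>I. P j = t \<longrightarrow> b' j \<noteq> 0 \<longrightarrow> j = i)"
  proof
    fix t assume t: "t \<in> P ` I"
    show "\<exists>i. i \<in> I \<and> P i = t \<and> (\<forall>j\<in>I. P j = t \<longrightarrow> b' j \<noteq> 0 \<longrightarrow> j = i)"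
    proof (cases "\<exists>i\<in>I. P i = t \<and> b' i \<noteq> 0")
      case True
      then obtain i where i: "i \<in> I" "P i = t" "b' i \<noteq> 0" by blast
      have "j = i" if "j \<in> I" "P j = t" "b' j \<noteq> 0" for j
        using b'(2)[THEN bspec, THEN bspec, of i j] i that by auto
      then show ?thesis using i by blast
    next
      case False
      then show ?thesis using t by blast
    qed
  qed
  from bchoice[OF this] obtain rep where rep0:
    "\<forall>t\<in>P ` I. rep t \<in> I \<and> P (rep t) = t \<and> (\<forall>j\<in>I. P j = t \<longrightarrow> b' j \<noteq> 0 \<longrightarrow> j = rep t)" ..
  have rep: "rep (P i) \<in> I" "P (rep (P i)) = P i" "b' i \<noteq> 0 \<Longrightarrow> rep (P i) = i" if "i \<in> I" for i
    using rep0[THEN bspec, of "P i"] that by auto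
  have "\<forall>t\<in>P ` I. \<exists>ms :: int \<times> int. coprime_to t (fst ms) \<and> coprime (snd ms) (fst ms) \<and>
      b' (rep t) - of_int (snd ms) / of_int (fst ms) \<in> loc t"
  proof
    fix t assume "t \<in> P ` I"
    then obtain m s where "coprime_to t m" "coprime s m" "b' (rep t) - of_int s / of_int m \<in> loc t"
      using frac_mod_loc[of t] P by blast
    then show "\<exists>ms :: int \<times> int. coprime_to t (fst ms) \<and> coprime (snd ms) (fst ms) \<and>
      b' (rep t) - of_int (snd ms) / of_int (fst ms) \<in> loc t" by (intro exI[of _ "(m, s)"]) simp
  qed
  from bchoice[OF this] obtain ms :: "nat set \<Rightarrow> int \<times> int" where ms: "\<forall>t\<in>P ` I. coprime_to t (fst (ms t)) \<and>
      coprime (snd (ms t)) (fst (ms t)) \<and> b' (rep t) - of_int (snd (ms t)) / of_int (fst (ms t)) \<in> loc t" ..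
  define m where "m = (\<lambda>t. fst (ms t))"
  define s where "s = (\<lambda>t. snd (ms t))"
  have ms: "coprime_to (P i) (m (P i))" "coprime (s (P i)) (m (P i))"
    "b' (rep (P i)) - of_int (s (P i)) / of_int (m (P i)) \<in> loc (P i)" if "i \<in> I" for i
    using ms that by (simp_all add: m_def s_def)
  define B where "B = rep ` P ` I"
  have repB: "rep (P i) = i" if "i \<in> B" for i using that rep by (auto simp: B_def)
  define g where "g = (\<lambda>i. if i \<in> B then of_int (s (P i)) / of_int (m (P i)) else (0::rat))"
  have BI: "B \<subseteq> I" using rep by (auto simp: B_def)
  have "b' i - g i \<in> loc (P i)" if i: "i \<in> I" for i
  proof (cases "i \<in> B")
    case True
    then show ?thesis using ms(3)[OF i] repB by (simp add: g_def)
  next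
    case False
    have "b' i = 0"
    proof (rule ccontr)
      assume "b' i \<noteq> 0"
      then have "rep (P i) = i" using rep(3)[OF i] by blast
      then show False using False i unfolding B_def by (metis imageI)
    qed
    then show ?thesis using False by (simp add: g_def)
  qed
  then have ext: "ext_set I P b' = ext_set I P g" by (rule ext_set_cong)
  have data: "acd_data I P B m s"
  proof
    show "inj_on P B" by (rule inj_onI) (metis repB)
    show "\<exists>j\<in>B. P j = P i" if "i \<in> I" for i using rep[OF that] that unfolding B_def by (metis imageI)
    show "m (P i) dvd k" if i: "i \<in> B" and k: "\<And>j. j \<in> B \<Longrightarrow> j \<noteq> i \<Longrightarrow> m (P j) dvd k" for i k
    proof -
      have iI: "i \<in> I" using BI i by blast
      have "of_int k * g i \<in> loc (P i)"
      proof (rule least_index_pure[OF comm_group_axioms fin _ h[unfolded ext] reg iI])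
        fix j assume j: "j \<in> I" "j \<noteq> i"
        show "of_int k * g j \<in> loc (P j)"
        proof (cases "j \<in> B")
          case True
          then have "m (P j) dvd k * s (P j)" using k j by simp
          then have "of_int (k * s (P j)) / of_int (m (P j)) \<in> loc (P j)"
            using loc_frac_iff[OF ms(1)[OF j(1)]] by blast
          then show ?thesis using True by (simp add: g_def)
        qed (simp add: g_def)
      qed (use P in blast)
      then have "of_int (k * s (P i)) / of_int (m (P i)) \<in> loc (P i)" using i by (simp add: g_def)
      then have "m (P i) dvd k * s (P i)" using loc_frac_iff[OF ms(1)[OF iI]] by blast
      then show ?thesis using ms(2)[OF iI] by (simp add: coprime_dvd_mult_left_iff coprime_commute)
    qed
  qed (use fin P anti BI ms in blast)+
  have "acd_data.X I P B m s = ext_set I P g"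
    unfolding acd_data.X_def[OF data] acd_data.gen_def[OF data] g_def ..
  then have "G \<cong> vec_group (acd_data.X I P B m s)" using h(1) ext by (metis is_isoI)
  then show ?thesis using data by blast
qed

section \<open>Multiplication groups determine the groups\<close>

lemma iso_imp_equivalent_data:
  assumes A: "acd_data I P B m s" and A': "acd_data I' P' B' m' s'"
    and iso: "vec_group (acd_data.X I P B m s) \<cong> vec_group (acd_data.X I' P' B' m' s')"
  shows "equivalent_data I P m s I' P' m' s'"
proof -
  interpret A: acd_data I P B m s by fact
  interpret A': acd_data I' P' B' m' s' by fact
  obtain \<phi> where \<phi>: "\<phi> \<in> iso (vec_group A.X) (vec_group A'.X)" using iso by (auto simp: is_iso_def)
  define \<psi> where "\<psi> = inv_into A.X \<phi>"
  have \<psi>: "\<psi> \<in> iso (vec_group A'.X) (vec_group A.X)"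
    using group.iso_set_sym[OF comm_group.axioms(2)[OF A.comm_group_vec_group] \<phi>] by (simp add: \<psi>_def)
  have bij: "bij_betw \<phi> A.X A'.X" using \<phi> by (simp add: iso_def)
  have hom: "\<phi> \<in> hom (vec_group A.X) (vec_group A'.X)" "\<psi> \<in> hom (vec_group A'.X) (vec_group A.X)"
    using \<phi> \<psi> by (simp_all add: iso_def)
  interpret acd_iso I P B m s I' P' B' m' s' \<phi> \<psi>
  proof
    show "\<phi> x \<in> A'.X" if "x \<in> A.X" for x using hom_in_carrier[OF hom(1)] that by simp
    show "\<psi> y \<in> A.X" if "y \<in> A'.X" for y using hom_in_carrier[OF hom(2)] that by simp
    show "\<phi> (x + x') = \<phi> x + \<phi> x'" if "x \<in> A.X" "x' \<in> A.X" for x x' using hom_mult[OF hom(1)] that by simp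
    show "\<psi> (y + y') = \<psi> y + \<psi> y'" if "y \<in> A'.X" "y' \<in> A'.X" for y y' using hom_mult[OF hom(2)] that by simp
    show "\<psi> (\<phi> x) = x" if "x \<in> A.X" for x using bij that by (simp add: \<psi>_def bij_betw_def)
    show "\<phi> (\<psi> y) = y" if "y \<in> A'.X" for y using bij that by (simp add: \<psi>_def bij_betw_def f_inv_into_f)
  qed
  show ?thesis by (rule equivalent)
qed

text \<open>Multiplying u r = k r' modulo m by l s s'/u gives s/u = l s'. So the unit and the common
  factor are replaced by their inverses, and the block sizes are recovered as cube roots.\<close>

lemma equivalent_data_cube:
  assumes A: "acd_cube I P B m s r" and A': "acd_cube I' P' B' m' s' r'"
    and eq: "equivalent_data (acd_data.I3 I P) (acd_data.P3 P) m r (acd_data.I3 I' P') (acd_data.P3 P') m' r'"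
  shows "equivalent_data I P m s I' P' m' s'"
proof -
  interpret A: acd_cube I P B m s r by fact
  interpret A': acd_cube I' P' B' m' s' r' by fact
  note eq' = eq[unfolded equivalent_data_def A.image_P3 A'.image_P3 A.card_cube_block A'.card_cube_block]
  have img: "P ` I = P' ` I'" by (rule eq'[THEN conjunct1])
  have card: "card {i\<in>I. P i = t} = card {i\<in>I'. P' i = t}" and mm: "m t = m' t" if "t \<in> P ` I" for t
  proof -
    note h = eq'[THEN conjunct2, THEN conjunct1, THEN bspec, OF that]
    show "card {i\<in>I. P i = t} = card {i\<in>I'. P' i = t}"
      by (rule power_eq_imp_eq_base[OF h[THEN conjunct1]]) simp_all
    show "m t = m' t" by (rule h[THEN conjunct2])
  qed
  obtain k l where kl0: "\<forall>t\<in>P ` I. m t dvd 1 - k * l \<and> (card {i\<in>I. P i = t} ^ 3 = 1 \<longrightarrow>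
         unit_multiple t (of_int (r t) / of_int (m t)) (of_int k * (of_int (r' t) / of_int (m t))))"
    using eq'[THEN conjunct2, THEN conjunct2] by (elim exE)
  have main: "m t dvd 1 - l * k \<and> (card {i\<in>I. P i = t} = 1 \<longrightarrow>
         unit_multiple t (of_int (s t) / of_int (m t)) (of_int l * (of_int (s' t) / of_int (m t))))"
    if t: "t \<in> P ` I" for t
  proof (intro conjI impI)
    note h = kl0[THEN bspec, OF t]
    have kl: "m t dvd 1 - k * l" by (rule h[THEN conjunct1])
    then show "m t dvd 1 - l * k" by (simp add: mult.commute)
    assume "card {i\<in>I. P i = t} = 1"
    then have "card {i\<in>I. P i = t} ^ 3 = 1" by simp
    from h[THEN conjunct2, THEN mp, OF this, unfolded unit_multiple_def] obtain u where u: "u \<in> loc t" "u \<noteq> 0" "1 / u \<in> loc t"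
      "u * (of_int (r t) / of_int (m t)) - of_int k * (of_int (r' t) / of_int (m t)) \<in> loc t"
      by (elim bexE conjE)
    obtain i where i: "i \<in> I" "t = P i" using t by blast
    obtain j where j: "j \<in> I'" "t = P' j" using t img by blast
    have m0: "of_int (m t) \<noteq> (0::rat)" using A.den_pos[OF i(1)] i(2) by simp
    let ?m = "of_int (m t) :: rat"
    obtain x where "1 - s t * r t = m t * x" using A.inverse[OF i(1)] i(2) by blast
    then have "of_int (1 - s t * r t) = (of_int (m t * x) :: rat)" by (rule arg_cong)
    then have x: "of_int (s t) * of_int (r t) = 1 - ?m * of_int x" by simp
    obtain y where "1 - s' t * r' t = m t * y" using A'.inverse[OF j(1)] j(2) mm[OF t] by auto
    then have "of_int (1 - s' t * r' t) = (of_int (m t * y) :: rat)" by (rule arg_cong)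
    then have y: "of_int (s' t) * of_int (r' t) = 1 - ?m * of_int y" by simp
    obtain z where "1 - k * l = m t * z" using kl by blast
    then have "of_int (1 - k * l) = (of_int (m t * z) :: rat)" by (rule arg_cong)
    then have z: "of_int k * of_int l = 1 - ?m * of_int z" by simp
    define v where "v = 1 / u"
    have v: "v \<in> loc t" "v * u = 1" "v \<noteq> 0" "1 / v = u" using u by (simp_all add: v_def)
    let ?e = "of_int (s t) / ?m" and ?f = "of_int (s' t) / ?m"
    let ?w = "u * (of_int (r t) / ?m) - of_int k * (of_int (r' t) / ?m)"
    \<comment> \<open>The error in cancelling the two inverse pairs: s (k l) (s' r') = s - m
      c.\<close>
    define c where "c = of_int (s t) * (of_int y + of_int z - ?m * of_int z * of_int y)"
    have cloc: "c \<in> loc t"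
    proof -
      have "c = of_int (s t * (y + z - m t * z * y))" by (simp add: c_def)
      then show ?thesis by (simp only: loc_of_int)
    qed
    have "v * (of_int l * of_int (s t) * of_int (s' t)) * ?w =
        (v * u) * of_int l * (of_int (s t) * of_int (r t)) * ?f -
        v * (of_int k * of_int l) * (of_int (s' t) * of_int (r' t)) * ?e"
      by (simp add: field_simps)
    also have "\<dots> = of_int l * ?f - of_int (l * x * s' t) - (v * ?e - v * c)"
      unfolding v(2) x y z c_def using m0 by (simp add: field_simps)
    finally have "v * ?e - of_int l * ?f =
        v * c - of_int (l * x * s' t) - v * of_int (l * s t * s' t) * ?w"
      by (simp add: algebra_simps)
    also have "\<dots> \<in> loc t"
      by (intro loc_diff loc_mult[OF v(1) cloc] loc_of_int loc_mult[OF loc_mult[OF v(1) loc_of_int] u(4)])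
    finally show "unit_multiple t ?e (of_int l * ?f)"
      unfolding unit_multiple_def using v u(1) by (intro bexI[of _ v]) simp_all
  qed
  show ?thesis
    unfolding equivalent_data_def
  proof (rule conjI[OF img], rule conjI)
    show "\<forall>t\<in>P ` I. card {i\<in>I. P i = t} = card {i\<in>I'. P' i = t} \<and> m t = m' t"
      by (intro ballI conjI card mm)
    show "\<exists>k l. \<forall>t\<in>P ` I. m t dvd 1 - k * l \<and> (card {i\<in>I. P i = t} = 1 \<longrightarrow>
         unit_multiple t (of_int (s t) / of_int (m t)) (of_int k * (of_int (s' t) / of_int (m t))))"
      by (rule exI[of _ l], rule exI[of _ k], rule ballI, rule main)
  qed
qed

text \<open>Both isomorphisms refer to the same data, so that invariants of \<open>Mult G\<close>
  speak about this model of \<open>G\<close>.\<close>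

lemma class_A0_Mult_model:
  fixes G :: "('a, 'm) monoid_scheme"
  assumes G: "class_A0 G"
  shows "\<exists>(I :: 'a set set) P B m s r. acd_cube I P B m s r \<and> G \<cong> vec_group (acd_data.X I P B m s) \<and>
    Mult G \<cong> vec_group (acd_data.X (acd_data.I3 I P) (acd_data.P3 P) (acd_data.B3 B) m r)"
proof -
  have comm: "comm_group G" using G by (simp add: class_A0_def ACD_group_def torsion_free_group_def)
  obtain I :: "'a set set" and P B m s where data: "acd_data I P B m s"
    and iso: "G \<cong> vec_group (acd_data.X I P B m s)"
    using class_A0_model[OF G] by blast
  interpret acd_data I P B m s by (rule data)
  have "\<forall>t\<in>P ` I. \<exists>r. m t dvd 1 - s t * r"
    using num_coprime coprime_inverse_int by (metis imageE)
  from bchoice[OF this] obtain r where r: "\<forall>t\<in>P ` I. m t dvd 1 - s t * r t" ..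
  interpret acd_cube I P B m s r by unfold_locales (use r in blast)
  have "Mult G \<cong> bilinear_group G" by (rule Mult_iso_bilinear_group[OF comm])
  also have "bilinear_group G \<cong> bilinear_group (vec_group X)"
    by (rule bilinear_group_cong[OF comm_group.axioms(2)[OF comm] comm_group.axioms(2)[OF comm_group_vec_group] iso])
  also have "bilinear_group (vec_group X) \<cong> vec_group cube.X" by (rule bilinear_group_iso_cube)
  finally (iso_trans) have "Mult G \<cong> vec_group cube.X" .
  then show ?thesis using iso acd_cube_axioms by blast
qed

theorem theorem3p5:
  fixes G :: "('a, 'm) monoid_scheme" and H :: "('b, 'n) monoid_scheme"
  assumes "class_A0 G" and "class_A0 H"
  shows "G \<cong> H \<longleftrightarrow> Mult G \<cong> Mult H"
proof -
  have comm: "comm_group G" "comm_group H"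
    using assms by (simp_all add: class_A0_def ACD_group_def torsion_free_group_def)
  have grp: "group G" "group H" using comm by (simp_all add: comm_group.axioms(2))
  have Mult: "group (Mult G)" "group (Mult H)"
    unfolding Mult_def
    by (rule comm_group.axioms(2)[OF comm_group_hom_group[OF group_tensor_product[OF grp(1) grp(1)] comm(1)]])
       (rule comm_group.axioms(2)[OF comm_group_hom_group[OF group_tensor_product[OF grp(2) grp(2)] comm(2)]])
  show ?thesis
  proof
    assume "G \<cong> H"
    then have "bilinear_group G \<cong> bilinear_group H" by (rule bilinear_group_cong[OF grp])
    then have 1: "Mult G \<cong> bilinear_group H" by (rule iso_trans[OF Mult_iso_bilinear_group[OF comm(1)]])
    have "bilinear_group H \<cong> Mult H"
      by (rule group.iso_sym[OF Mult(2) Mult_iso_bilinear_group[OF comm(2)]])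
    with 1 show "Mult G \<cong> Mult H" by (rule iso_trans)
  next
    assume M: "Mult G \<cong> Mult H"
    obtain I :: "'a set set" and P B m s r where A: "acd_cube I P B m s r" "G \<cong> vec_group (acd_data.X I P B m s)"
      "Mult G \<cong> vec_group (acd_data.X (acd_data.I3 I P) (acd_data.P3 P) (acd_data.B3 B) m r)"
      using class_A0_Mult_model[OF assms(1)] by (elim exE conjE)
    obtain I' :: "'b set set" and P' B' m' s' r' where A': "acd_cube I' P' B' m' s' r'"
      "H \<cong> vec_group (acd_data.X I' P' B' m' s')"
      "Mult H \<cong> vec_group (acd_data.X (acd_data.I3 I' P') (acd_data.P3 P') (acd_data.B3 B') m' r')"
      using class_A0_Mult_model[OF assms(2)] by (elim exE conjE)
    interpret A: acd_cube I P B m s r by (rule A(1))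
    interpret A': acd_cube I' P' B' m' s' r' by (rule A'(1))
    have "vec_group A.cube.X \<cong> Mult G" by (rule group.iso_sym[OF Mult(1) A(3)])
    then have "vec_group A.cube.X \<cong> vec_group A'.cube.X" by (rule iso_trans[OF iso_trans[OF _ M] A'(3)])
    then have "equivalent_data A.I3 A.P3 m r A'.I3 A'.P3 m' r'"
      by (rule iso_imp_equivalent_data[OF A.cube.acd_data_axioms A'.cube.acd_data_axioms])
    then have "equivalent_data I P m s I' P' m' s'" by (rule equivalent_data_cube[OF A(1) A'(1)])
    then have iso: "vec_group A.X \<cong> vec_group A'.X"
      by (rule equivalent_data_imp_iso[OF A.acd_data_axioms A'.acd_data_axioms])
    have "vec_group A'.X \<cong> H" by (rule group.iso_sym[OF grp(2) A'(2)])
    then show "G \<cong> H" by (rule iso_trans[OF iso_trans[OF A(2) iso]])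
  qed
qed

end
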